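(* For every $n\ge2$, the minimal projective wonderful model of the noncommutative braid arrangement is isomorphic to the brick manifold: $$\widehat Y_{ncA_{n-1},\min}\cong\mathcal B(\underline n).$$
   Context: Work over a field $\Bbbk$; $\underline n=\{1<2<\dots<n\}$. Wonderful models. Let $V$ be a finite-dimensional vector space and $\mathcal G$ a building set of subspaces of $V^*$: that is, $\mathcal G$ is a finite set of nonzero subspaces equal to the set of all $\mathcal G$-indecomposable elements of the lattice $L_{\mathcal G}$ of sums of elements of $\mathcal G$, where a $\mathcal G$-decomposition of $U\in L_{\mathcal G}$ is a family of nonzero $U_i\in L_{\mathcal G}$ with $U=\bigoplus U_i$ such that each $G\in\mathcal G$ with $G\subset U$ lies in some $U_i$. For $G\subset V^*$ let $G^\perp\subset V$ be its annihilator. Let $\widehat M_{\mathcal G}=\mathbb P(V)\setminus\bigcup_{G\in\mathcal G}\mathbb P(G^\perp)$. The projective wonderful model $\widehat Y_{\mathcal G}$ is the closure of the image of the natural map $\widehat M_{\mathcal G}\to\mathbb P(V)\times\prod_{G\in\mathcal G}\mathbb P(V/G^\perp)$. Noncommutative braid arrangement. Let $x_1,\dots,x_n$ be the coordinate functions on $\Bbbk^n$ and $N=\Bbbk(1,\dots,1)$, $V=\Bbbk^n/N$, so $V^*\subset(\Bbbk^n)^*$. The arrangement $ncA_{n-1}$ consists of the lines $H_{i,i+1}=\mathrm{span}(x_i-x_{i+1})\subset V^*$, $1\le i<i+1\le n$. Its minimal building set consists of all $H_I=\sum_{i,i+1\in I}H_{i,i+1}$ for intervals $I\subset\underline n$ with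 $|I|\ge2$; the corresponding projective wonderful model is $\widehat Y_{ncA_{n-1},\min}$. Brick manifold. $G(\underline n)$ is the vector space with basis $e_{1,2},\dots,e_{n-1,n}$; for $1\le a\le b\le n$, $G(a,b)=\mathrm{span}(e_{a,a+1},\dots,e_{b-1,b})$. A point of $\mathcal B(\underline n)$ is a collection of subspaces $V_{i,j}\subset G(\underline n)$, one for each proper interval $[i,j]\subsetneq\underline n$, such that $\dim V_{i,j}=j-i+1$; $V_{i,j}\subset V_{i-1,j}$ and $V_{i,j}\subset V_{i,j+1}$ whenever the larger interval is a proper interval of $\underline n$; $V_{1,j}=G(1,j+1)$; $V_{i,n}=G(i-1,n)$. It is a closed subvariety of a product of Grassmannians. *)

theory Defs
  imports
    "HOL-Algebra.Algebraic_Closure_Type"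
    "HOL-Library.Function_Algebras"
    "HOL-Library.FuncSet"
begin

section \<open>Varieties over a field, in homogeneous coordinates\<close>

text \<open>
  The ground field is an arbitrary type \<open>'k\<close> of class \<open>field\<close>. A (reduced) variety over \<open>'k\<close> is
  represented by its set of points over the algebraic closure of \<open>'k\<close>, together with the Zariski
  topology and the sheaf of regular functions defined by polynomials with coefficients in \<open>'k\<close>.

  \<open>polys\<close> is the set of polynomial functions with coefficients in \<open>'k\<close>, on the affine space over
  the algebraic closure with coordinates indexed by \<open>'i\<close>.
\<close>

inductive_set polys :: "(('i \<Rightarrow> 'k::field alg_closure) \<Rightarrow> 'k alg_closure) set" where
  const: "(\<lambda>_. to_ac c) \<in> polys"
| coord: "(\<lambda>x. x i) \<in> polys"
| add: "p \<in> polys \<Longrightarrow> q \<in> polys \<Longrightarrow> (\<lambda>x. p x + q x) \<in> polys"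
| mult: "p \<in> polys \<Longrightarrow> q \<in> polys \<Longrightarrow> (\<lambda>x. p x * q x) \<in> polys"

text \<open>
  A variety is presented as the quotient of a set of admissible systems of homogeneous coordinates
  by the relation of representing the same point, just as projective space is the quotient of the
  nonzero vectors by scaling, and a Grassmannian the quotient of the \<open>d\<close>-frames by change of frame.
  Topology and regular functions are those of the quotient: they are tested on coordinates.
  In the two cases used below (products of projective spaces, products of Grassmannians, and their
  subvarieties) the quotient map has regular local sections defined over \<open>'k\<close>, so this is the
  usual structure, and for subvarieties it is the induced reduced one.
\<close>

record (overloaded) ('i, 'k::field, 'p) variety =
  hcoords :: "('i \<Rightarrow> 'k alg_closure) set"
  point_of :: "('i \<Rightarrow> 'k alg_closure) \<Rightarrow> 'p"

definition points :: "('i, 'k::field, 'p) variety \<Rightarrow> 'p set" where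
  "points M = point_of M ` hcoords M"

definition zariski_closed :: "('i, 'k::field, 'p) variety \<Rightarrow> 'p set \<Rightarrow> bool" where
  "zariski_closed M C \<longleftrightarrow> C \<subseteq> points M \<and>
     (\<exists>F \<subseteq> polys. \<forall>x \<in> hcoords M. point_of M x \<in> C \<longleftrightarrow> (\<forall>f\<in>F. f x = 0))"

definition zariski_open :: "('i, 'k::field, 'p) variety \<Rightarrow> 'p set \<Rightarrow> bool" where
  "zariski_open M U \<longleftrightarrow> U \<subseteq> points M \<and> zariski_closed M (points M - U)"

definition zariski_closure :: "('i, 'k::field, 'p) variety \<Rightarrow> 'p set \<Rightarrow> 'p set" where
  "zariski_closure M S = \<Inter> {C. zariski_closed M C \<and> S \<subseteq> C}"

text \<open>Functions on an open set that are locally quotients of polynomials in the coordinates.\<close>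

definition regular_on ::
  "('i, 'k::field, 'p) variety \<Rightarrow> 'p set \<Rightarrow> ('p \<Rightarrow> 'k alg_closure) \<Rightarrow> bool" where
  "regular_on M U f \<longleftrightarrow> zariski_open M U \<and>
     (\<forall>x \<in> hcoords M. point_of M x \<in> U \<longrightarrow>
        (\<exists>p \<in> polys. \<exists>q \<in> polys. q x \<noteq> 0 \<and>
           (\<forall>y \<in> hcoords M. point_of M y \<in> U \<and> q y \<noteq> 0 \<longrightarrow> f (point_of M y) = p y / q y)))"

text \<open>
  Continuity is part of this definition, because the function \<open>0\<close> is regular on every open set.
\<close>

definition morphism ::
  "('i, 'k::field, 'p) variety \<Rightarrow> ('j, 'k, 'q) variety \<Rightarrow> ('p \<Rightarrow> 'q) \<Rightarrow> bool" where
  "morphism M M' \<phi> \<longleftrightarrow> \<phi> \<in> points M \<rightarrow> points M' \<and>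
     (\<forall>U f. regular_on M' U f \<longrightarrow> regular_on M (\<phi> -` U \<inter> points M) (f \<circ> \<phi>))"

definition isomorphic :: "('i, 'k::field, 'p) variety \<Rightarrow> ('j, 'k, 'q) variety \<Rightarrow> bool" where
  "isomorphic M M' \<longleftrightarrow> (\<exists>\<phi> \<psi>. morphism M M' \<phi> \<and> morphism M' M \<psi> \<and>
     (\<forall>x \<in> points M. \<psi> (\<phi> x) = x) \<and> (\<forall>y \<in> points M'. \<phi> (\<psi> y) = y))"

definition subvariety :: "('i, 'k::field, 'p) variety \<Rightarrow> 'p set \<Rightarrow> ('i, 'k, 'p) variety" where
  "subvariety M Z = \<lparr>hcoords = {x \<in> hcoords M. point_of M x \<in> Z}, point_of = point_of M\<rparr>"


section \<open>Coordinate vector spaces\<close>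

definition scl :: "'a::field \<Rightarrow> ('i \<Rightarrow> 'a) \<Rightarrow> 'i \<Rightarrow> 'a" where
  "scl c v = (\<lambda>i. c * v i)"

global_interpretation vs: vector_space "scl :: 'a::field \<Rightarrow> ('i \<Rightarrow> 'a) \<Rightarrow> 'i \<Rightarrow> 'a"
  by unfold_locales (auto simp: scl_def fun_eq_iff algebra_simps)

text \<open>The space of vectors with \<open>n\<close> coordinates, numbered from \<open>1\<close> to \<open>n\<close>, and its standard basis.\<close>

definition vecs :: "nat \<Rightarrow> (nat \<Rightarrow> 'a::field) set" where
  "vecs n = {x. \<forall>i. i \<notin> {1..n} \<longrightarrow> x i = 0}"

definition std :: "nat \<Rightarrow> nat \<Rightarrow> 'a::field" where
  "std i = (\<lambda>j. if j = i then 1 else 0)"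

text \<open>The component with index \<open>j\<close> of a family of vectors.\<close>

definition comp_at :: "('j \<times> 'r \<Rightarrow> 'a) \<Rightarrow> 'j \<Rightarrow> 'r \<Rightarrow> 'a" where
  "comp_at z j = (\<lambda>r. z (j, r))"


section \<open>Products of projective spaces of quotient spaces\<close>

text \<open>
  Elements of a quotient by a subspace \<open>U\<close> are cosets of \<open>U\<close>; points of a projective space are lines.
  For \<open>U \<subseteq> W\<close>, \<open>proj_space W U\<close> is the projective space of \<open>W / U\<close>.
\<close>

definition coset_of :: "('i \<Rightarrow> 'a::field) set \<Rightarrow> ('i \<Rightarrow> 'a) \<Rightarrow> ('i \<Rightarrow> 'a) set" where
  "coset_of U x = {y. y - x \<in> U}"

definition line_of :: "('i \<Rightarrow> 'a::field) set \<Rightarrow> ('i \<Rightarrow> 'a) \<Rightarrow> ('i \<Rightarrow> 'a) set set" where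
  "line_of U x = range (\<lambda>c. coset_of U (scl c x))"

definition proj_space ::
  "('i \<Rightarrow> 'a::field) set \<Rightarrow> ('i \<Rightarrow> 'a) set \<Rightarrow> ('i \<Rightarrow> 'a) set set set" where
  "proj_space W U = line_of U ` (W - U)"

text \<open>
  The map on lines induced by the further quotient by a larger subspace \<open>U\<close>: a coset of the smaller
  subspace goes to the coset of \<open>U\<close> containing it.
\<close>

definition quot_line :: "('i \<Rightarrow> 'a::field) set \<Rightarrow> ('i \<Rightarrow> 'a) set set \<Rightarrow> ('i \<Rightarrow> 'a) set set" where
  "quot_line U l = (\<lambda>a. \<Union>x\<in>a. coset_of U x) ` l"

text \<open>
  The product over \<open>j \<in> J\<close> of the projective spaces of \<open>vecs n / U j\<close>. Homogeneous coordinates of a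
  point of such a factor are the coordinates of any vector lifting a generator of the line.
\<close>

definition proj_prod :: "nat \<Rightarrow> 'j set \<Rightarrow> ('j \<Rightarrow> (nat \<Rightarrow> 'k::field alg_closure) set) \<Rightarrow>
    ('j \<times> nat, 'k, 'j \<Rightarrow> (nat \<Rightarrow> 'k alg_closure) set set) variety" where
  "proj_prod n J U =
     \<lparr>hcoords = {z. \<forall>j. if j \<in> J then comp_at z j \<in> vecs n - U j else comp_at z j = 0},
      point_of = (\<lambda>z. \<lambda>j\<in>J. line_of (U j) (comp_at z j))\<rparr>"


section \<open>Building sets and projective wonderful models\<close>

text \<open>
  We take \<open>V = vecs n / N\<close> for a subspace \<open>N\<close> (every finite-dimensional space is of this form).
  The dual of \<open>vecs n\<close> is identified with \<open>vecs n\<close>, a functional being given by its coefficients,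
  so that \<open>std i\<close> is the \<open>i\<close>-th coordinate function; the dual of \<open>V\<close> consists of the functionals
  vanishing on \<open>N\<close>.
\<close>

definition dual_quot :: "nat \<Rightarrow> (nat \<Rightarrow> 'k::field) set \<Rightarrow> (nat \<Rightarrow> 'k) set" where
  "dual_quot n N = {\<phi> \<in> vecs n. \<forall>v\<in>N. (\<Sum>i=1..n. \<phi> i * v i) = 0}"

text \<open>The lattice of all sums of subfamilies of \<open>\<G>\<close>.\<close>

definition sum_lattice :: "('i \<Rightarrow> 'k::field) set set \<Rightarrow> ('i \<Rightarrow> 'k) set set" where
  "sum_lattice \<G> = {vs.span (\<Union>\<A>) | \<A>. \<A> \<subseteq> \<G>}"

definition direct_sum_decomp :: "('i \<Rightarrow> 'k::field) set set \<Rightarrow> ('i \<Rightarrow> 'k) set \<Rightarrow> bool" where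
  "direct_sum_decomp \<U> U \<longleftrightarrow> finite \<U> \<and> vs.span (\<Union>\<U>) = U \<and>
     (\<forall>W\<in>\<U>. W \<inter> vs.span (\<Union>(\<U> - {W})) = {0})"

text \<open>The summands of a decomposition are nonzero, hence distinct, and form a set.\<close>

definition decomposition ::
  "('i \<Rightarrow> 'k::field) set set \<Rightarrow> ('i \<Rightarrow> 'k) set \<Rightarrow> ('i \<Rightarrow> 'k) set set \<Rightarrow> bool" where
  "decomposition \<G> U \<U> \<longleftrightarrow> \<U> \<subseteq> sum_lattice \<G> - {{0}} \<and> direct_sum_decomp \<U> U \<and>
     (\<forall>G\<in>\<G>. G \<subseteq> U \<longrightarrow> (\<exists>W\<in>\<U>. G \<subseteq> W))"

definition indecomposable :: "('i \<Rightarrow> 'k::field) set set \<Rightarrow> ('i \<Rightarrow> 'k) set \<Rightarrow> bool" where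
  "indecomposable \<G> U \<longleftrightarrow> U \<in> sum_lattice \<G> \<and> U \<noteq> {0} \<and>
     (\<forall>\<U>. decomposition \<G> U \<U> \<longrightarrow> \<U> = {U})"

definition building_set :: "('i \<Rightarrow> 'k::field) set \<Rightarrow> ('i \<Rightarrow> 'k) set set \<Rightarrow> bool" where
  "building_set D \<G> \<longleftrightarrow> finite \<G> \<and> (\<forall>G\<in>\<G>. vs.subspace G \<and> G \<subseteq> D \<and> G \<noteq> {0}) \<and>
     \<G> = {U. indecomposable \<G> U}"

text \<open>
  Extension of scalars of a subspace to the algebraic closure, and the subspace of vectors over the
  algebraic closure annihilated by a set of functionals over \<open>'k\<close>. If \<open>G \<subseteq> dual_quot n N\<close>, then
  \<open>annihilator n G\<close> is the preimage in \<open>vecs n\<close> of the annihilator of \<open>G\<close> in \<open>vecs n / N\<close>; the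
  quotient of the latter space by that annihilator is therefore \<open>vecs n / annihilator n G\<close>.
\<close>

definition base_change :: "('i \<Rightarrow> 'k::field) set \<Rightarrow> ('i \<Rightarrow> 'k alg_closure) set" where
  "base_change N = vs.span ((\<lambda>v. to_ac \<circ> v) ` N)"

definition annihilator :: "nat \<Rightarrow> (nat \<Rightarrow> 'k::field) set \<Rightarrow> (nat \<Rightarrow> 'k alg_closure) set" where
  "annihilator n G = {x \<in> vecs n. \<forall>\<phi>\<in>G. (\<Sum>i=1..n. to_ac (\<phi> i) * x i) = 0}"

text \<open>
  The factor with index \<open>None\<close> is the projective space of \<open>V\<close>; the factor with index \<open>Some G\<close> is
  the projective space of the quotient of \<open>V\<close> by the annihilator of \<open>G\<close>.
\<close>

fun factor_kernel ::
  "nat \<Rightarrow> (nat \<Rightarrow> 'k::field) set \<Rightarrow> (nat \<Rightarrow> 'k) set option \<Rightarrow> (nat \<Rightarrow> 'k alg_closure) set" where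
  "factor_kernel n N None = base_change N"
| "factor_kernel n N (Some G) = annihilator n G"

definition wonderful_index :: "(nat \<Rightarrow> 'k::field) set set \<Rightarrow> (nat \<Rightarrow> 'k) set option set" where
  "wonderful_index \<G> = insert None (Some ` \<G>)"

definition wonderful_ambient :: "nat \<Rightarrow> (nat \<Rightarrow> 'k::field) set \<Rightarrow> (nat \<Rightarrow> 'k) set set \<Rightarrow>
    ((nat \<Rightarrow> 'k) set option \<times> nat, 'k,
     (nat \<Rightarrow> 'k) set option \<Rightarrow> (nat \<Rightarrow> 'k alg_closure) set set) variety" where
  "wonderful_ambient n N \<G> = proj_prod n (wonderful_index \<G>) (factor_kernel n N)"

definition proj_complement :: "nat \<Rightarrow> (nat \<Rightarrow> 'k::field) set \<Rightarrow> (nat \<Rightarrow> 'k) set set \<Rightarrow>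
    (nat \<Rightarrow> 'k alg_closure) set set set" where
  "proj_complement n N \<G> =
     proj_space (vecs n) (base_change N) -
     (\<Union>G\<in>\<G>. proj_space (annihilator n G) (base_change N))"

definition natural_map :: "nat \<Rightarrow> (nat \<Rightarrow> 'k::field) set set \<Rightarrow>
    (nat \<Rightarrow> 'k alg_closure) set set \<Rightarrow>
    (nat \<Rightarrow> 'k) set option \<Rightarrow> (nat \<Rightarrow> 'k alg_closure) set set" where
  "natural_map n \<G> l =
     (\<lambda>j\<in>wonderful_index \<G>. case j of None \<Rightarrow> l | Some G \<Rightarrow> quot_line (annihilator n G) l)"

definition wonderful_model :: "nat \<Rightarrow> (nat \<Rightarrow> 'k::field) set \<Rightarrow> (nat \<Rightarrow> 'k) set set \<Rightarrow>
    ((nat \<Rightarrow> 'k) set option \<times> nat, 'k,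
     (nat \<Rightarrow> 'k) set option \<Rightarrow> (nat \<Rightarrow> 'k alg_closure) set set) variety" where
  "wonderful_model n N \<G> =
     subvariety (wonderful_ambient n N \<G>)
       (zariski_closure (wonderful_ambient n N \<G>) (natural_map n \<G> ` proj_complement n N \<G>))"


section \<open>The noncommutative braid arrangement\<close>

definition diag :: "nat \<Rightarrow> (nat \<Rightarrow> 'k::field) set" where
  "diag n = vs.span {\<lambda>i. if i \<in> {1..n} then 1 else 0}"

definition ncA_line :: "nat \<Rightarrow> (nat \<Rightarrow> 'k::field) set" where
  "ncA_line i = vs.span {std i - std (Suc i)}"

definition ncA_space :: "nat set \<Rightarrow> (nat \<Rightarrow> 'k::field) set" where
  "ncA_space I = vs.span (\<Union> {ncA_line i | i. i \<in> I \<and> Suc i \<in> I})"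

definition ncA_min :: "nat \<Rightarrow> (nat \<Rightarrow> 'k::field) set set" where
  "ncA_min n = {ncA_space {a..b} | a b. 1 \<le> a \<and> a < b \<and> b \<le> n}"

text \<open>
  The collection \<open>ncA_min n\<close> is a building set of subspaces of the dual of \<open>vecs n / diag n\<close>.
\<close>

lemma ncA_space_Icc:
  "ncA_space {a..b} = vs.span ((\<lambda>i. std i - std (Suc i)) ` {a..<b})"
  unfolding ncA_space_def ncA_line_def
proof (subst vs.span_eq, intro conjI subsetI)
  fix x :: "nat \<Rightarrow> 'a"
  assume "x \<in> \<Union> {vs.span {std i - std (Suc i)} |i. i \<in> {a..b} \<and> Suc i \<in> {a..b}}"
  then obtain i where "i \<in> {a..b} \<and> Suc i \<in> {a..b}"
      and i2: "x \<in> vs.span {std i - std (Suc i)}"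
    by blast
  hence i1: "i \<in> {a..<b}" by auto
  have "vs.span {std i - std (Suc i)} \<subseteq>
      vs.span ((\<lambda>i. std i - std (Suc i) :: nat \<Rightarrow> 'a) ` {a..<b})"
    using i1 by (intro vs.span_mono) auto
  with i2 show "x \<in> vs.span ((\<lambda>i. std i - std (Suc i)) ` {a..<b})" by blast
next
  fix x :: "nat \<Rightarrow> 'a"
  assume "x \<in> (\<lambda>i. std i - std (Suc i)) ` {a..<b}"
  then obtain i where i: "i \<in> {a..<b}" "x = std i - std (Suc i)" by auto
  hence "x \<in> vs.span {std i - std (Suc i)}" by (simp add: vs.span_base)
  with i(1) have "x \<in> \<Union> {vs.span {std i - std (Suc i)} |i. i \<in> {a..b} \<and> Suc i \<in> {a..b}}"
    by force
  thus "x \<in> vs.span (\<Union> {vs.span {std i - std (Suc i)} |i. i \<in> {a..b} \<and> Suc i \<in> {a..b}})"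
    by (rule vs.span_base)
qed

lemma partial_sum_diff_std:
  "(\<Sum>j\<le>i. (std k - std (Suc k)) j) = (if i = k then 1 else (0::'a::field))"
  by (auto simp: std_def sum_subtractf sum.delta)

lemma partial_sum_in_span:
  assumes "v \<in> vs.span ((\<lambda>i. std i - std (Suc i) :: nat \<Rightarrow> 'a::field) ` S)" "i \<notin> S"
  shows "(\<Sum>j\<le>i. v j) = 0"
  using assms(1)
proof (induction rule: vs.span_induct_alt)
  case base
  show ?case by simp
next
  case (step c x y)
  then obtain k where "k \<in> S" "x = std k - std (Suc k)" by auto
  with assms(2) have "(\<Sum>j\<le>i. x j) = 0"
    using partial_sum_diff_std[where 'a='a, of k i] by auto
  with step.IH show ?case
    by (simp add: scl_def sum.distrib flip: sum_distrib_left)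
qed

lemma partial_sums_zero:
  fixes v :: "nat \<Rightarrow> 'a::field"
  assumes "\<And>i. (\<Sum>j\<le>i. v j) = 0"
  shows "v = 0"
proof
  fix i
  show "v i = 0 i"
  proof (cases i)
    case 0
    thus ?thesis using assms[of 0] by simp
  next
    case (Suc k)
    thus ?thesis using assms[of i] assms[of k] by simp
  qed
qed

lemma diff_std_in_span_iff:
  "std i - std (Suc i) \<in> vs.span ((\<lambda>i. std i - std (Suc i) :: nat \<Rightarrow> 'a::field) ` S) \<longleftrightarrow> i \<in> S"
proof
  assume "std i - std (Suc i) \<in> vs.span ((\<lambda>i. std i - std (Suc i) :: nat \<Rightarrow> 'a) ` S)"
  from partial_sum_in_span[OF this, of i] show "i \<in> S"
    using partial_sum_diff_std[where 'a='a, of i i] by (metis zero_neq_one)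
qed (auto intro: vs.span_base)

lemma span_diff_std_disjoint:
  assumes "S \<inter> T = {}"
  shows "vs.span ((\<lambda>i. std i - std (Suc i) :: nat \<Rightarrow> 'a::field) ` S) \<inter>
         vs.span ((\<lambda>i. std i - std (Suc i)) ` T) = {0}"
proof -
  have "v = 0" if "v \<in> vs.span ((\<lambda>i. std i - std (Suc i) :: nat \<Rightarrow> 'a) ` S)"
      "v \<in> vs.span ((\<lambda>i. std i - std (Suc i)) ` T)" for v
  proof (rule partial_sums_zero)
    fix i
    show "(\<Sum>j\<le>i. v j) = 0"
      using partial_sum_in_span[OF that(1), of i] partial_sum_in_span[OF that(2), of i] assms
      by blast
  qed
  thus ?thesis by (auto intro: vs.span_zero)
qed

lemma building_set_ncA_min:
  "building_set (dual_quot n (diag n)) (ncA_min n :: (nat \<Rightarrow> 'k::field) set set)"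
proof -
  define D :: "nat set \<Rightarrow> (nat \<Rightarrow> 'k) set"
    where "D S = vs.span ((\<lambda>i. std i - std (Suc i)) ` S)" for S
  let ?G = "ncA_min n :: (nat \<Rightarrow> 'k) set set"
  have G_eq: "?G = {D {a..<b} | a b. 1 \<le> a \<and> a < b \<and> b \<le> n}"
    by (simp add: ncA_min_def ncA_space_Icc D_def)
  have d_iff: "std i - std (Suc i) \<in> D S \<longleftrightarrow> i \<in> S" for i S
    unfolding D_def by (rule diff_std_in_span_iff)
  have D_sub: "D S \<subseteq> W \<longleftrightarrow> (\<forall>i\<in>S. std i - std (Suc i) \<in> W)" if "vs.subspace W" for S W
  proof
    show "\<forall>i\<in>S. std i - std (Suc i) \<in> W" if "D S \<subseteq> W"
      using that d_iff by blast
    show "D S \<subseteq> W" if "\<forall>i\<in>S. std i - std (Suc i) \<in> W"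
      unfolding D_def using that \<open>vs.subspace W\<close> by (intro vs.span_minimal) auto
  qed
  have D_subspace: "vs.subspace (D S)" for S
    by (simp add: D_def)
  have D_mono: "D S \<subseteq> D T \<longleftrightarrow> S \<subseteq> T" for S T
    by (auto simp: D_sub[OF D_subspace] d_iff)
  have D_disj: "D S \<inter> D T = {0}" if "S \<inter> T = {}" for S T
    using span_diff_std_disjoint[OF that] by (simp add: D_def)
  have D_empty: "D {} = {0}" by (simp add: D_def)
  have D_nz: "D S \<noteq> {0}" if "S \<noteq> {}" for S
    using D_mono[of S "{}"] that D_empty by auto
  have in_lattice: "D S \<in> sum_lattice ?G" if S: "S \<subseteq> {1..<n}" for S
  proof -
    have "D S = vs.span (\<Union> ((\<lambda>i. D {i..<Suc i}) ` S))"
      unfolding D_def[of S] vs.span_eq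
    proof (intro conjI subsetI)
      fix x assume "x \<in> (\<lambda>i. std i - std (Suc i) :: nat \<Rightarrow> 'k) ` S"
      then obtain i where i: "i \<in> S" "x = std i - std (Suc i)" by auto
      hence "x \<in> D {i..<Suc i}" by (simp add: d_iff)
      with i(1) show "x \<in> vs.span (\<Union>i\<in>S. D {i..<Suc i})"
        by (auto intro: vs.span_base)
    next
      fix x assume "x \<in> (\<Union>i\<in>S. D {i..<Suc i})"
      then obtain i where i: "i \<in> S" "x \<in> D {i..<Suc i}" by auto
      have "D {i..<Suc i} \<subseteq> D S" using i(1) by (subst D_mono) auto
      thus "x \<in> vs.span ((\<lambda>i. std i - std (Suc i)) ` S)" using i(2) by (auto simp: D_def)
    qed
    moreover have "(\<lambda>i. D {i..<Suc i}) ` S \<subseteq> ?G"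
    proof (rule image_subsetI)
      fix i assume "i \<in> S"
      hence "1 \<le> i" "i < Suc i" "Suc i \<le> n" using S by auto
      thus "D {i..<Suc i} \<in> ?G" unfolding G_eq by blast
    qed
    ultimately show ?thesis unfolding sum_lattice_def by (intro CollectI exI conjI)
  qed
  have lattice_D: "\<exists>S \<subseteq> {1..<n}. U = D S" if "U \<in> sum_lattice ?G" for U
  proof -
    from that obtain A where A: "A \<subseteq> ?G" "U = vs.span (\<Union>A)"
      unfolding sum_lattice_def by blast
    define S where "S = {i. std i - std (Suc i) \<in> U}"
    have U: "vs.subspace U" by (simp add: A)
    have "D S \<subseteq> U" by (simp add: D_sub[OF U] S_def)
    moreover have "\<Union>A \<subseteq> D S"
    proof
      fix x assume "x \<in> \<Union>A"
      then obtain B where B: "B \<in> A" "x \<in> B" by auto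
      then obtain a b where ab: "B = D {a..<b}" using A(1) unfolding G_eq by blast
      have "B \<subseteq> U" using B(1) unfolding A(2) by (meson Union_upper order_trans vs.span_superset)
      hence "{a..<b} \<subseteq> S" unfolding ab by (auto simp: D_sub[OF U] S_def)
      thus "x \<in> D S" using B(2) D_mono ab by blast
    qed
    hence "U \<subseteq> D S" unfolding A(2) by (intro vs.span_minimal D_subspace)
    moreover have "\<Union>A \<subseteq> D {1..<n}"
    proof
      fix x assume "x \<in> \<Union>A"
      then obtain B where B: "B \<in> A" "x \<in> B" by auto
      then obtain a b where ab: "B = D {a..<b}" "1 \<le> a" "b \<le> n" using A(1) unfolding G_eq by blast
      hence "{a..<b} \<subseteq> {1..<n}" by auto
      thus "x \<in> D {1..<n}" using B(2) D_mono ab(1) by blast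
    qed
    hence "U \<subseteq> D {1..<n}" unfolding A(2) by (intro vs.span_minimal D_subspace)
    ultimately show ?thesis by (metis D_mono subset_antisym)
  qed
  have G_lattice: "U \<in> sum_lattice ?G" if "U \<in> ?G" for U
  proof -
    from that obtain a b where "U = D {a..<b}" "1 \<le> a" "b \<le> n" unfolding G_eq by blast
    moreover from this have "{a..<b} \<subseteq> {1..<n}" by auto
    ultimately show ?thesis using in_lattice by simp
  qed
  have G_nz: "U \<noteq> {0}" if "U \<in> ?G" for U
    using that D_nz unfolding G_eq by fastforce
  have fin_G: "finite ?G"
  proof (rule finite_subset)
    show "?G \<subseteq> (\<lambda>(a, b). D {a..<b}) ` ({..n} \<times> {..n})" unfolding G_eq by force
  qed auto
  have sub_G: "vs.subspace U \<and> U \<subseteq> dual_quot n (diag n) \<and> U \<noteq> {0}" if U: "U \<in> ?G" for U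
  proof (intro conjI)
    obtain a b where ab: "U = D {a..<b}" "1 \<le> a" "a < b" "b \<le> n"
      using U unfolding G_eq by blast
    show "vs.subspace U" by (simp add: ab D_subspace)
    show "U \<noteq> {0}" using U by (rule G_nz)
    have sub: "vs.subspace (dual_quot n (diag n :: (nat \<Rightarrow> 'k) set))"
      by (auto simp: vs.subspace_def dual_quot_def vecs_def scl_def distrib_right sum.distrib
          mult.assoc simp flip: sum_distrib_left)
    have "std i - std (Suc i) \<in> dual_quot n (diag n :: (nat \<Rightarrow> 'k) set)" if "i \<in> {a..<b}" for i
    proof -
      have i: "1 \<le> i" "Suc i \<le> n" using that ab by auto
      have "(\<Sum>j=1..n. (std i - std (Suc i)) j * v j) = 0" if v: "v \<in> diag n" for v :: "nat \<Rightarrow> 'k"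
      proof -
        obtain c where c: "v = scl c (\<lambda>i. if i \<in> {1..n} then 1 else 0)"
          using v unfolding diag_def vs.span_singleton by blast
        have "(\<Sum>j=1..n. (std i - std (Suc i)) j * v j) =
            (\<Sum>j=1..n. (if j = i then c else 0) - (if j = Suc i then c else 0))"
          by (intro sum.cong) (auto simp: std_def c scl_def)
        also have "\<dots> = 0" using i by (simp add: sum_subtractf)
        finally show ?thesis .
      qed
      thus ?thesis using i by (auto simp: dual_quot_def vecs_def std_def)
    qed
    thus "U \<subseteq> dual_quot n (diag n)" by (simp add: ab D_sub[OF sub])
  qed
  have G_indec: "?G = {U. indecomposable ?G U}"
  proof (intro equalityI subsetI CollectI)
    fix U assume U: "U \<in> ?G"
    show "indecomposable ?G U"
      unfolding indecomposable_def
    proof (intro conjI allI impI)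
      show "U \<in> sum_lattice ?G" "U \<noteq> {0}" using U G_lattice G_nz by auto
      fix \<U> assume dec: "decomposition ?G U \<U>"
      then obtain W where W: "W \<in> \<U>" "U \<subseteq> W"
        using U unfolding decomposition_def by blast
      have span: "vs.span (\<Union>\<U>) = U" and
        dir: "\<And>W. W \<in> \<U> \<Longrightarrow> W \<inter> vs.span (\<Union>(\<U> - {W})) = {0}" and
        nz: "\<And>W. W \<in> \<U> \<Longrightarrow> W \<noteq> {0}"
        using dec unfolding decomposition_def direct_sum_decomp_def by auto
      have sub: "W' \<subseteq> U" if "W' \<in> \<U>" for W'
        using that span by (metis Union_upper order_trans vs.span_superset)
      have WU: "W = U" using sub[OF W(1)] W(2) by blast
      have "W' = U" if W': "W' \<in> \<U>" for W'
      proof (rule ccontr)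
        assume "W' \<noteq> U"
        hence "U \<in> \<U> - {W'}" using W(1) WU by auto
        hence "U \<subseteq> vs.span (\<Union>(\<U> - {W'}))" by (meson Union_upper order_trans vs.span_superset)
        hence "W' \<inter> vs.span (\<Union>(\<U> - {W'})) = W'" using sub[OF W'] by blast
        thus False using dir[OF W'] nz[OF W'] by simp
      qed
      thus "\<U> = {U}" using W(1) WU by blast
    qed
  next
    fix U assume "U \<in> {U. indecomposable ?G U}"
    hence U: "U \<in> sum_lattice ?G" "U \<noteq> {0}" "\<And>\<U>. decomposition ?G U \<U> \<Longrightarrow> \<U> = {U}"
      by (auto simp: indecomposable_def)
    then obtain S where S: "S \<subseteq> {1..<n}" "U = D S" using lattice_D by blast
    have ne: "S \<noteq> {}" using U(2) S(2) D_empty by auto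
    have fin: "finite S" using S(1) finite_subset by blast
    define a where "a = Min S"
    define b where "b = (LEAST b. a < b \<and> b \<notin> S)"
    have a: "a \<in> S" "\<And>i. i \<in> S \<Longrightarrow> a \<le> i" using fin ne by (auto simp: a_def)
    have "\<exists>b. a < b \<and> b \<notin> S"
      using a(1) S(1) by (intro exI[of _ n]) auto
    hence b: "a < b" "b \<notin> S" unfolding b_def by (metis (mono_tags, lifting) LeastI)+
    have bS: "i \<in> S" if "a < i" "i < b" for i
      using not_less_Least[of i "\<lambda>b. a < b \<and> b \<notin> S"] that unfolding b_def by blast
    define C where "C = {a..<b}"
    define R where "R = S - C"
    have C: "C \<subseteq> S" using bS a(1) by (auto simp: C_def le_less)
    have b_le: "b \<le> n"
    proof -
      have "b - 1 \<in> C" using b(1) by (auto simp: C_def)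
      hence "b - 1 \<in> {1..<n}" using C S(1) by blast
      thus ?thesis by auto
    qed
    have "R = {}"
    proof (rule ccontr)
      assume R: "R \<noteq> {}"
      have Cne: "C \<noteq> {}" using b(1) by (auto simp: C_def)
      have neq: "D C \<noteq> D R"
        using D_mono[of C R] Cne by (auto simp: R_def)
      have RC: "R \<subseteq> S" "C \<union> R = S" "C \<inter> R = {}" using C by (auto simp: R_def)
      have "decomposition ?G U {D C, D R}"
        unfolding decomposition_def direct_sum_decomp_def
      proof (intro conjI ballI impI)
        show "{D C, D R} \<subseteq> sum_lattice ?G - {{0}}"
          using D_nz[OF Cne] D_nz[OF R] in_lattice[of C] in_lattice[of R] C RC S(1) by auto
        show "finite {D C, D R}" by simp
        have "D C \<subseteq> D S" "D R \<subseteq> D S" using C RC by (simp_all add: D_mono)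
        moreover have "D S \<subseteq> vs.span (\<Union>{D C, D R})"
        proof (subst D_sub[OF vs.subspace_span], intro ballI vs.span_base)
          fix i assume "i \<in> S"
          thus "std i - std (Suc i) \<in> \<Union>{D C, D R}" using RC(2) by (auto simp: d_iff)
        qed
        ultimately show "vs.span (\<Union>{D C, D R}) = U"
          unfolding S(2) by (intro equalityI vs.span_minimal D_subspace) auto
      next
        fix W assume "W \<in> {D C, D R}"
        hence W: "W = D C \<or> W = D R" by simp
        have diff: "{D C, D R} - {D C} = {D R}" "{D C, D R} - {D R} = {D C}"
          using neq by auto
        have span_D: "vs.span (D T) = D T" for T by (simp add: D_def vs.span_span)
        show "W \<inter> vs.span (\<Union>({D C, D R} - {W})) = {0}"
          using W
        proof
          assume "W = D C"
          thus ?thesis using D_disj[OF RC(3)] by (simp only: diff cSup_singleton span_D)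
        next
          assume "W = D R"
          thus ?thesis using D_disj[OF RC(3)]
            by (simp only: diff cSup_singleton span_D Int_commute)
        qed
      next
        fix G assume G: "G \<in> ?G" "G \<subseteq> U"
        then obtain a' b' where ab': "G = D {a'..<b'}" "a' < b'" unfolding G_eq by blast
        have sub: "{a'..<b'} \<subseteq> S" using G(2) D_mono by (simp add: ab' S(2))
        show "\<exists>W\<in>{D C, D R}. G \<subseteq> W"
        proof (cases "{a'..<b'} \<inter> C = {}")
          case True
          hence "{a'..<b'} \<subseteq> R" using sub by (auto simp: R_def)
          thus ?thesis by (simp add: ab' D_mono)
        next
          case False
          then obtain i where "i \<in> {a'..<b'}" "i \<in> C" by blast
          hence i: "a' \<le> i" "i < b'" "a \<le> i" "i < b" by (simp_all add: C_def)
          have "b \<notin> {a'..<b'}" using b(2) sub by blast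
          hence "b' \<le> b" using i by auto
          moreover have "a \<le> a'" using a(2)[of a'] sub ab'(2) by auto
          ultimately have "{a'..<b'} \<subseteq> C" by (auto simp: C_def)
          thus ?thesis by (simp add: ab' D_mono)
        qed
      qed
      hence "{D C, D R} = {U}" by (rule U(3))
      thus False using neq by auto
    qed
    hence "S = {a..<b}" using C by (auto simp: R_def C_def)
    moreover have "1 \<le> a" using a(1) S(1) by auto
    ultimately show "U \<in> ?G" unfolding G_eq using S(2) b(1) b_le by blast
  qed
  show ?thesis
    unfolding building_set_def
  proof (intro conjI)
    show "finite ?G" by (rule fin_G)
    show "\<forall>G\<in>?G. vs.subspace G \<and> G \<subseteq> dual_quot n (diag n) \<and> G \<noteq> {0}"
      using sub_G by (rule ballI)
    show "?G = {U. indecomposable ?G U}" by (rule G_indec)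
  qed
qed

section \<open>Products of Grassmannians and the brick manifold\<close>

definition grassmannian :: "nat \<Rightarrow> nat \<Rightarrow> (nat \<Rightarrow> 'a::field) set set" where
  "grassmannian d m = {W. vs.subspace W \<and> W \<subseteq> vecs m \<and> vs.dim W = d}"

text \<open>
  The product over \<open>j \<in> J\<close> of the Grassmannians of \<open>d j\<close>-dimensional subspaces of \<open>vecs m\<close>.
  The vectors \<open>comp_at (comp_at z j) c\<close> with \<open>c < d j\<close> form a basis of the subspace with index \<open>j\<close>.
\<close>

definition grassmannian_prod :: "nat \<Rightarrow> 'j set \<Rightarrow> ('j \<Rightarrow> nat) \<Rightarrow>
    ('j \<times> nat \<times> nat, 'k::field, 'j \<Rightarrow> (nat \<Rightarrow> 'k alg_closure) set) variety" where
  "grassmannian_prod m J d =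
     \<lparr>hcoords = {z. \<forall>j.
         (\<forall>c. if j \<in> J \<and> c < d j then comp_at (comp_at z j) c \<in> vecs m
               else comp_at (comp_at z j) c = 0) \<and>
         (j \<in> J \<longrightarrow> inj_on (comp_at (comp_at z j)) {..<d j} \<and>
                    \<not> vs.dependent (comp_at (comp_at z j) ` {..<d j}))},
      point_of = (\<lambda>z. \<lambda>j\<in>J. vs.span (comp_at (comp_at z j) ` {..<d j}))\<rparr>"

lemma points_grassmannian_prod:
  fixes d :: "'j \<Rightarrow> nat"
  shows "points (grassmannian_prod m J d :: ('j \<times> nat \<times> nat, 'k::field, _) variety) =
    (\<Pi>\<^sub>E j\<in>J. grassmannian (d j) m)"
proof (intro equalityI subsetI)
  fix V :: "'j \<Rightarrow> (nat \<Rightarrow> 'k alg_closure) set"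
  assume "V \<in> points (grassmannian_prod m J d)"
  then obtain z where hz: "z \<in> hcoords (grassmannian_prod m J d)"
    and V': "V = point_of (grassmannian_prod m J d) z"
    unfolding points_def by (rule imageE)
  have V: "V = (\<lambda>j\<in>J. vs.span (comp_at (comp_at z j) ` {..<d j}))"
    by (simp add: V' grassmannian_prod_def)
  have z: "comp_at (comp_at z j) c \<in> vecs m" if "j \<in> J" "c < d j" for j c
  proof -
    have "if j \<in> J \<and> c < d j then comp_at (comp_at z j) c \<in> vecs m
          else comp_at (comp_at z j) c = 0"
      using hz by (simp add: grassmannian_prod_def)
    thus ?thesis using that by simp
  qed
  have inj: "inj_on (comp_at (comp_at z j)) {..<d j}"
    and ind: "\<not> vs.dependent (comp_at (comp_at z j) ` {..<d j})" if "j \<in> J" for j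
    using hz that by (simp_all add: grassmannian_prod_def)
  have "vs.subspace (vecs m :: (nat \<Rightarrow> 'k alg_closure) set)"
    by (auto simp: vs.subspace_def vecs_def scl_def)
  hence "vs.span (comp_at (comp_at z j) ` {..<d j}) \<subseteq> vecs m" if "j \<in> J" for j
    using z[OF that] by (intro vs.span_minimal) auto
  moreover have "vs.dim (vs.span (comp_at (comp_at z j) ` {..<d j})) = d j" if "j \<in> J" for j
    using vs.dim_span_eq_card_independent[OF ind[OF that]] card_image[OF inj[OF that]] by simp
  ultimately show "V \<in> (\<Pi>\<^sub>E j\<in>J. grassmannian (d j) m)"
    by (auto simp: V grassmannian_def)
next
  fix V :: "'j \<Rightarrow> (nat \<Rightarrow> 'k alg_closure) set"
  assume V: "V \<in> (\<Pi>\<^sub>E j\<in>J. grassmannian (d j) m)"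
  have span: "vecs m \<subseteq> vs.span (std ` {1..m} :: (nat \<Rightarrow> 'k alg_closure) set)"
  proof
    fix v :: "nat \<Rightarrow> 'k alg_closure" assume v: "v \<in> vecs m"
    have "v = (\<Sum>i\<in>{1..m}. scl (v i) (std i))"
    proof
      fix r
      have "(\<Sum>i\<in>A. scl (v i) (std i)) r = (\<Sum>i\<in>A. if i = r then v r else 0)"
        if "finite A" for A :: "nat set"
        using that by (induction A rule: finite_induct) (auto simp: scl_def std_def)
      from this[of "{1..m}"] show "v r = (\<Sum>i\<in>{1..m}. scl (v i) (std i)) r"
        using v by (auto simp: vecs_def)
    qed
    also have "\<dots> \<in> vs.span (std ` {1..m})"
      by (intro vs.span_sum vs.span_scale vs.span_base) auto
    finally show "v \<in> vs.span (std ` {1..m})" .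
  qed
  have "\<exists>w. inj_on w {..<d j} \<and> w ` {..<d j} \<subseteq> vecs m \<and> \<not> vs.dependent (w ` {..<d j}) \<and>
      V j = vs.span (w ` {..<d j})" if j: "j \<in> J" for j
  proof -
    have W: "vs.subspace (V j)" "V j \<subseteq> vecs m" "vs.dim (V j) = d j"
      using PiE_mem[OF V j] by (auto simp: grassmannian_def)
    obtain B where B: "B \<subseteq> V j" "\<not> vs.dependent B" "V j \<subseteq> vs.span B" "card B = d j"
      using vs.basis_exists[of "V j"] W(3) by metis
    have "finite B"
      using vs.independent_span_bound[of "std ` {1..m}" B] B W(2) span by blast
    then obtain w where "bij_betw w {..<d j} B"
      using ex_bij_betw_nat_finite[of B] B(4) by (auto simp: lessThan_atLeast0)
    moreover have "V j = vs.span B"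
      using vs.span_minimal[OF B(1) W(1)] B(3) by blast
    ultimately show ?thesis using B W by (intro exI[of _ w]) (auto simp: bij_betw_def)
  qed
  then obtain w where w: "\<And>j. j \<in> J \<Longrightarrow> inj_on (w j) {..<d j} \<and> w j ` {..<d j} \<subseteq> vecs m \<and>
      \<not> vs.dependent (w j ` {..<d j}) \<and> V j = vs.span (w j ` {..<d j})"
    by metis
  define z where "z = (\<lambda>(j, c, r). if j \<in> J \<and> c < d j then w j c r else 0)"
  have z: "comp_at (comp_at z j) c = (if j \<in> J \<and> c < d j then w j c else 0)" for j c
    by (auto simp: z_def comp_at_def fun_eq_iff)
  have z_img: "comp_at (comp_at z j) ` {..<d j} = w j ` {..<d j}" if "j \<in> J" for j
    using that by (auto simp: z intro!: image_cong)
  have z_inj: "inj_on (comp_at (comp_at z j)) {..<d j}" if "j \<in> J" for j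
    using w[OF that] that by (auto simp: z inj_on_def)
  have "z \<in> hcoords (grassmannian_prod m J d)"
    using w by (auto simp: grassmannian_prod_def z z_img z_inj)
  moreover have "point_of (grassmannian_prod m J d) z = V"
  proof
    fix j
    show "point_of (grassmannian_prod m J d) z j = V j"
      using w[of j] z_img[of j] PiE_arb[OF V, of j]
      by (cases "j \<in> J") (auto simp: grassmannian_prod_def)
  qed
  ultimately show "V \<in> points (grassmannian_prod m J d)"
    unfolding points_def by blast
qed

definition proper_intervals :: "nat \<Rightarrow> (nat \<times> nat) set" where
  "proper_intervals n = {(i, j). 1 \<le> i \<and> i \<le> j \<and> j \<le> n \<and> (i, j) \<noteq> (1, n)}"

text \<open>The basis vector \<open>e_{i,i+1}\<close> of \<open>G(n) = vecs (n - 1)\<close> is \<open>std i\<close>.\<close>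

definition brick_span :: "nat \<Rightarrow> nat \<Rightarrow> (nat \<Rightarrow> 'a::field) set" where
  "brick_span a b = vs.span (std ` {a..<b})"

text \<open>
  \<open>(0, j)\<close> is not a proper interval, so there is no condition on \<open>(i - 1, j)\<close> for \<open>i = 1\<close>.
\<close>

definition brick_points :: "nat \<Rightarrow> (nat \<times> nat \<Rightarrow> (nat \<Rightarrow> 'a::field) set) set" where
  "brick_points n = {V \<in> (\<Pi>\<^sub>E (i, j) \<in> proper_intervals n. grassmannian (j - i + 1) (n - 1)).
     (\<forall>(i, j) \<in> proper_intervals n.
        ((i - 1, j) \<in> proper_intervals n \<longrightarrow> V (i, j) \<subseteq> V (i - 1, j)) \<and>
        ((i, j + 1) \<in> proper_intervals n \<longrightarrow> V (i, j) \<subseteq> V (i, j + 1))) \<and>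
     (\<forall>j. (1, j) \<in> proper_intervals n \<longrightarrow> V (1, j) = brick_span 1 (j + 1)) \<and>
     (\<forall>i. (i, n) \<in> proper_intervals n \<longrightarrow> V (i, n) = brick_span (i - 1) n)}"

definition brick_manifold :: "nat \<Rightarrow>
    ((nat \<times> nat) \<times> nat \<times> nat, 'k::field,
     nat \<times> nat \<Rightarrow> (nat \<Rightarrow> 'k alg_closure) set) variety" where
  "brick_manifold n =
     subvariety (grassmannian_prod (n - 1) (proper_intervals n) (\<lambda>(i, j). j - i + 1))
       (brick_points n)"

end

theory Submission
  imports Defs
begin

text \<open>
  Put \<open>t_i = x_i - x_{i+1}\<close>. The factor of the wonderful model belonging to \<open>H_{[a,b+1]}\<close> is the
  projective space with coordinates \<open>t_a, \<dots>, t_b\<close>, so a point of the ambient product is a family of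
  nonzero vectors, one for each interval \<open>[a,b]\<close>, up to scaling, and the model lies in the closed
  set where the restriction of each of them to a smaller interval is a multiple, possibly \<open>0\<close>, of
  the vector there. This set is the whole model: each of its points is the limit at \<open>s = 0\<close> of a
  curve with \<open>t_i = c_i s^{d_i}\<close>, all \<open>c_i\<close> nonzero.

  In the brick manifold, \<open>V_{a+1,b}\<close> for \<open>1 \<le> a < b < n\<close> is contained in the intersection of \<open>V_{1,b}\<close>
  and \<open>V_{a+1,n}\<close>, the span of \<open>std a, \<dots>, std b\<close>, as a hyperplane. The functional cutting it out is
  the vector of the interval \<open>[a,b]\<close>, and the inclusions between the \<open>V_{i,j}\<close> become the restriction
  conditions. Passing from functionals to bases of their kernels and back is polynomial locally.
\<close>

section \<open>Morphisms in homogeneous coordinates\<close>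

text \<open>Neither direction comes with one polynomial formula on coordinates. A basis of a kernel
  is written down after choosing a coordinate where the functional is nonzero, and an equation of a
  frame after choosing a pivot at each elimination step. The isomorphism is therefore given as a
  relation \<open>brick_rel\<close> between coordinate systems, compatible with representing the
  same point, and only its local sections are polynomial. The data match because the remaining ones
  are rigid: for \<open>a = b\<close> the projective space is a single point, the spaces V_{1,j} and
  V_{i,n} are prescribed, and \<open>(a, b)\<close> corresponds to \<open>(Suc a, b)\<close> for
  \<open>a < b\<close>. The factor P(V), with index \<open>None\<close>, duplicates the factor of
  the full interval. Proportionality is expressed by 2x2 minors, since a vector may restrict to 0 on
  a smaller interval. The field \<open>'k\<close> may be finite, so the limit argument uses a
  parameter s in the algebraic closure: a polynomial in s that vanishes for all s different from 0
  then also vanishes at 0, which puts the limit into every closed set containing the image of the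
  complement.\<close>

lemma polys_uminus: "p \<in> polys \<Longrightarrow> (\<lambda>x. - p x) \<in> polys"
  using polys.mult[OF polys.const[of "-1"], of p] by simp

lemma polys_diff: "p \<in> polys \<Longrightarrow> q \<in> polys \<Longrightarrow> (\<lambda>x. p x - q x) \<in> polys"
  using polys.add[OF _ polys_uminus, of p q] by simp

lemma polys_0: "(\<lambda>x. 0) \<in> polys" and polys_1: "(\<lambda>x. 1) \<in> polys"
  using polys.const[of 0] polys.const[of 1] by simp_all

lemma polys_sum: "(\<And>i. i \<in> A \<Longrightarrow> p i \<in> polys) \<Longrightarrow> (\<lambda>x. \<Sum>i\<in>A. p i x) \<in> polys"
  by (induction A rule: infinite_finite_induct) (auto intro: polys_0 polys.add)

lemma polys_prod: "(\<And>i. i \<in> A \<Longrightarrow> p i \<in> polys) \<Longrightarrow> (\<lambda>x. \<Prod>i\<in>A. p i x) \<in> polys"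
  by (induction A rule: infinite_finite_induct) (auto intro: polys_1 polys.mult)

lemma polys_subst:
  assumes "p \<in> polys" "\<And>i. P i \<in> polys"
  shows "(\<lambda>x. p (\<lambda>i. P i x)) \<in> polys"
  using assms(1) by induction (auto intro: polys.intros assms(2))

text \<open>Polynomial lifts pull equations and quotients back to equations and quotients. The locus
  where \<open>r\<close> is nonzero lies in coordinate space and need not be a union of fibres of
  \<open>point_of\<close>; this is harmless because closedness and regularity are tested on
  coordinates.\<close>

lemma morphismI_local:
  fixes M :: "('i, 'k::field, 'p) variety" and M' :: "('j, 'k, 'q) variety"
  assumes maps: "\<phi> \<in> points M \<rightarrow> points M'"
    and loc: "\<And>z0. z0 \<in> hcoords M \<Longrightarrow> \<exists>P r. (\<forall>i. P i \<in> polys) \<and> r \<in> polys \<and> r z0 \<noteq> 0 \<and>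
      (\<forall>z\<in>hcoords M. r z \<noteq> 0 \<longrightarrow> (\<lambda>i. P i z) \<in> hcoords M' \<and>
         point_of M' (\<lambda>i. P i z) = \<phi> (point_of M z))"
  shows "morphism M M' \<phi>"
  unfolding morphism_def
proof (intro conjI allI impI maps)
  fix U f assume reg: "regular_on M' U f"
  define lifts where "lifts z0 P r \<longleftrightarrow> (\<forall>i. P i \<in> polys) \<and> r \<in> polys \<and> r z0 \<noteq> 0 \<and>
      (\<forall>z\<in>hcoords M. r z \<noteq> 0 \<longrightarrow> (\<lambda>i. P i z) \<in> hcoords M' \<and>
         point_of M' (\<lambda>i. P i z) = \<phi> (point_of M z))" for z0 P r
  have "\<exists>P r. lifts z0 P r" if "z0 \<in> hcoords M" for z0
    unfolding lifts_def by (rule loc[OF that])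
  then obtain P r where Pr: "\<And>z0. z0 \<in> hcoords M \<Longrightarrow> lifts z0 (P z0) (r z0)"
    by metis
  have P: "P z0 i \<in> polys" and r: "r z0 \<in> polys" "r z0 z0 \<noteq> 0" if "z0 \<in> hcoords M" for z0 i
    using Pr[OF that] by (simp_all add: lifts_def)
  have lift: "(\<lambda>i. P z0 i z) \<in> hcoords M' \<and> point_of M' (\<lambda>i. P z0 i z) = \<phi> (point_of M z)"
    if "z0 \<in> hcoords M" "z \<in> hcoords M" "r z0 z \<noteq> 0" for z0 z
    using Pr[OF that(1)] that(2,3) by (simp add: lifts_def)
  let ?U = "\<phi> -` U \<inter> points M"
  have pt: "point_of M z \<in> points M" if "z \<in> hcoords M" for z
    using that by (simp add: points_def)
  have "zariski_closed M' (points M' - U)"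
    using reg by (simp add: regular_on_def zariski_open_def)
  then obtain F where F: "F \<subseteq> polys"
    "\<And>y. y \<in> hcoords M' \<Longrightarrow> point_of M' y \<in> points M' - U \<longleftrightarrow> (\<forall>g\<in>F. g y = 0)"
    unfolding zariski_closed_def by blast
  show "regular_on M ?U (f \<circ> \<phi>)"
    unfolding regular_on_def
  proof (intro conjI ballI impI)
    have "zariski_closed M (points M - ?U)"
      unfolding zariski_closed_def
    proof (intro conjI exI)
      \<comment> \<open>The factor \<open>r z0 x\<close> silences an equation wherever its lift is
        not valid. No point escapes all the equations, since at \<open>x\<close> the lift centred at
        \<open>z0 = x\<close> is valid.\<close>
      let ?F = "{\<lambda>x. r z0 x * g (\<lambda>i. P z0 i x) | z0 g. z0 \<in> hcoords M \<and> g \<in> F}"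
      have "(\<lambda>x. r z0 x * g (\<lambda>i. P z0 i x)) \<in> polys" if "z0 \<in> hcoords M" "g \<in> F" for z0 g
        by (rule polys.mult[OF r(1)[OF that(1)] polys_subst[OF _ P[OF that(1)]]]) (use F(1) that in auto)
      thus "?F \<subseteq> polys" by blast
      show "\<forall>x\<in>hcoords M. point_of M x \<in> points M - ?U \<longleftrightarrow> (\<forall>h\<in>?F. h x = 0)"
      proof
        fix x assume x: "x \<in> hcoords M"
        have eq: "point_of M x \<in> points M - ?U \<longleftrightarrow> (\<forall>g\<in>F. g (\<lambda>i. P z0 i x) = 0)"
          if "z0 \<in> hcoords M" "r z0 x \<noteq> 0" for z0
          using F(2)[of "\<lambda>i. P z0 i x"] lift[OF that(1) x that(2)] pt[OF x] maps by auto
        show "point_of M x \<in> points M - ?U \<longleftrightarrow> (\<forall>h\<in>?F. h x = 0)"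
        proof
          assume "point_of M x \<in> points M - ?U"
          hence "r z0 x * g (\<lambda>i. P z0 i x) = 0" if "z0 \<in> hcoords M" "g \<in> F" for z0 g
            using eq[OF that(1)] that(2) by (cases "r z0 x = 0") auto
          thus "\<forall>h\<in>?F. h x = 0" by blast
        next
          assume h: "\<forall>h\<in>?F. h x = 0"
          have "r x x * g (\<lambda>i. P x i x) = 0" if "g \<in> F" for g
            using h x that by fastforce
          thus "point_of M x \<in> points M - ?U"
            using eq[OF x r(2)[OF x]] r(2)[OF x] by auto
        qed
      qed
    qed auto
    thus "zariski_open M ?U" by (auto simp: zariski_open_def)
  next
    fix x assume x: "x \<in> hcoords M" and xU: "point_of M x \<in> ?U"
    note L = lift[OF x x r(2)[OF x]]
    obtain p q where pq: "p \<in> polys" "q \<in> polys" "q (\<lambda>i. P x i x) \<noteq> 0"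
      "\<And>y. y \<in> hcoords M' \<Longrightarrow> point_of M' y \<in> U \<Longrightarrow> q y \<noteq> 0 \<Longrightarrow> f (point_of M' y) = p y / q y"
    proof -
      have "\<exists>p\<in>polys. \<exists>q\<in>polys. q (\<lambda>i. P x i x) \<noteq> 0 \<and> (\<forall>y\<in>hcoords M'.
          point_of M' y \<in> U \<and> q y \<noteq> 0 \<longrightarrow> f (point_of M' y) = p y / q y)"
        using reg[unfolded regular_on_def, THEN conjunct2, rule_format, OF L[THEN conjunct1]] L xU
        by simp
      thus ?thesis using that by blast
    qed
    show "\<exists>p\<in>polys. \<exists>q\<in>polys. q x \<noteq> 0 \<and> (\<forall>y\<in>hcoords M. point_of M y \<in> ?U \<and> q y \<noteq> 0 \<longrightarrow>
        (f \<circ> \<phi>) (point_of M y) = p y / q y)"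
    \<comment> \<open>Numerator and denominator both carry \<open>r x y\<close>: the quotient is
      unchanged, and a nonzero denominator now guarantees that the lift is valid at
      \<open>y\<close>.\<close>
    proof (rule bexI[of _ "\<lambda>y. r x y * p (\<lambda>i. P x i y)"],
        rule bexI[of _ "\<lambda>y. r x y * q (\<lambda>i. P x i y)"], intro conjI ballI impI)
      show "r x x * q (\<lambda>i. P x i x) \<noteq> 0" using pq(3) r(2)[OF x] by simp
      fix y assume y: "y \<in> hcoords M" "point_of M y \<in> ?U \<and> r x y * q (\<lambda>i. P x i y) \<noteq> 0"
      hence "r x y \<noteq> 0" by auto
      thus "(f \<circ> \<phi>) (point_of M y) = (r x y * p (\<lambda>i. P x i y)) / (r x y * q (\<lambda>i. P x i y))"
        using lift[OF x y(1)] pq(4)[of "\<lambda>i. P x i y"] y(2) by auto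
    qed (rule polys.mult[OF r(1)[OF x] polys_subst[OF pq(1) P[OF x]]]
        polys.mult[OF r(1)[OF x] polys_subst[OF pq(2) P[OF x]]])+
  qed
qed

text \<open>
  A relation between the homogeneous coordinates that respects representing the same point and has
  local polynomial sections in both directions is the graph of an isomorphism.
\<close>

lemma isomorphicI_relation:
  fixes M :: "('i, 'k::field, 'p) variety" and M' :: "('j, 'k, 'q) variety"
  assumes dom: "\<And>z y. R z y \<Longrightarrow> z \<in> hcoords M \<and> y \<in> hcoords M'"
    and pt: "\<And>z y z' y'. R z y \<Longrightarrow> R z' y' \<Longrightarrow>
      point_of M z = point_of M z' \<longleftrightarrow> point_of M' y = point_of M' y'"
    and lr: "\<And>z0. z0 \<in> hcoords M \<Longrightarrow> \<exists>P r. (\<forall>i. P i \<in> polys) \<and> r \<in> polys \<and> r z0 \<noteq> 0 \<and>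
      (\<forall>z\<in>hcoords M. r z \<noteq> 0 \<longrightarrow> R z (\<lambda>i. P i z))"
    and rl: "\<And>y0. y0 \<in> hcoords M' \<Longrightarrow> \<exists>P r. (\<forall>i. P i \<in> polys) \<and> r \<in> polys \<and> r y0 \<noteq> 0 \<and>
      (\<forall>y\<in>hcoords M'. r y \<noteq> 0 \<longrightarrow> R (\<lambda>i. P i y) y)"
  shows "isomorphic M M'"
proof -
  have tot: "\<exists>y. R z y" if "z \<in> hcoords M" for z
    using lr[OF that] that by blast
  have sur: "\<exists>z. R z y" if "y \<in> hcoords M'" for y
    using rl[OF that] that by blast
  \<comment> \<open>By \<open>pt\<close> the chosen point does not depend on the related pair: one
    direction of the equivalence makes \<open>\<phi>\<close> well defined, the other
    \<open>\<psi>\<close>.\<close>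
  define \<phi> where "\<phi> a = (SOME b. \<exists>z y. R z y \<and> a = point_of M z \<and> b = point_of M' y)" for a
  define \<psi> where "\<psi> b = (SOME a. \<exists>z y. R z y \<and> a = point_of M z \<and> b = point_of M' y)" for b
  have phi: "\<phi> (point_of M z) = point_of M' y" if "R z y" for z y
    unfolding \<phi>_def by (rule some_equality) (use that pt[OF that] in metis)+
  have psi: "\<psi> (point_of M' y) = point_of M z" if "R z y" for z y
    unfolding \<psi>_def by (rule some_equality) (use that pt[OF that] in metis)+
  have "morphism M M' \<phi>"
  proof (rule morphismI_local)
    show "\<phi> \<in> points M \<rightarrow> points M'"
    proof
      fix a assume "a \<in> points M"
      then obtain z y where "a = point_of M z" "R z y" unfolding points_def using tot by blast
      thus "\<phi> a \<in> points M'" using phi dom by (auto simp: points_def)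
    qed
    fix z0 assume "z0 \<in> hcoords M"
    then obtain P r where P: "\<forall>i. P i \<in> polys" "r \<in> polys" "r z0 \<noteq> 0"
      "\<And>z. z \<in> hcoords M \<Longrightarrow> r z \<noteq> 0 \<Longrightarrow> R z (\<lambda>i. P i z)"
      using lr[of z0] by blast
    show "\<exists>P r. (\<forall>i. P i \<in> polys) \<and> r \<in> polys \<and> r z0 \<noteq> 0 \<and>
      (\<forall>z\<in>hcoords M. r z \<noteq> 0 \<longrightarrow> (\<lambda>i. P i z) \<in> hcoords M' \<and>
         point_of M' (\<lambda>i. P i z) = \<phi> (point_of M z))"
      by (intro exI[of _ P] exI[of _ r] conjI ballI impI P)
        (simp_all add: dom[OF P(4)] phi[OF P(4)])
  qed
  moreover have "morphism M' M \<psi>"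
  proof (rule morphismI_local)
    show "\<psi> \<in> points M' \<rightarrow> points M"
    proof
      fix b assume "b \<in> points M'"
      then obtain z y where "b = point_of M' y" "R z y" unfolding points_def using sur by blast
      thus "\<psi> b \<in> points M" using psi dom by (auto simp: points_def)
    qed
    fix y0 assume "y0 \<in> hcoords M'"
    then obtain P r where P: "\<forall>i. P i \<in> polys" "r \<in> polys" "r y0 \<noteq> 0"
      "\<And>y. y \<in> hcoords M' \<Longrightarrow> r y \<noteq> 0 \<Longrightarrow> R (\<lambda>i. P i y) y"
      using rl[of y0] by blast
    show "\<exists>P r. (\<forall>i. P i \<in> polys) \<and> r \<in> polys \<and> r y0 \<noteq> 0 \<and>
      (\<forall>y\<in>hcoords M'. r y \<noteq> 0 \<longrightarrow> (\<lambda>i. P i y) \<in> hcoords M \<and>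
         point_of M (\<lambda>i. P i y) = \<psi> (point_of M' y))"
      by (intro exI[of _ P] exI[of _ r] conjI ballI impI P)
        (simp_all add: dom[OF P(4)] psi[OF P(4)])
  qed
  moreover have "\<psi> (\<phi> a) = a" if a: "a \<in> points M" for a
  proof -
    obtain z y where "a = point_of M z" "R z y" using a tot unfolding points_def by blast
    thus ?thesis by (simp add: phi psi)
  qed
  moreover have "\<phi> (\<psi> b) = b" if b: "b \<in> points M'" for b
  proof -
    obtain z y where "b = point_of M' y" "R z y" using b sur unfolding points_def by blast
    thus ?thesis by (simp add: phi psi)
  qed
  ultimately show ?thesis unfolding isomorphic_def by blast
qed

section \<open>Hyperplanes and their equations\<close>

lemma sum_fun_apply: "(\<Sum>c\<in>A. f c) x = (\<Sum>c\<in>A. f c x)"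
  by (induction A rule: infinite_finite_induct) auto

text \<open>Coordinates of a Grassmannian are indexed families, while \<open>vs.dependent\<close>
  speaks of sets. Injectivity together with independence of the image is independence of the family,
  which can be tested with coefficients.\<close>

lemma frame_iff:
  fixes w :: "'c \<Rightarrow> 'i \<Rightarrow> 'a::field"
  assumes A: "finite A"
  shows "inj_on w A \<and> \<not> vs.dependent (w ` A) \<longleftrightarrow>
    (\<forall>u. (\<Sum>c\<in>A. scl (u c) (w c)) = 0 \<longrightarrow> (\<forall>c\<in>A. u c = 0))"
    (is "?L \<longleftrightarrow> ?R")
proof
  assume L: ?L
  hence inj: "inj_on w A" by simp
  show ?R
  proof (intro allI impI ballI)
    fix u c assume u: "(\<Sum>c\<in>A. scl (u c) (w c)) = 0" and c: "c \<in> A"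
    let ?u = "\<lambda>v. u (the_inv_into A w v)"
    have "(\<Sum>v\<in>w ` A. scl (?u v) v) = (\<Sum>c\<in>A. scl (u c) (w c))"
      by (simp add: sum.reindex[OF inj] the_inv_into_f_f[OF inj])
    hence "?u (w c) = 0"
      using vs.independentD[of "w ` A" "w ` A" ?u "w c"] L A u c by simp
    thus "u c = 0" by (simp add: the_inv_into_f_f[OF inj c])
  qed
next
  assume R: ?R
  have inj: "inj_on w A"
  proof (rule inj_onI, rule ccontr)
    fix c c' assume c: "c \<in> A" "c' \<in> A" "w c = w c'" "c \<noteq> c'"
    \<comment> \<open>A repeated vector gives the relation with coefficients 1 and -1.\<close>
    let ?u = "\<lambda>e. if e = c then 1 else if e = c' then - 1 else 0"
    have "(\<Sum>e\<in>A. scl (?u e) (w e)) =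
        (\<Sum>e\<in>A. if e = c then w c else 0) - (\<Sum>e\<in>A. if e = c' then w c' else 0)"
      unfolding sum_subtractf[symmetric] using c
      by (intro sum.cong) (auto simp: scl_def fun_eq_iff)
    also have "\<dots> = 0" using A c by simp
    finally show False using R[rule_format, of ?u c] c by simp
  qed
  moreover have "\<not> vs.dependent (w ` A)"
  proof
    assume "vs.dependent (w ` A)"
    then obtain u v where u: "v \<in> w ` A" "u v \<noteq> 0" "(\<Sum>v\<in>w ` A. scl (u v) v) = 0"
      using A by (auto simp: vs.dependent_finite)
    hence "(\<Sum>c\<in>A. scl (u (w c)) (w c)) = 0" by (simp add: sum.reindex[OF inj])
    thus False using R[rule_format, of "\<lambda>c. u (w c)"] u by auto
  qed
  ultimately show ?L by simp
qed

text \<open>An element of \<open>C\<close> outside the span of \<open>B\<close> could be added to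
  \<open>B\<close>, giving an independent set in the span of \<open>C\<close> with more than
  \<open>card C\<close> elements.\<close>

lemma span_eq_card:
  fixes B C :: "('i \<Rightarrow> 'a::field) set"
  assumes "finite C" "\<not> vs.dependent B" "B \<subseteq> vs.span C" "card C \<le> card B"
  shows "vs.span B = vs.span C"
proof (intro equalityI)
  show "vs.span B \<subseteq> vs.span C" using assms(3) by (rule vs.span_minimal) simp
  have "C \<subseteq> vs.span B"
  proof (rule ccontr)
    assume "\<not> C \<subseteq> vs.span B"
    then obtain x where x: "x \<in> C" "x \<notin> vs.span B" by blast
    have "\<not> vs.dependent (insert x B)" by (rule vs.independent_insertI) (use x assms in auto)
    moreover have "insert x B \<subseteq> vs.span C" using vs.span_base[OF x(1)] assms(3) by simp
    ultimately have "finite (insert x B) \<and> card (insert x B) \<le> card C"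
      by (rule vs.independent_span_bound[OF assms(1)])
    moreover have "x \<notin> B" using x(2) vs.span_base[of x B] by auto
    ultimately show False using assms(4) by auto
  qed
  thus "vs.span C \<subseteq> vs.span B" by (rule vs.span_minimal) simp
qed

text \<open>Vanishing of the 2x2 minors is a polynomial condition that admits 0 on either side. The
  price is that transitivity can fail through a middle vector vanishing on \<open>I\<close>, whence
  the index \<open>p\<close> in \<open>parallel_trans\<close>.\<close>

definition parallel :: "'i set \<Rightarrow> ('i \<Rightarrow> 'a::field) \<Rightarrow> ('i \<Rightarrow> 'a) \<Rightarrow> bool" where
  "parallel I t t' \<longleftrightarrow> (\<forall>i\<in>I. \<forall>j\<in>I. t i * t' j = t j * t' i)"

lemma parallel_sym: "parallel I t t' \<Longrightarrow> parallel I t' t"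
  by (auto simp: parallel_def mult.commute)

lemma parallel_iff_scale:
  assumes "p \<in> I" "t' p \<noteq> 0"
  shows "parallel I t t' \<longleftrightarrow> (\<exists>c. \<forall>i\<in>I. t i = c * t' i)"
proof
  assume "parallel I t t'"
  hence "t i = t p / t' p * t' i" if "i \<in> I" for i
    using assms that by (auto simp: parallel_def field_simps)
  thus "\<exists>c. \<forall>i\<in>I. t i = c * t' i" by blast
qed (auto simp: parallel_def)

lemma parallel_trans:
  assumes "parallel I t t'" "parallel I t' t''" "p \<in> I" "t' p \<noteq> 0"
  shows "parallel I t t''"
proof -
  obtain c c' where "\<forall>i\<in>I. t i = c * t' i" "\<forall>i\<in>I. t'' i = c' * t' i"
    using assms parallel_iff_scale[where I = I and p = p and t' = t', OF assms(3,4)]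
      parallel_sym[OF assms(2)] by blast
  thus ?thesis by (auto simp: parallel_def)
qed

text \<open>Coordinates outside \<open>{a..b}\<close> are set to 0, not dropped, so that kernels for
  different intervals live in one space and can be compared by inclusion.\<close>

definition hyperplane :: "nat \<Rightarrow> nat \<Rightarrow> (nat \<Rightarrow> 'a::field) \<Rightarrow> (nat \<Rightarrow> 'a) set" where
  "hyperplane a b t = {v. (\<forall>i. i \<notin> {a..b} \<longrightarrow> v i = 0) \<and> (\<Sum>i=a..b. t i * v i) = 0}"

lemma subspace_hyperplane: "vs.subspace (hyperplane a b t)"
  by (auto simp: vs.subspace_def hyperplane_def scl_def algebra_simps sum.distrib
      simp flip: sum_distrib_left)

text \<open>Multiplied by the nonzero number \<open>t p\<close>, the value of \<open>t'\<close> on a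
  vector supported in \<open>{a..b}\<close> becomes \<open>t' p\<close> times the value of
  \<open>t\<close>. This includes the case where \<open>t'\<close> vanishes on
  \<open>{a..b}\<close>.\<close>

lemma hyperplane_subset:
  assumes "parallel {a..b} t t'" "p \<in> {a..b}" "t p \<noteq> 0" "{a..b} \<subseteq> {a'..b'}"
  shows "hyperplane a b t \<subseteq> hyperplane a' b' t'"
proof
  fix v assume v: "v \<in> hyperplane a b t"
  have "t p * (\<Sum>i=a'..b'. t' i * v i) = t p * (\<Sum>i=a..b. t' i * v i)"
    using v assms(4) by (intro arg_cong2[of _ _ _ _ "(*)"] refl sum.mono_neutral_right)
      (auto simp: hyperplane_def)
  also have "\<dots> = (\<Sum>i=a..b. t' p * (t i * v i))"
    unfolding sum_distrib_left
  proof (intro sum.cong refl)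
    fix i assume "i \<in> {a..b}"
    hence "t p * t' i = t i * t' p" using assms(1,2) by (auto simp: parallel_def)
    thus "t p * (t' i * v i) = t' p * (t i * v i)" by (simp add: algebra_simps)
  qed
  also have "\<dots> = 0" using v by (simp add: hyperplane_def flip: sum_distrib_left)
  finally show "v \<in> hyperplane a' b' t'" using v assms(3,4) by (auto simp: hyperplane_def)
qed

text \<open>The vector with entry \<open>t j\<close> at \<open>i\<close> and \<open>- t i\<close> at
  \<open>j\<close> is killed by \<open>t\<close>; evaluating \<open>t'\<close> on it gives the minor
  for \<open>i\<close> and \<open>j\<close>.\<close>

lemma parallel_if_hyperplane_subset:
  assumes "hyperplane a b t \<subseteq> hyperplane a' b' t'" "{a..b} \<subseteq> {a'..b'}"
  shows "parallel {a..b} t t'"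
  unfolding parallel_def
proof (intro ballI)
  fix i j assume ij: "i \<in> {a..b}" "j \<in> {a..b}"
  define v where "v = (\<lambda>r. (if r = i then t j else 0) - (if r = j then t i else 0))"
  have sum: "(\<Sum>r=c..d. s r * v r) = s i * t j - s j * t i"
    if "i \<in> {c..d}" "j \<in> {c..d}" for c d and s :: "nat \<Rightarrow> 'a"
    using that by (simp add: v_def algebra_simps sum_subtractf if_distrib[of "\<lambda>x. _ * x"] cong: if_cong)
  have "v \<in> hyperplane a b t" using ij sum[of a b t] by (auto simp: hyperplane_def v_def)
  hence "(\<Sum>r=a'..b'. t' r * v r) = 0" using assms by (auto simp: hyperplane_def)
  thus "t i * t' j = t j * t' i"
    using sum[of a' b' t'] ij assms(2) by (auto simp: algebra_simps subset_iff)
qed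

lemma hyperplane_eq_iff:
  assumes "\<exists>p\<in>{a..b}. t p \<noteq> 0" "\<exists>p\<in>{a..b}. t' p \<noteq> 0"
  shows "hyperplane a b t = hyperplane a b t' \<longleftrightarrow> parallel {a..b} t t'"
  using hyperplane_subset[of a b t t' _ a b] hyperplane_subset[of a b t' t _ a b]
    parallel_if_hyperplane_subset[of a b t a b t'] parallel_sym[of "{a..b}" t t'] assms
  by blast

text \<open>The syzygy between the entries of \<open>t\<close> at \<open>p\<close> and
  \<open>q\<close>. It lies in the kernel of \<open>t\<close> and is linear in \<open>t\<close>, so
  no division enters the coordinates.\<close>

definition hyperplane_vec :: "nat \<Rightarrow> nat \<Rightarrow> (nat \<Rightarrow> 'a::field) \<Rightarrow> nat \<Rightarrow> 'a" where
  "hyperplane_vec p q t = (\<lambda>r. (if r = q then t p else 0) - (if r = p then t q else 0))"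

text \<open>At the coordinates \<open>k c\<close> other than the pivot, the family is
  \<open>t p\<close> times the standard basis. This gives independence and lets coefficients be read
  off.\<close>

lemma hyperplane_basis:
  fixes t :: "nat \<Rightarrow> 'a::field" and d :: nat
  assumes p: "p \<in> {a..b}" "t p \<noteq> 0" and k: "bij_betw k {..<d} ({a..b} - {p})"
    and w: "\<And>c. c < d \<Longrightarrow> w c = hyperplane_vec p (k c) t"
  shows "inj_on w {..<d}" "\<not> vs.dependent (w ` {..<d})" "vs.span (w ` {..<d}) = hyperplane a b t"
proof -
  have kp: "k c \<noteq> p" "k c \<in> {a..b}" if "c < d" for c
    using bij_betwE[OF k] that by auto
  have kinj: "k c = k c' \<longleftrightarrow> c = c'" if "c < d" "c' < d" for c c'
    using k that by (auto simp: bij_betw_def inj_on_def)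
  have wk: "w c' (k c) = (if c = c' then t p else 0)" if "c < d" "c' < d" for c c'
    using that kp[of c] kinj[of c c'] w[of c'] by (auto simp: hyperplane_vec_def)
  have "inj_on w {..<d} \<and> \<not> vs.dependent (w ` {..<d})"
  proof (subst frame_iff; (intro allI impI ballI)?)
    fix u c assume u: "(\<Sum>c<d. scl (u c) (w c)) = 0" and c: "c \<in> {..<d}"
    have "(\<Sum>e<d. scl (u e) (w e)) (k c) = (\<Sum>e<d. if e = c then u c * t p else 0)"
      unfolding sum_fun_apply using c by (intro sum.cong) (auto simp: scl_def wk)
    also have "\<dots> = u c * t p" using c by (subst sum.delta) auto
    finally have "u c * t p = 0" using u by simp
    thus "u c = 0" using p by simp
  qed simp
  thus "inj_on w {..<d}" "\<not> vs.dependent (w ` {..<d})" by auto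
  show "vs.span (w ` {..<d}) = hyperplane a b t"
  proof (intro equalityI vs.span_minimal subspace_hyperplane subsetI)
    fix x assume "x \<in> w ` {..<d}"
    then obtain c where c: "c < d" "x = w c" by auto
    have "(\<Sum>i=a..b. t i * w c i) = t (k c) * t p - t p * t (k c)"
      using kp[OF c(1)] p
      by (simp add: w[OF c(1)] hyperplane_vec_def algebra_simps sum_subtractf
          if_distrib[of "\<lambda>x. _ * x"] cong: if_cong)
    thus "x \<in> hyperplane a b t"
      using kp[OF c(1)] p w[OF c(1)] c(2) by (auto simp: hyperplane_def hyperplane_vec_def)
  next
    fix v assume v: "v \<in> hyperplane a b t"
    \<comment> \<open>The coefficients are forced by the coordinates \<open>k c\<close>. The
      remaining coordinate \<open>p\<close> then agrees because both sides satisfy the equation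
      \<open>t\<close>.\<close>
    have "v = (\<Sum>c<d. scl (v (k c) / t p) (w c))"
    proof
      fix r
      consider "r \<notin> {a..b}" | "r = p" | "r \<in> {a..b} - {p}" by blast
      thus "v r = (\<Sum>c<d. scl (v (k c) / t p) (w c)) r"
      proof cases
        case 1
        hence "(\<Sum>c<d. scl (v (k c) / t p) (w c)) r = 0"
          unfolding sum_fun_apply using kp p
          by (intro sum.neutral) (auto simp: scl_def w hyperplane_vec_def)
        thus ?thesis using v 1 by (auto simp: hyperplane_def)
      next
        case 2
        have "(\<Sum>c<d. scl (v (k c) / t p) (w c)) p = (\<Sum>c<d. - (t (k c) * v (k c) / t p))"
          unfolding sum_fun_apply using kp
          by (intro sum.cong) (auto simp: scl_def w hyperplane_vec_def field_simps)
        also have "\<dots> = (\<Sum>i\<in>{a..b} - {p}. - (t i * v i / t p))"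
          using sum.reindex_bij_betw[OF k, of "\<lambda>i. - (t i * v i / t p)"] by simp
        also have "\<dots> = - (\<Sum>i\<in>{a..b} - {p}. t i * v i) / t p"
          by (simp add: sum_negf sum_divide_distrib)
        also have "(\<Sum>i\<in>{a..b} - {p}. t i * v i) = - (t p * v p)"
          using v sum.remove[of "{a..b}" p "\<lambda>i. t i * v i"] p
          by (auto simp: hyperplane_def eq_neg_iff_add_eq_0 add.commute)
        finally show ?thesis using p 2 by simp
      next
        case 3
        hence "r \<in> k ` {..<d}" using k by (simp add: bij_betw_def)
        then obtain c where c: "c < d" "r = k c" by auto
        have "(\<Sum>e<d. scl (v (k e) / t p) (w e)) r = (\<Sum>e<d. if e = c then v (k c) else 0)"
          unfolding sum_fun_apply using c p
          by (intro sum.cong) (auto simp: scl_def wk)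
        also have "\<dots> = v r" using c by (subst sum.delta) auto
        finally show ?thesis by simp
      qed
    qed
    also have "\<dots> \<in> vs.span (w ` {..<d})"
      by (intro vs.span_sum vs.span_scale vs.span_base) auto
    finally show "v \<in> vs.span (w ` {..<d})" .
  qed
qed

text \<open>The pivot basis of the kernel also has \<open>b - a\<close> vectors, so an independent
  family of that size inside the kernel spans it.\<close>

lemma span_frame_eq_hyperplane:
  fixes t :: "nat \<Rightarrow> 'a::field"
  assumes p: "p \<in> {a..b}" "t p \<noteq> 0"
    and w: "inj_on w {..<b - a}" "\<not> vs.dependent (w ` {..<b - a})"
    and sub: "w ` {..<b - a} \<subseteq> hyperplane a b t"
  shows "vs.span (w ` {..<b - a}) = hyperplane a b t"
proof -
  have "card ({a..b} - {p}) = b - a" using p(1) by auto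
  then obtain k where k: "bij_betw k {..<b - a} ({a..b} - {p})"
    using ex_bij_betw_nat_finite[of "{a..b} - {p}"] by (auto simp: lessThan_atLeast0)
  define w' where "w' c = hyperplane_vec p (k c) t" for c
  note B = hyperplane_basis[where w = w' and t = t, OF p k w'_def]
  have "vs.span (w ` {..<b - a}) = vs.span (w' ` {..<b - a})"
    using sub B w by (intro span_eq_card) (auto simp: card_image)
  thus ?thesis using B by simp
qed

text \<open>
  Fraction-free Gaussian elimination: near \<open>z0\<close>, a functional vanishing on a frame of codimension
  one can be chosen with polynomial coefficients.
\<close>

lemma polynomial_functional:
  fixes w :: "nat \<Rightarrow> 's \<Rightarrow> (('i \<Rightarrow> 'k::field alg_closure) \<Rightarrow> 'k alg_closure)"
  assumes "finite S" "card S = Suc d"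
    and "\<And>c i. c < d \<Longrightarrow> i \<in> S \<Longrightarrow> w c i \<in> polys"
    and "\<And>u c. \<forall>i\<in>S. (\<Sum>c<d. u c * w c i z0) = 0 \<Longrightarrow> c < d \<Longrightarrow> u c = 0"
  shows "\<exists>t r. (\<forall>i. t i \<in> polys) \<and> r \<in> polys \<and> r z0 \<noteq> 0 \<and>
    (\<forall>z. r z \<noteq> 0 \<longrightarrow> (\<exists>i\<in>S. t i z \<noteq> 0) \<and> (\<forall>c<d. (\<Sum>i\<in>S. t i z * w c i z) = 0))"
  using assms
proof (induction d arbitrary: S w)
  case 0
  then obtain i where "S = {i}" using card_1_singletonE by auto
  thus ?case using polys_1 by (intro exI[of _ "\<lambda>_ _. 1"] exI[of _ "\<lambda>_. 1"]) auto
next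
  case (Suc d)
  note fin = Suc.prems(1) and wpoly = Suc.prems(3) and ind = Suc.prems(4)
  have "\<exists>p\<in>S. w d p z0 \<noteq> 0"
  proof (rule ccontr)
    assume "\<not> ?thesis"
    hence "\<forall>i\<in>S. (\<Sum>c<Suc d. (if c = d then 1 else 0) * w c i z0) = 0" by simp
    from ind[OF this, of d] show False by simp
  qed
  then obtain p where p: "p \<in> S" "w d p z0 \<noteq> 0" by blast
  \<comment> \<open>Elimination of coordinate \<open>p\<close> by means of the row
    \<open>w d\<close>, cross-multiplied to avoid dividing by the pivot.\<close>
  define w' where "w' c i z = w d p z * w c i z - w c p z * w d i z" for c i z
  have "\<exists>t r. (\<forall>i. t i \<in> polys) \<and> r \<in> polys \<and> r z0 \<noteq> 0 \<and>
    (\<forall>z. r z \<noteq> 0 \<longrightarrow> (\<exists>i\<in>S - {p}. t i z \<noteq> 0) \<and> (\<forall>c<d. (\<Sum>i\<in>S - {p}. t i z * w' c i z) = 0))"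
  proof (rule Suc.IH)
    show "card (S - {p}) = Suc d" using Suc.prems(2) p fin by simp
    show "w' c i \<in> polys" if "c < d" "i \<in> S - {p}" for c i
      unfolding w'_def[abs_def] using that p by (intro polys_diff polys.mult wpoly) auto
    fix u c assume u: "\<forall>i\<in>S - {p}. (\<Sum>c<d. u c * w' c i z0) = 0" and c: "c < d"
    \<comment> \<open>A relation among the reduced rows extends to the original ones: the old
      coefficients are multiplied by the pivot, and the coefficient of row \<open>d\<close> collects
      what was subtracted.\<close>
    define u' where "u' e = (if e = d then - (\<Sum>c<d. u c * w c p z0) else u e * w d p z0)" for e
    have "(\<Sum>e<Suc d. u' e * w e i z0) = (\<Sum>c<d. u c * w' c i z0)" for i
      by (simp add: u'_def w'_def algebra_simps sum_subtractf sum_distrib_left)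
    moreover have "w' c p z0 = 0" for c by (simp add: w'_def)
    ultimately have "(\<Sum>e<Suc d. u' e * w e i z0) = 0" if "i \<in> S" for i
      using u that by (cases "i = p") auto
    hence "\<forall>i\<in>S. (\<Sum>e<Suc d. u' e * w e i z0) = 0" by blast
    from ind[OF this, of c] show "u c = 0" using c p by (simp add: u'_def)
  qed (use fin in auto)
  then obtain t r where t: "\<And>i. t i \<in> polys" "r \<in> polys" "r z0 \<noteq> 0"
    "\<And>z. r z \<noteq> 0 \<Longrightarrow> \<exists>i\<in>S - {p}. t i z \<noteq> 0"
    "\<And>z c. r z \<noteq> 0 \<Longrightarrow> c < d \<Longrightarrow> (\<Sum>i\<in>S - {p}. t i z * w' c i z) = 0"
    by blast
  \<comment> \<open>Back substitution, again without division: the entry at \<open>p\<close> is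
    chosen so that row \<open>d\<close> is annihilated, and then the value on every other row is the
    value of \<open>t\<close> on the reduced row.\<close>
  define t' where "t' i z = (if i = p then - (\<Sum>j\<in>S - {p}. w d j z * t j z) else w d p z * t i z)"
    for i z
  show ?case
  proof (rule exI[of _ t'], rule exI[of _ "\<lambda>z. w d p z * r z"], intro conjI allI impI)
    show "(\<lambda>z. w d p z * r z) \<in> polys" using p t by (intro polys.mult wpoly) auto
    show "w d p z0 * r z0 \<noteq> 0" using p t by simp
    fix i
    show "t' i \<in> polys"
    proof (cases "i = p")
      case True
      have "(\<lambda>z. - (\<Sum>j\<in>S - {p}. w d j z * t j z)) \<in> polys"
        by (intro polys_uminus polys_sum polys.mult wpoly t) auto
      thus ?thesis using True by (simp add: t'_def[abs_def])
    next
      case False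
      have "(\<lambda>z. w d p z * t i z) \<in> polys" by (intro polys.mult wpoly t p) simp
      thus ?thesis using False by (simp add: t'_def[abs_def])
    qed
  next
    fix z assume "w d p z * r z \<noteq> 0"
    hence nz: "w d p z \<noteq> 0" "r z \<noteq> 0" by auto
    obtain i where "i \<in> S - {p}" "t i z \<noteq> 0" using t(4)[OF nz(2)] by blast
    thus "\<exists>i\<in>S. t' i z \<noteq> 0" using nz by (intro bexI[of _ i]) (auto simp: t'_def)
    have split: "(\<Sum>i\<in>S. t' i z * x i) =
        (\<Sum>i\<in>S - {p}. t i z * (w d p z * x i - x p * w d i z))" for x
      using p fin by (subst sum.remove[of S p])
        (auto simp: t'_def algebra_simps sum_subtractf sum_distrib_left)
    fix c assume "c < Suc d"
    thus "(\<Sum>i\<in>S. t' i z * w c i z) = 0"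
      using t(5)[OF nz(2), of c]
      by (cases "c = d") (simp_all add: split w'_def algebra_simps)
  qed
qed

section \<open>Coordinates of the wonderful model\<close>

text \<open>In a finite field the product of all X - a, increased by 1, has no root. The result is
  needed because \<open>'k\<close> may be finite.\<close>

lemma infinite_alg_closed: "infinite (UNIV :: 'a::alg_closed_field set)"
proof
  assume fin: "finite (UNIV :: 'a set)"
  define p where "p = (\<Prod>a\<in>UNIV. [:- a, 1 :: 'a:])"
  have "degree p = card (UNIV :: 'a set)"
    unfolding p_def by (subst degree_prod_sum_eq) simp_all
  hence "degree p > 0" using fin by (simp add: card_gt_0_iff)
  hence "degree (p + 1) > 0" by (subst degree_add_eq_left) simp_all
  then obtain x where x: "poly (p + 1) x = 0" using alg_closed_imp_poly_has_root by blast
  have "poly p x = 0" unfolding p_def poly_prod using fin by (intro prod_zero) auto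
  thus False using x by simp
qed

lemma subspace_vecs: "vs.subspace (vecs n)"
  by (auto simp: vs.subspace_def vecs_def scl_def)

section \<open>Vectors through their consecutive differences\<close>

definition gaps :: "(nat \<Rightarrow> 'a::field) \<Rightarrow> nat \<Rightarrow> 'a" where
  "gaps x i = x i - x (Suc i)"

definition flat :: "nat \<Rightarrow> nat \<Rightarrow> nat \<Rightarrow> (nat \<Rightarrow> 'a::field) set" where
  "flat n a b = {x \<in> vecs n. \<forall>i\<in>{a..b}. gaps x i = 0}"

text \<open>A right inverse of \<open>gaps\<close>, normalised so that the coordinate with index
  \<open>n\<close> is 0. The coordinates are suffix sums, hence polynomial in the prescribed
  gaps.\<close>

definition of_gaps :: "nat \<Rightarrow> (nat \<Rightarrow> 'a::field) \<Rightarrow> nat \<Rightarrow> 'a" where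
  "of_gaps n t r = (if r \<in> {1..n} then \<Sum>k=r..<n. t k else 0)"

lemma of_gaps_in_vecs: "of_gaps n t \<in> vecs n"
  by (auto simp: vecs_def of_gaps_def)

lemma gaps_of_gaps: "1 \<le> i \<Longrightarrow> i < n \<Longrightarrow> gaps (of_gaps n t) i = t i"
  by (auto simp: gaps_def of_gaps_def sum.atLeast_Suc_lessThan)

lemma gaps_scl: "gaps (scl c x) i = c * gaps x i"
  by (simp add: gaps_def scl_def algebra_simps)

lemma gaps_diff: "gaps (x - y) i = gaps x i - gaps y i"
  by (simp add: gaps_def)

lemma subspace_flat: "vs.subspace (flat n a b)"
  using subspace_vecs[of n] by (auto simp: vs.subspace_def flat_def gaps_scl) (auto simp: gaps_def)

lemma annihilator_ncA_space:
  assumes "1 \<le> a" "b < n"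
  shows "annihilator n (ncA_space {a..Suc b} :: (nat \<Rightarrow> 'k::field) set) = flat n a b"
proof -
  have gen: "(\<Sum>r=1..n. to_ac ((std i - std (Suc i)) r) * x r) = gaps x i"
    if "1 \<le> i" "i < n" for i and x :: "nat \<Rightarrow> 'k alg_closure"
    using that
    by (simp add: std_def gaps_def algebra_simps sum_subtractf if_distrib[of to_ac]
        if_distrib[of "\<lambda>y. _ * y"] cong: if_cong)
  show ?thesis
  proof (intro equalityI subsetI)
    fix x :: "nat \<Rightarrow> 'k alg_closure"
    assume x: "x \<in> annihilator n (ncA_space {a..Suc b} :: (nat \<Rightarrow> 'k) set)"
    have "gaps x i = 0" if "i \<in> {a..b}" for i
    proof -
      have "(std i - std (Suc i) :: nat \<Rightarrow> 'k) \<in> ncA_space {a..Suc b}"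
        unfolding ncA_space_Icc using that by (intro vs.span_base) auto
      hence "(\<Sum>r=1..n. to_ac ((std i - std (Suc i) :: nat \<Rightarrow> 'k) r) * x r) = 0"
        using x unfolding annihilator_def by blast
      thus ?thesis using gen[of i x] that assms by simp
    qed
    thus "x \<in> flat n a b" using x by (simp add: annihilator_def flat_def)
  next
    fix x :: "nat \<Rightarrow> 'k alg_closure" assume x: "x \<in> flat n a b"
    have "ncA_space {a..Suc b} \<subseteq> {\<phi> :: nat \<Rightarrow> 'k. (\<Sum>r=1..n. to_ac (\<phi> r) * x r) = 0}"
      unfolding ncA_space_Icc
    proof (rule vs.span_minimal)
      show "(\<lambda>i. std i - std (Suc i)) ` {a..<Suc b} \<subseteq>
          {\<phi> :: nat \<Rightarrow> 'k. (\<Sum>r=1..n. to_ac (\<phi> r) * x r) = 0}"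
      proof (intro image_subsetI CollectI)
        fix i assume i: "i \<in> {a..<Suc b}"
        hence "gaps x i = 0" using x by (auto simp: flat_def)
        thus "(\<Sum>r=1..n. to_ac ((std i - std (Suc i) :: nat \<Rightarrow> 'k) r) * x r) = 0"
          using gen[of i x] i assms by simp
      qed
      show "vs.subspace {\<phi> :: nat \<Rightarrow> 'k. (\<Sum>r=1..n. to_ac (\<phi> r) * x r) = 0}"
        by (auto simp: vs.subspace_def scl_def algebra_simps sum.distrib simp flip: sum_distrib_left)
    qed
    thus "x \<in> annihilator n (ncA_space {a..Suc b} :: (nat \<Rightarrow> 'k) set)"
      using x unfolding annihilator_def flat_def by blast
  qed
qed

text \<open>The line N is where all gaps vanish, so the kernel of the factor P(V) has the same form
  as the kernels of the other factors.\<close>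

lemma base_change_diag: "base_change (diag n :: (nat \<Rightarrow> 'k::field) set) = flat n 1 (n - 1)"
proof -
  let ?one = "\<lambda>i. if i \<in> {1..n} then 1 else 0"
  have diag: "(diag n :: (nat \<Rightarrow> 'k) set) = range (\<lambda>c. scl c ?one)"
    unfolding diag_def by (rule vs.span_singleton)
  have one: "scl c (?one :: nat \<Rightarrow> 'k alg_closure) \<in> flat n 1 (n - 1)" for c
    by (auto simp: flat_def vecs_def gaps_def scl_def)
  show ?thesis
    unfolding base_change_def
  proof (intro equalityI vs.span_minimal subspace_flat image_subsetI subsetI)
    fix v :: "nat \<Rightarrow> 'k" assume "v \<in> diag n"
    then obtain c where "v = scl c ?one" using diag by blast
    hence "to_ac \<circ> v = scl (to_ac c) ?one" by (auto simp: scl_def fun_eq_iff)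
    thus "to_ac \<circ> v \<in> flat n 1 (n - 1)" using one by simp
  next
    fix x :: "nat \<Rightarrow> 'k alg_closure" assume x: "x \<in> flat n 1 (n - 1)"
    have const: "x (Suc i) = x 1" if "Suc i \<le> n" for i
      using that
    proof (induction i)
      case (Suc i)
      have "gaps x (Suc i) = 0" using x Suc.prems by (auto simp: flat_def)
      thus ?case using Suc by (simp add: gaps_def)
    qed simp
    have x_eq: "x = scl (x 1) (to_ac \<circ> (?one :: nat \<Rightarrow> 'k))"
    proof
      fix i
      show "x i = scl (x 1) (to_ac \<circ> (?one :: nat \<Rightarrow> 'k)) i"
      proof (cases "i \<in> {1..n}")
        case True
        thus ?thesis using const[of "i - 1"] by (simp add: scl_def)
      next
        case False
        hence "x i = 0" using x unfolding flat_def vecs_def by blast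
        thus ?thesis using False by (auto simp: scl_def)
      qed
    qed
    moreover have "(?one :: nat \<Rightarrow> 'k) \<in> diag n" unfolding diag_def by (intro vs.span_base) simp
    ultimately have "scl (x 1) (to_ac \<circ> (?one :: nat \<Rightarrow> 'k)) \<in>
        vs.span ((\<lambda>v. to_ac \<circ> v) ` (diag n :: (nat \<Rightarrow> 'k) set))"
      by (intro vs.span_scale vs.span_base imageI)
    thus "x \<in> vs.span ((\<lambda>v. to_ac \<circ> v) ` (diag n :: (nat \<Rightarrow> 'k) set))"
      by (subst x_eq)
  qed
qed

section \<open>Lines in quotient spaces\<close>

lemma coset_of_eq_iff:
  assumes "vs.subspace U"
  shows "coset_of U x = coset_of U y \<longleftrightarrow> x - y \<in> U"
proof
  assume "coset_of U x = coset_of U y"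
  moreover have "x \<in> coset_of U x" using vs.subspace_0[OF assms] by (simp add: coset_of_def)
  ultimately show "x - y \<in> U" by (simp add: coset_of_def)
next
  assume xy: "x - y \<in> U"
  have "z - x \<in> U \<longleftrightarrow> z - y \<in> U" for z
    using vs.subspace_add[OF assms, of "z - x" "x - y"] vs.subspace_diff[OF assms, of "z - y" "x - y"] xy
    by auto
  thus "coset_of U x = coset_of U y" by (simp add: coset_of_def)
qed

lemma line_of_eq_iff:
  assumes U: "vs.subspace U" and x: "x \<notin> U"
  shows "line_of U x = line_of U x' \<longleftrightarrow> (\<exists>c. x - scl c x' \<in> U)"
proof
  assume eq: "line_of U x = line_of U x'"
  have "coset_of U (scl 1 x) \<in> line_of U x" unfolding line_of_def by (rule rangeI)
  then obtain c where "coset_of U (scl 1 x) = coset_of U (scl c x')" using eq by (auto simp: line_of_def)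
  thus "\<exists>c. x - scl c x' \<in> U" by (auto simp: coset_of_eq_iff[OF U])
next
  assume "\<exists>c. x - scl c x' \<in> U"
  then obtain c where c: "x - scl c x' \<in> U" ..
  have c0: "c \<noteq> 0" using c x by auto
  have sub: "coset_of U (scl e x) = coset_of U (scl (e * c) x')" for e
    using vs.subspace_scale[OF U c, of e] by (simp add: coset_of_eq_iff[OF U] vs.scale_right_diff_distrib)
  have "coset_of U (scl e x') = coset_of U (scl (e / c) x)" for e
    using sub[of "e / c"] c0 by simp
  thus "line_of U x = line_of U x'" unfolding line_of_def using sub by blast
qed

lemma notin_flat_iff: "x \<in> vecs n \<Longrightarrow> x \<notin> flat n a b \<longleftrightarrow> (\<exists>i\<in>{a..b}. gaps x i \<noteq> 0)"
  by (auto simp: flat_def)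

text \<open>Modulo \<open>flat n a b\<close> a vector is determined by its gaps in
  \<open>{a..b}\<close>, so equality of points becomes proportionality of gap vectors.\<close>

lemma line_of_flat_eq_iff:
  assumes "x \<in> vecs n - flat n a b" "x' \<in> vecs n - flat n a b"
  shows "line_of (flat n a b) x = line_of (flat n a b) x' \<longleftrightarrow> parallel {a..b} (gaps x) (gaps x')"
proof -
  obtain p where p: "p \<in> {a..b}" "gaps x' p \<noteq> 0" using assms notin_flat_iff by blast
  have "x - scl c x' \<in> flat n a b \<longleftrightarrow> (\<forall>i\<in>{a..b}. gaps x i = c * gaps x' i)" for c
    using assms vs.subspace_diff[OF subspace_vecs, of x n "scl c x'"]
      vs.subspace_scale[OF subspace_vecs, of x' n c]
    by (auto simp: flat_def gaps_diff gaps_scl)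
  thus ?thesis
    using line_of_eq_iff[OF subspace_flat, of x n a b x'] assms
      parallel_iff_scale[where t' = "gaps x'" and t = "gaps x", OF p] by simp
qed

lemma quot_line_line_of:
  assumes "vs.subspace U" "vs.subspace W" "U \<subseteq> W"
  shows "quot_line W (line_of U x) = line_of W x"
proof -
  have "(\<Union>y\<in>coset_of U z. coset_of W y) = coset_of W z" for z
  proof -
    have "coset_of W y = coset_of W z" if "y \<in> coset_of U z" for y
      using that assms unfolding coset_of_eq_iff[OF assms(2)] by (auto simp: coset_of_def)
    moreover have "z \<in> coset_of U z" using vs.subspace_0[OF assms(1)] by (simp add: coset_of_def)
    ultimately show ?thesis by blast
  qed
  thus ?thesis by (simp add: quot_line_def line_of_def image_image)
qed

text \<open>Intervals \<open>{a..b}\<close> are intervals of gaps: the index \<open>iv a b\<close> is that of \<open>H_{[a,b+1]}\<close>.\<close>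

definition iv :: "nat \<Rightarrow> nat \<Rightarrow> (nat \<Rightarrow> 'k::field) set option" where
  "iv a b = Some (ncA_space {a..Suc b})"

definition idx :: "nat \<Rightarrow> (nat \<times> nat) set" where
  "idx n = {(a, b). 1 \<le> a \<and> a \<le> b \<and> b < n}"

lemma finite_idx: "finite (idx n)"
  by (rule finite_subset[of _ "{..n} \<times> {..n}"]) (auto simp: idx_def)

text \<open>The flat of an interval recovers it: a vector whose only nonzero gap is at
  \<open>i\<close> lies outside the flat exactly when \<open>i\<close> is in the interval.\<close>

lemma iv_inject:
  assumes "(a, b) \<in> idx n" "(a', b') \<in> idx n"
    and eq: "iv a b = (iv a' b' :: (nat \<Rightarrow> 'k::field) set option)"
  shows "a = a' \<and> b = b'"
proof -
  have "flat n a b = (flat n a' b' :: (nat \<Rightarrow> 'k alg_closure) set)"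
    using annihilator_ncA_space[of a b n, where 'k = 'k]
      annihilator_ncA_space[of a' b' n, where 'k = 'k] assms by (simp add: idx_def iv_def)
  moreover have "of_gaps n (\<lambda>k. if k = i then 1 else 0 :: 'k alg_closure) \<notin> flat n c d \<longleftrightarrow> i \<in> {c..d}"
    if "(c, d) \<in> idx n" for i c d
    using that by (auto simp: notin_flat_iff[OF of_gaps_in_vecs] idx_def gaps_of_gaps)
  ultimately have "{a..b} = {a'..b'}" using assms(1,2) by blast
  thus ?thesis using assms by (auto simp: idx_def Icc_eq_Icc)
qed

text \<open>Factors are indexed by subspaces, so the interval has to be recovered by choice; it is
  unique by \<open>iv_inject\<close>. The index \<open>None\<close> receives the full interval,
  which makes \<open>flat\<close> describe every kernel.\<close>

definition bounds :: "nat \<Rightarrow> (nat \<Rightarrow> 'k::field) set option \<Rightarrow> nat \<times> nat" where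
  "bounds n j = (if j = None then (1, n - 1) else SOME p. p \<in> idx n \<and> j = iv (fst p) (snd p))"

abbreviation rng :: "nat \<Rightarrow> (nat \<Rightarrow> 'k::field) set option \<Rightarrow> nat set" where
  "rng n j \<equiv> {fst (bounds n j)..snd (bounds n j)}"

lemma bounds_iv:
  assumes "(a, b) \<in> idx n"
  shows "bounds n (iv a b :: (nat \<Rightarrow> 'k::field) set option) = (a, b)"
proof -
  have "(SOME p. p \<in> idx n \<and> (iv a b :: (nat \<Rightarrow> 'k) set option) = iv (fst p) (snd p)) = (a, b)"
  proof (rule some_equality)
    fix p assume p: "p \<in> idx n \<and> (iv a b :: (nat \<Rightarrow> 'k) set option) = iv (fst p) (snd p)"
    hence "(fst p, snd p) \<in> idx n" by simp
    thus "p = (a, b)" using iv_inject[OF assms _ conjunct2[OF p]] by (simp add: prod_eq_iff)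
  qed (use assms in simp)
  thus ?thesis by (simp add: bounds_def iv_def)
qed

lemma bounds_None: "bounds n None = (1, n - 1)"
  by (simp add: bounds_def)

abbreviation ncA_index :: "nat \<Rightarrow> (nat \<Rightarrow> 'k::field) set option set" where
  "ncA_index n \<equiv> wonderful_index (ncA_min n)"

lemma ncA_index_eq:
  "(ncA_index n :: (nat \<Rightarrow> 'k::field) set option set) = insert None {iv a b | a b. (a, b) \<in> idx n}"
proof -
  have "Some ` ncA_min n = {iv a b :: (nat \<Rightarrow> 'k) set option | a b. (a, b) \<in> idx n}"
  proof (intro equalityI subsetI)
    fix j :: "(nat \<Rightarrow> 'k) set option" assume "j \<in> Some ` ncA_min n"
    then obtain a b where ab: "j = Some (ncA_space {a..b})" "1 \<le> a" "a < b" "b \<le> n"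
      by (auto simp: ncA_min_def)
    hence "j = iv a (b - 1)" "(a, b - 1) \<in> idx n" by (auto simp: iv_def idx_def)
    thus "j \<in> {iv a b | a b. (a, b) \<in> idx n}" by blast
  next
    fix j :: "(nat \<Rightarrow> 'k) set option" assume "j \<in> {iv a b | a b. (a, b) \<in> idx n}"
    then obtain a b where ab: "j = iv a b" "(a, b) \<in> idx n" by blast
    hence "(ncA_space {a..Suc b} :: (nat \<Rightarrow> 'k) set) \<in> ncA_min n" unfolding ncA_min_def idx_def
      by (intro CollectI exI[of _ a] exI[of _ "Suc b"]) auto
    thus "j \<in> Some ` ncA_min n" using ab by (simp add: iv_def)
  qed
  thus ?thesis by (simp add: wonderful_index_def)
qed

lemma ncA_index_cases:
  assumes "j \<in> ncA_index n"
  obtains "j = None" | a b where "j = iv a b" "(a, b) \<in> idx n"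
  using assms by (auto simp: ncA_index_eq)

lemma factor_kernel_ncA:
  "j \<in> ncA_index n \<Longrightarrow>
    factor_kernel n (diag n) j = flat n (fst (bounds n j)) (snd (bounds n j))"
proof (erule ncA_index_cases)
  fix a b assume "j = iv a b" "(a, b) \<in> idx n"
  thus "factor_kernel n (diag n) j = flat n (fst (bounds n j)) (snd (bounds n j))"
    by (auto simp: bounds_iv) (auto simp: iv_def idx_def annihilator_ncA_space)
qed (simp add: bounds_None base_change_diag)

lemma bounds_in_idx: "j \<in> ncA_index n \<Longrightarrow> n \<ge> 2 \<Longrightarrow> bounds n j \<in> idx n"
  by (erule ncA_index_cases) (auto simp: bounds_iv bounds_None idx_def)

section \<open>Coordinates and equations on the ambient product\<close>

abbreviation ncA_ambient :: "nat \<Rightarrow> ((nat \<Rightarrow> 'k::field) set option \<times> nat, 'k,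
     (nat \<Rightarrow> 'k) set option \<Rightarrow> (nat \<Rightarrow> 'k alg_closure) set set) variety" where
  "ncA_ambient n \<equiv> wonderful_ambient n (diag n) (ncA_min n)"

abbreviation gaps_at :: "('j \<times> nat \<Rightarrow> 'a::field) \<Rightarrow> 'j \<Rightarrow> nat \<Rightarrow> 'a" where
  "gaps_at z j \<equiv> gaps (comp_at z j)"

lemma hcoords_ambient_iff:
  "z \<in> hcoords (ncA_ambient n) \<longleftrightarrow>
    (\<forall>j\<in>ncA_index n. comp_at z j \<in> vecs n \<and> (\<exists>i\<in>rng n j. gaps_at z j i \<noteq> 0)) \<and>
    (\<forall>j. j \<notin> ncA_index n \<longrightarrow> comp_at z j = 0)"
proof -
  have "comp_at z j \<in> vecs n - factor_kernel n (diag n) j \<longleftrightarrow>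
      comp_at z j \<in> vecs n \<and> (\<exists>i\<in>rng n j. gaps_at z j i \<noteq> 0)" if "j \<in> ncA_index n" for j
    using that notin_flat_iff[of "comp_at z j" n] by (auto simp: factor_kernel_ncA)
  thus ?thesis by (auto simp: wonderful_ambient_def proj_prod_def split: if_splits)
qed

lemma point_of_ambient:
  "point_of (ncA_ambient n) z =
    (\<lambda>j\<in>ncA_index n. line_of (flat n (fst (bounds n j)) (snd (bounds n j))) (comp_at z j))"
  by (auto simp: wonderful_ambient_def proj_prod_def factor_kernel_ncA intro!: restrict_ext)

lemma point_of_ambient_eq_iff:
  assumes "z \<in> hcoords (ncA_ambient n)" "z' \<in> hcoords (ncA_ambient n)"
  shows "point_of (ncA_ambient n) z = point_of (ncA_ambient n) z' \<longleftrightarrow>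
    (\<forall>j\<in>ncA_index n. parallel (rng n j) (gaps_at z j) (gaps_at z' j))"
proof -
  have "line_of (flat n (fst (bounds n j)) (snd (bounds n j))) (comp_at z j) =
      line_of (flat n (fst (bounds n j)) (snd (bounds n j))) (comp_at z' j) \<longleftrightarrow>
      parallel (rng n j) (gaps_at z j) (gaps_at z' j)" if "j \<in> ncA_index n" for j
    using that assms by (intro line_of_flat_eq_iff) (auto simp: hcoords_ambient_iff flat_def)
  thus ?thesis
    by (auto simp: point_of_ambient restrict_def fun_eq_iff)
qed

text \<open>These will be the equations of the model. For \<open>n \<ge> 2\<close> the indices
  \<open>None\<close> and \<open>iv 1 (n - 1)\<close> have the same range, so the condition also
  forces these two components to agree up to scaling.\<close>

definition restr_compat :: "nat \<Rightarrow> ((nat \<Rightarrow> 'k::field) set option \<times> nat \<Rightarrow> 'k alg_closure) \<Rightarrow> bool" where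
  "restr_compat n z \<longleftrightarrow> (\<forall>j\<in>ncA_index n. \<forall>j'\<in>ncA_index n. rng n j \<subseteq> rng n j' \<longrightarrow>
     parallel (rng n j) (gaps_at z j) (gaps_at z j'))"

text \<open>Another representative of the same point only rescales the gaps of each component, and
  the minors are homogeneous in each of the two components. The condition thus belongs to
  points.\<close>

lemma restr_compat_cong:
  fixes z z' :: "(nat \<Rightarrow> 'k::field) set option \<times> nat \<Rightarrow> 'k alg_closure"
  assumes z: "z \<in> hcoords (ncA_ambient n)" and z': "z' \<in> hcoords (ncA_ambient n)"
    and eq: "point_of (ncA_ambient n) z = point_of (ncA_ambient n) z'" and c: "restr_compat n z'"
  shows "restr_compat n z"
  unfolding restr_compat_def
proof (intro ballI impI)
  fix j j' :: "(nat \<Rightarrow> 'k) set option"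
  assume j: "j \<in> ncA_index n" "j' \<in> ncA_index n" "rng n j \<subseteq> rng n j'"
  have sc: "\<exists>c. \<forall>i\<in>rng n e. gaps_at z e i = c * gaps_at z' e i" 
    if e: "e \<in> ncA_index n" for e :: "(nat \<Rightarrow> 'k) set option"
  proof -
    obtain p where "p \<in> rng n e" "gaps_at z' e p \<noteq> 0" using z' e unfolding hcoords_ambient_iff by blast
    from parallel_iff_scale[where t = "gaps_at z e" and t' = "gaps_at z' e", OF this]
    show ?thesis using eq e unfolding point_of_ambient_eq_iff[OF z z'] by blast
  qed
  obtain c c' where "\<forall>i\<in>rng n j. gaps_at z j i = c * gaps_at z' j i"
    "\<forall>i\<in>rng n j'. gaps_at z j' i = c' * gaps_at z' j' i"
    using sc j by blast
  moreover have "parallel (rng n j) (gaps_at z' j) (gaps_at z' j')"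
    using c j unfolding restr_compat_def by blast
  ultimately show "parallel (rng n j) (gaps_at z j) (gaps_at z j')"
    using j(3) unfolding parallel_def by (simp add: subset_iff algebra_simps)
qed

lemma gaps_at_polys: "(\<lambda>z. gaps_at z j i) \<in> polys"
  unfolding gaps_def comp_at_def by (intro polys_diff polys.coord)

lemma zariski_closed_compat:
  "zariski_closed (ncA_ambient n :: (_, 'k::field, _) variety)
    (point_of (ncA_ambient n) ` {z \<in> hcoords (ncA_ambient n). restr_compat n z})"
  unfolding zariski_closed_def
proof (intro conjI exI)
  let ?A = "ncA_ambient n :: (_, 'k, _) variety"
  let ?F = "{\<lambda>z :: (nat \<Rightarrow> 'k) set option \<times> nat \<Rightarrow> 'k alg_closure.
      gaps_at z j i * gaps_at z j' k - gaps_at z j k * gaps_at z j' i | j j' i k.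
    j \<in> (ncA_index n :: (nat \<Rightarrow> 'k) set option set) \<and> j' \<in> ncA_index n \<and>
    rng n j \<subseteq> rng n j' \<and> i \<in> rng n j \<and> k \<in> rng n j}"
  show "point_of ?A ` {z \<in> hcoords ?A. restr_compat n z} \<subseteq> points ?A"
    unfolding points_def by blast
  show "?F \<subseteq> polys"
  proof
    fix f :: "((nat \<Rightarrow> 'k) set option \<times> nat \<Rightarrow> 'k alg_closure) \<Rightarrow> 'k alg_closure"
    assume "f \<in> ?F"
    then obtain j j' i k where "f = (\<lambda>z. gaps_at z j i * gaps_at z j' k - gaps_at z j k * gaps_at z j' i)" by blast
    thus "f \<in> polys" by (simp only:) (intro polys_diff polys.mult gaps_at_polys)
  qed
  show "\<forall>x\<in>hcoords ?A. point_of ?A x \<in> point_of ?A ` {z \<in> hcoords ?A. restr_compat n z} \<longleftrightarrow>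
      (\<forall>f\<in>?F. f x = 0)"
  proof
    fix x assume x: "x \<in> hcoords ?A"
    have "point_of ?A x \<in> point_of ?A ` {z \<in> hcoords ?A. restr_compat n z} \<longleftrightarrow> restr_compat n x"
      using restr_compat_cong[OF x] x by blast
    also have "\<dots> \<longleftrightarrow> (\<forall>f\<in>?F. f x = 0)"
    proof
      assume "restr_compat n x"
      hence "gaps_at x j i * gaps_at x j' k - gaps_at x j k * gaps_at x j' i = 0"
        if "j \<in> ncA_index n" "j' \<in> ncA_index n" "rng n j \<subseteq> rng n j'" "i \<in> rng n j" "k \<in> rng n j"
        for j j' i k
        using that unfolding restr_compat_def parallel_def right_minus_eq by blast
      thus "\<forall>f\<in>?F. f x = 0" by blast
    next
      assume F: "\<forall>f\<in>?F. f x = 0"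
      show "restr_compat n x"
        unfolding restr_compat_def parallel_def
      proof (intro ballI impI)
        fix j j' :: "(nat \<Rightarrow> 'k) set option" and i k
        assume "j \<in> ncA_index n" "j' \<in> ncA_index n" "rng n j \<subseteq> rng n j'"
          "i \<in> rng n j" "k \<in> rng n j"
        hence "(\<lambda>z. gaps_at z j i * gaps_at z j' k - gaps_at z j k * gaps_at z j' i) \<in> ?F" by blast
        from bspec[OF F this] show "gaps_at x j i * gaps_at x j' k = gaps_at x j k * gaps_at x j' i" by simp
      qed
    qed
    finally show "point_of ?A x \<in> point_of ?A ` {z \<in> hcoords ?A. restr_compat n z} \<longleftrightarrow>
      (\<forall>f\<in>?F. f x = 0)" .
  qed
qed

text \<open>Coordinates for the image of the line of \<open>x\<close> under the natural map: the
  vector \<open>x\<close> itself lifts a generator of the line in every factor.\<close>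

definition spread :: "nat \<Rightarrow> (nat \<Rightarrow> 'k alg_closure) \<Rightarrow>
    (nat \<Rightarrow> 'k::field) set option \<times> nat \<Rightarrow> 'k alg_closure" where
  "spread n x = (\<lambda>(j, r). if j \<in> ncA_index n then x r else 0)"

lemma comp_at_spread: "comp_at (spread n x) j = (if j \<in> ncA_index n then x else 0)"
  by (auto simp: comp_at_def spread_def)

text \<open>Only the one-gap flats matter for removal: the flat of a longer interval is contained in
  that of each of its gaps. Conversely, having all gaps nonzero does not depend on the generator of
  the line.\<close>

lemma proj_complement_iff:
  fixes l :: "(nat \<Rightarrow> 'k::field alg_closure) set set"
  assumes n: "n \<ge> 2"
  shows "l \<in> proj_complement n (diag n) (ncA_min n :: (nat \<Rightarrow> 'k) set set) \<longleftrightarrow>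
    (\<exists>x\<in>vecs n. (\<forall>i\<in>{1..n - 1}. gaps x i \<noteq> 0) \<and> l = line_of (flat n 1 (n - 1)) x)"
proof -
  let ?F = "flat n 1 (n - 1) :: (nat \<Rightarrow> 'k alg_closure) set"
  have ann: "(\<Union>G\<in>(ncA_min n :: (nat \<Rightarrow> 'k) set set). proj_space (annihilator n G) ?F) =
      (\<Union>(a, b)\<in>idx n. proj_space (flat n a b) ?F)"
  proof -
    have "ncA_min n = (\<lambda>(a, b). ncA_space {a..Suc b} :: (nat \<Rightarrow> 'k) set) ` idx n"
    proof (intro equalityI subsetI)
      fix G :: "(nat \<Rightarrow> 'k) set" assume "G \<in> ncA_min n"
      then obtain a b where ab: "G = ncA_space {a..b}" "1 \<le> a" "a < b" "b \<le> n"
        by (auto simp: ncA_min_def)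
      thus "G \<in> (\<lambda>(a, b). ncA_space {a..Suc b}) ` idx n"
        by (intro image_eqI[of _ _ "(a, b - 1)"]) (auto simp: idx_def)
    qed (force simp: ncA_min_def idx_def)
    thus ?thesis by (auto simp: idx_def annihilator_ncA_space)
  qed
  show ?thesis
  proof
    assume "l \<in> proj_complement n (diag n) (ncA_min n :: (nat \<Rightarrow> 'k) set set)"
    hence l: "l \<in> proj_space (vecs n) ?F" "\<And>a b. (a, b) \<in> idx n \<Longrightarrow> l \<notin> proj_space (flat n a b) ?F"
      unfolding proj_complement_def base_change_diag ann by auto
    then obtain x where x: "x \<in> vecs n" "x \<notin> ?F" "l = line_of ?F x"
      by (auto simp: proj_space_def)
    have "gaps x i \<noteq> 0" if i: "i \<in> {1..n - 1}" for i
    proof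
      assume "gaps x i = 0"
      hence "x \<in> flat n i i - ?F" using x by (simp add: flat_def)
      hence "l \<in> proj_space (flat n i i) ?F" unfolding proj_space_def x(3) by (rule imageI)
      moreover have "i < n" using i n unfolding atLeastAtMost_iff by linarith
      ultimately show False using l(2)[of i i] i by (auto simp: idx_def)
    qed
    thus "\<exists>x\<in>vecs n. (\<forall>i\<in>{1..n - 1}. gaps x i \<noteq> 0) \<and> l = line_of ?F x" using x by blast
  next
    assume "\<exists>x\<in>vecs n. (\<forall>i\<in>{1..n - 1}. gaps x i \<noteq> 0) \<and> l = line_of ?F x"
    then obtain x where x: "x \<in> vecs n" "\<And>i. i \<in> {1..n - 1} \<Longrightarrow> gaps x i \<noteq> 0" "l = line_of ?F x"
      by blast
    have "1 \<in> {1..n - 1}" using n by simp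
    hence xF: "x \<in> vecs n - ?F" using x(1,2) unfolding flat_def by blast
    have "l \<notin> proj_space (flat n a b) ?F" if ab: "(a, b) \<in> idx n" for a b
    proof
      assume "l \<in> proj_space (flat n a b) ?F"
      then obtain y where y: "y \<in> flat n a b" "y \<notin> ?F" "l = line_of ?F y"
        by (auto simp: proj_space_def)
      hence yF: "y \<in> vecs n - ?F" by (auto simp: flat_def)
      have "line_of ?F x = line_of ?F y" using x(3) y(3) by simp
      hence par: "parallel {1..n - 1} (gaps x) (gaps y)"
        by (rule line_of_flat_eq_iff[OF xF yF, THEN iffD1])
      have a: "a \<in> {1..n - 1}" "gaps y a = 0" using ab y(1) by (auto simp: idx_def flat_def)
      have "gaps y i = 0" if "i \<in> {1..n - 1}" for i
        using par that a x(2)[OF a(1)] unfolding parallel_def by force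
      thus False using y by (auto simp: flat_def)
    qed
    moreover have "l \<in> proj_space (vecs n) ?F" unfolding proj_space_def x(3) using xF by (rule imageI)
    ultimately show "l \<in> proj_complement n (diag n) (ncA_min n :: (nat \<Rightarrow> 'k) set set)"
      unfolding proj_complement_def base_change_diag ann by auto
  qed
qed

lemma natural_map_line_of:
  fixes x :: "nat \<Rightarrow> 'k::field alg_closure"
  shows "natural_map n (ncA_min n :: (nat \<Rightarrow> 'k) set set) (line_of (flat n 1 (n - 1)) x) =
    point_of (ncA_ambient n) (spread n x)"
  unfolding natural_map_def point_of_ambient
proof (intro restrict_ext)
  fix j :: "(nat \<Rightarrow> 'k) set option" assume j: "j \<in> ncA_index n"
  have "quot_line (flat n a b) (line_of (flat n 1 (n - 1)) x) = line_of (flat n a b) x"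
    if "(a, b) \<in> idx n" for a b
    using that by (intro quot_line_line_of subspace_flat) (auto simp: flat_def idx_def)
  thus "(case j of None \<Rightarrow> line_of (flat n 1 (n - 1)) x
         | Some G \<Rightarrow> quot_line (annihilator n G) (line_of (flat n 1 (n - 1)) x)) =
        line_of (flat n (fst (bounds n j)) (snd (bounds n j))) (comp_at (spread n x) j)"
    using j
  proof (cases rule: ncA_index_cases[OF j, case_names None iv])
    case (iv a b)
    thus ?thesis
      using \<open>\<And>a b. (a, b) \<in> idx n \<Longrightarrow> _\<close> j
      by (simp add: comp_at_spread bounds_iv) (simp add: iv_def idx_def annihilator_ncA_space)
  qed (simp_all add: comp_at_spread bounds_None)
qed

lemma spread_in_hcoords:
  assumes "n \<ge> 2" "x \<in> vecs n" "\<And>i. i \<in> {1..n - 1} \<Longrightarrow> gaps x i \<noteq> 0"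
  shows "spread n x \<in> hcoords (ncA_ambient n)"
proof -
  have "fst (bounds n j) \<in> rng n j \<and> fst (bounds n j) \<in> {1..n - 1}"
    if "j \<in> ncA_index n" for j :: "(nat \<Rightarrow> 'a) set option"
    using bounds_in_idx[OF that assms(1)] by (cases "bounds n j") (auto simp: idx_def)
  thus ?thesis using assms unfolding hcoords_ambient_iff comp_at_spread by fastforce
qed

lemma restr_compat_spread: "restr_compat n (spread n x)"
  by (simp add: restr_compat_def parallel_def comp_at_spread)

lemma iv_in_ncA_index:
  "(a, b) \<in> idx n \<Longrightarrow> (iv a b :: (nat \<Rightarrow> 'k::field) set option) \<in> ncA_index n"
  by (auto simp: ncA_index_eq)

lemma gaps_at_iv_nonzero:
  fixes z :: "(nat \<Rightarrow> 'k::field) set option \<times> nat \<Rightarrow> 'k alg_closure"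
  assumes "z \<in> hcoords (ncA_ambient n)" "(a, b) \<in> idx n"
  shows "\<exists>i\<in>{a..b}. gaps_at z (iv a b) i \<noteq> 0"
proof -
  have "\<exists>k\<in>rng n (iv a b :: (nat \<Rightarrow> 'k) set option). gaps_at z (iv a b) k \<noteq> 0"
    using assms iv_in_ncA_index[OF assms(2)] unfolding hcoords_ambient_iff by blast
  thus ?thesis by (simp add: bounds_iv[OF assms(2)])
qed

lemma restr_compat_iv:
  fixes z :: "(nat \<Rightarrow> 'k::field) set option \<times> nat \<Rightarrow> 'k alg_closure"
  assumes "restr_compat n z" "(a, b) \<in> idx n" "(a', b') \<in> idx n" "a' \<le> a" "b \<le> b'"
  shows "parallel {a..b} (gaps_at z (iv a b)) (gaps_at z (iv a' b'))"
proof -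
  have "rng n (iv a b :: (nat \<Rightarrow> 'k) set option) \<subseteq> rng n (iv a' b' :: (nat \<Rightarrow> 'k) set option) \<longrightarrow>
      parallel (rng n (iv a b :: (nat \<Rightarrow> 'k) set option)) (gaps_at z (iv a b)) (gaps_at z (iv a' b'))"
    using assms(1) iv_in_ncA_index assms(2,3) unfolding restr_compat_def by blast
  thus ?thesis using assms by (simp add: bounds_iv)
qed

section \<open>The closure of the torus\<close>

text \<open>The value at s = 0 of the curve with entries \<open>c i * s ^ (d i - m)\<close>,
  wherever \<open>m \<le> d i\<close>.\<close>

definition leading_part :: "(nat \<Rightarrow> 'a::field) \<Rightarrow> (nat \<Rightarrow> nat) \<Rightarrow> nat \<Rightarrow> nat \<Rightarrow> 'a" where
  "leading_part c d m = (\<lambda>i. if d i = m then c i else 0)"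

text \<open>Here \<open>m\<close> is the minimum of \<open>d\<close> on \<open>I\<close>. Dividing
  the curve \<open>c i * s ^ d i\<close> by the power m of s leaves a limit at s = 0 that is nonzero
  for nonzero \<open>c\<close>, and \<open>\<phi>\<close> represents the same projective point when
  it is nonzero on \<open>I\<close> as well.\<close>

definition has_limit :: "nat set \<Rightarrow> (nat \<Rightarrow> 'a::field) \<Rightarrow> (nat \<Rightarrow> nat) \<Rightarrow> (nat \<Rightarrow> 'a) \<Rightarrow> bool" where
  "has_limit I c d \<phi> \<longleftrightarrow> (\<exists>m. (\<forall>i\<in>I. m \<le> d i) \<and> (\<exists>i\<in>I. d i = m) \<and> parallel I \<phi> (leading_part c d m))"

lemma has_limitE:
  assumes "has_limit I c d \<phi>"
  obtains m p where "\<And>i. i \<in> I \<Longrightarrow> m \<le> d i" "p \<in> I" "d p = m"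
    "\<And>i j. i \<in> I \<Longrightarrow> j \<in> I \<Longrightarrow>
      \<phi> i * leading_part c d m j = \<phi> j * leading_part c d m i"
  using assms unfolding has_limit_def parallel_def by blast

lemma has_limitI:
  assumes "\<And>i. i \<in> I \<Longrightarrow> m \<le> d i" "p \<in> I" "d p = m"
    "\<And>i j. i \<in> I \<Longrightarrow> j \<in> I \<Longrightarrow>
      \<phi> i * leading_part c d m j = \<phi> j * leading_part c d m i"
  shows "has_limit I c d \<phi>"
  using assms unfolding has_limit_def parallel_def by blast

lemma has_limit_cong:
  assumes "has_limit I c d \<phi>" "\<And>i. i \<in> I \<Longrightarrow> c' i = c i" "\<And>i. i \<in> I \<Longrightarrow> d' i = d i"
  shows "has_limit I c' d' \<phi>"
proof -
  obtain m p where m: "\<And>i. i \<in> I \<Longrightarrow> m \<le> d i" "p \<in> I" "d p = m"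
    "\<And>i j. i \<in> I \<Longrightarrow> j \<in> I \<Longrightarrow>
      \<phi> i * leading_part c d m j = \<phi> j * leading_part c d m i"
    using has_limitE[OF assms(1)] by metis
  have "leading_part c' d' m i = leading_part c d m i" if "i \<in> I" for i
    using assms(2,3)[OF that] by (simp add: leading_part_def)
  thus ?thesis using m assms(3) by (intro has_limitI[of I m d' p]) simp_all
qed

lemma has_limit_scale:
  assumes "has_limit I c d \<phi>"
  shows "has_limit I (\<lambda>i. e * c i) d \<phi>"
proof -
  obtain m p where m: "\<And>i. i \<in> I \<Longrightarrow> m \<le> d i" "p \<in> I" "d p = m"
    "\<And>i j. i \<in> I \<Longrightarrow> j \<in> I \<Longrightarrow>
      \<phi> i * leading_part c d m j = \<phi> j * leading_part c d m i"
    using has_limitE[OF assms(1)] by metis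
  have "leading_part (\<lambda>i. e * c i) d m i = e * leading_part c d m i" for i
    by (simp add: leading_part_def)
  thus ?thesis using m by (intro has_limitI[of I m d p]) (simp_all add: mult.left_commute)
qed

text \<open>Multiplying the whole curve by s changes no projective limit. This is the freedom used
  when the vector of a subinterval must become 0 in the limit on an enclosing interval.\<close>

lemma has_limit_shift:
  assumes "has_limit I c d \<phi>"
  shows "has_limit I c (\<lambda>i. Suc (d i)) \<phi>"
proof -
  obtain m p where m: "\<And>i. i \<in> I \<Longrightarrow> m \<le> d i" "p \<in> I" "d p = m"
    "\<And>i j. i \<in> I \<Longrightarrow> j \<in> I \<Longrightarrow>
      \<phi> i * leading_part c d m j = \<phi> j * leading_part c d m i"
    using has_limitE[OF assms(1)] by metis
  have "leading_part c (\<lambda>i. Suc (d i)) (Suc m) = leading_part c d m"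
    by (simp add: leading_part_def)
  thus ?thesis using m by (intro has_limitI[of I "Suc m" _ p]) simp_all
qed

text \<open>
  The exponents \<open>d\<close> record how fast the coordinates of a curve tend to \<open>0\<close>: a coordinate in the
  support of \<open>\<phi> A B\<close> has exponent \<open>0\<close>, and splitting the interval at such a coordinate
  reduces to shorter intervals. The vector \<open>\<psi>\<close>, possibly \<open>0\<close>, is what the curve on a
  subinterval has to match in the limit on the enclosing one.
\<close>

lemma limit_exponents:
  fixes \<phi> :: "nat \<Rightarrow> nat \<Rightarrow> nat \<Rightarrow> 'a::field"
  assumes "1 \<le> A"
    and "\<And>a b. A \<le> a \<Longrightarrow> a \<le> b \<Longrightarrow> b \<le> B \<Longrightarrow> \<exists>i\<in>{a..b}. \<phi> a b i \<noteq> 0"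
    and "\<And>a b a' b'. A \<le> a' \<Longrightarrow> a' \<le> a \<Longrightarrow> a \<le> b \<Longrightarrow> b \<le> b' \<Longrightarrow> b' \<le> B \<Longrightarrow>
      parallel {a..b} (\<phi> a b) (\<phi> a' b')"
    and "A \<le> B \<Longrightarrow> parallel {A..B} (\<phi> A B) \<psi>"
  shows "\<exists>c d. (\<forall>i\<in>{A..B}. c i \<noteq> 0 \<and> \<psi> i = leading_part c d 0 i) \<and>
    (\<forall>a b. A \<le> a \<longrightarrow> a \<le> b \<longrightarrow> b \<le> B \<longrightarrow> has_limit {a..b} c d (\<phi> a b))"
  using assms
proof (induction "Suc B - A" arbitrary: A B \<psi> rule: less_induct)
  case less
  note A1 = less.prems(1) and nz = less.prems(2) and par = less.prems(3) and psi = less.prems(4)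
  show ?case
  proof (cases "A \<le> B")
    case False
    thus ?thesis by auto
  next
    case AB: True
    obtain p where p: "A \<le> p" "p \<le> B" "\<phi> A B p \<noteq> 0" using nz[of A B] AB by auto
    \<comment> \<open>On both sides of \<open>p\<close> the vector to be matched is the restriction
      of \<open>\<phi> A B\<close>, which may be 0 there. The assumption \<open>1 \<le> A\<close>
      gives \<open>p - 1 < p\<close>, so the left part really excludes \<open>p\<close>.\<close>
    have "\<exists>c d. (\<forall>i\<in>{A..p - 1}. c i \<noteq> 0 \<and> \<phi> A B i = leading_part c d 0 i) \<and>
      (\<forall>a b. A \<le> a \<longrightarrow> a \<le> b \<longrightarrow> b \<le> p - 1 \<longrightarrow> has_limit {a..b} c d (\<phi> a b))"
      using p A1 AB by (intro less.hyps nz par) auto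
    then obtain c1 d1 where 1: "\<And>i. i \<in> {A..p - 1} \<Longrightarrow> c1 i \<noteq> 0 \<and> \<phi> A B i = leading_part c1 d1 0 i"
      and left: "\<And>a b. A \<le> a \<Longrightarrow> a \<le> b \<Longrightarrow> b \<le> p - 1 \<Longrightarrow> has_limit {a..b} c1 d1 (\<phi> a b)"
      by blast
    have "\<exists>c d. (\<forall>i\<in>{Suc p..B}. c i \<noteq> 0 \<and> \<phi> A B i = leading_part c d 0 i) \<and>
      (\<forall>a b. Suc p \<le> a \<longrightarrow> a \<le> b \<longrightarrow> b \<le> B \<longrightarrow> has_limit {a..b} c d (\<phi> a b))"
      using p A1 AB by (intro less.hyps nz par) auto
    then obtain c2 d2 where 2: "\<And>i. i \<in> {Suc p..B} \<Longrightarrow> c2 i \<noteq> 0 \<and> \<phi> A B i = leading_part c2 d2 0 i"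
      and right: "\<And>a b. Suc p \<le> a \<Longrightarrow> a \<le> b \<Longrightarrow> b \<le> B \<Longrightarrow> has_limit {a..b} c2 d2 (\<phi> a b)"
      by blast
    define c where "c i = (if i < p then c1 i else if i = p then \<phi> A B p else c2 i)" for i
    define d where "d i = (if i < p then d1 i else if i = p then 0 else d2 i)" for i
    have c: "c i \<noteq> 0 \<and> \<phi> A B i = leading_part c d 0 i" if "i \<in> {A..B}" for i
      using that 1[of i] 2[of i] p by (auto simp: c_def d_def leading_part_def split: if_splits)
    have lim: "has_limit {a..b} c d (\<phi> a b)" if ab: "A \<le> a" "a \<le> b" "b \<le> B" for a b
    proof -
      consider "b < p" | "p < a" | "a \<le> p" "p \<le> b" by linarith
      thus ?thesis
      proof cases
        case 1
        have "has_limit {a..b} c1 d1 (\<phi> a b)" using 1 ab by (intro left) auto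
        thus ?thesis by (rule has_limit_cong) (use 1 in \<open>auto simp: c_def d_def\<close>)
      next
        case 2
        have "has_limit {a..b} c2 d2 (\<phi> a b)" using 2 ab by (intro right) auto
        thus ?thesis by (rule has_limit_cong) (use 2 in \<open>auto simp: c_def d_def\<close>)
      next
        \<comment> \<open>The interval contains \<open>p\<close>, where the exponent is 0, so the
          minimum is 0 and the leading part is the restriction of \<open>\<phi> A B\<close>, which
          is nonzero at \<open>p\<close>.\<close>
        case 3
        have "parallel {a..b} (\<phi> a b) (\<phi> A B)" using ab by (intro par) auto
        thus ?thesis
          using 3 ab c by (intro has_limitI[of _ 0 _ p]) (simp_all add: parallel_def d_def)
      qed
    qed
    have "parallel {A..B} \<psi> (\<phi> A B)" using parallel_sym[OF psi[OF AB]] .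
    then obtain e where e: "\<And>i. i \<in> {A..B} \<Longrightarrow> \<psi> i = e * \<phi> A B i"
      using parallel_iff_scale[where p = p and I = "{A..B}" and t = \<psi> and t' = "\<phi> A B"] p
      by (metis atLeastAtMost_iff)
    show ?thesis
    \<comment> \<open>It remains to match \<open>\<psi> = e * \<phi> A B\<close>. For
      \<open>e = 0\<close> all exponents are raised by one, so nothing is left at exponent 0;
      otherwise all coefficients are multiplied by \<open>e\<close>.\<close>
    proof (cases "e = 0")
      case True
      have "\<forall>i\<in>{A..B}. c i \<noteq> 0 \<and> \<psi> i = leading_part c (\<lambda>i. Suc (d i)) 0 i"
        using c e True by (simp add: leading_part_def)
      thus ?thesis using lim has_limit_shift by blast
    next
      case False
      have "\<forall>i\<in>{A..B}. e * c i \<noteq> 0 \<and> \<psi> i = leading_part (\<lambda>i. e * c i) d 0 i"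
        using c e False by (simp add: leading_part_def)
      thus ?thesis using lim has_limit_scale
        by (intro exI[of _ "\<lambda>i. e * c i"] exI[of _ d]) blast
    qed
  qed
qed

section \<open>Degeneration along a polynomial curve\<close>

lemma polys_along_curve:
  fixes p :: "('i \<Rightarrow> 'k::field alg_closure) \<Rightarrow> 'k alg_closure"
  assumes "p \<in> polys" "\<And>i. \<exists>P. \<forall>s. x s i = poly P s"
  shows "\<exists>P. \<forall>s. p (x s) = poly P s"
  using assms(1)
proof induction
  case (const c)
  show ?case by (intro exI[of _ "[:to_ac c:]"]) simp
next
  case (add p q)
  thus ?case by (metis poly_add)
next
  case (mult p q)
  thus ?case by (metis poly_mult)
qed (rule assms(2))

lemma of_gaps_monom_poly:
  "\<exists>P. \<forall>s. of_gaps n (\<lambda>i. c i * s ^ e i) r = poly P s"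
proof (cases "r \<in> {1..n}")
  case True
  show ?thesis
    by (intro exI[of _ "\<Sum>k=r..<n. monom (c k) (e k)"])
      (use True in \<open>simp add: of_gaps_def poly_sum poly_monom\<close>)
qed (intro exI[of _ 0], auto simp: of_gaps_def)

text \<open>This replaces the Zariski closure by explicit equations; the comparison with the brick
  manifold works with these alone.\<close>

lemma hcoords_wonderful_model:
  assumes n: "n \<ge> 2"
  shows "hcoords (wonderful_model n (diag n) (ncA_min n :: (nat \<Rightarrow> 'k::field) set set)) =
    {z \<in> hcoords (ncA_ambient n). restr_compat n z}"
proof -
  let ?A = "ncA_ambient n :: (_, 'k, _) variety"
  let ?\<G> = "ncA_min n :: (nat \<Rightarrow> 'k) set set"
  let ?J = "ncA_index n :: (nat \<Rightarrow> 'k) set option set"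
  let ?I = "natural_map n ?\<G> ` proj_complement n (diag n) ?\<G>"
  let ?Z = "point_of ?A ` {z \<in> hcoords ?A. restr_compat n z}"
  have img: "?I = {point_of ?A (spread n x) | x. x \<in> vecs n \<and> (\<forall>i\<in>{1..n - 1}. gaps x i \<noteq> 0)}"
  proof (intro equalityI subsetI)
    fix q assume "q \<in> ?I"
    then obtain l where l: "l \<in> proj_complement n (diag n) ?\<G>" "q = natural_map n ?\<G> l" by blast
    then obtain x where "x \<in> vecs n" "\<forall>i\<in>{1..n - 1}. gaps x i \<noteq> 0"
      "l = line_of (flat n 1 (n - 1)) x"
      unfolding proj_complement_iff[OF n] by blast
    thus "q \<in> {point_of ?A (spread n x) | x. x \<in> vecs n \<and> (\<forall>i\<in>{1..n - 1}. gaps x i \<noteq> 0)}"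
      using l(2) natural_map_line_of by blast
  next
    fix q assume "q \<in> {point_of ?A (spread n x) | x. x \<in> vecs n \<and> (\<forall>i\<in>{1..n - 1}. gaps x i \<noteq> 0)}"
    then obtain x where x: "q = point_of ?A (spread n x)" "x \<in> vecs n"
      "\<forall>i\<in>{1..n - 1}. gaps x i \<noteq> 0" by blast
    hence "line_of (flat n 1 (n - 1)) x \<in> proj_complement n (diag n) ?\<G>"
      unfolding proj_complement_iff[OF n] by blast
    thus "q \<in> ?I" using x(1) natural_map_line_of by (metis imageI)
  qed
  have "?I \<subseteq> ?Z"
    unfolding img using spread_in_hcoords[OF n] restr_compat_spread by blast
  hence "zariski_closure ?A ?I \<subseteq> ?Z"
    unfolding zariski_closure_def using zariski_closed_compat by blast
  moreover have "?Z \<subseteq> C" if C: "zariski_closed ?A C" "?I \<subseteq> C" for C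
  proof
    fix q assume "q \<in> ?Z"
    then obtain z where z: "z \<in> hcoords ?A" "restr_compat n z" "q = point_of ?A z" by blast
    define \<phi> where "\<phi> a b = gaps_at z (iv a b)" for a b
    \<comment> \<open>There is no enclosing interval at the top, so \<open>\<phi> 1 (n - 1)\<close>
      itself is taken as the vector to match.\<close>
    have "\<exists>c d. (\<forall>i\<in>{1..n - 1}. c i \<noteq> 0 \<and> \<phi> 1 (n - 1) i = leading_part c d 0 i) \<and>
      (\<forall>a b. 1 \<le> a \<longrightarrow> a \<le> b \<longrightarrow> b \<le> n - 1 \<longrightarrow> has_limit {a..b} c d (\<phi> a b))"
    proof (rule limit_exponents)
      show "\<exists>i\<in>{a..b}. \<phi> a b i \<noteq> 0" if "1 \<le> a" "a \<le> b" "b \<le> n - 1" for a b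
      proof -
        have i: "(a, b) \<in> idx n" using that by (auto simp: idx_def)
        show ?thesis unfolding \<phi>_def by (rule gaps_at_iv_nonzero[OF z(1) i])
      qed
      show "parallel {a..b} (\<phi> a b) (\<phi> a' b')"
        if "1 \<le> a'" "a' \<le> a" "a \<le> b" "b \<le> b'" "b' \<le> n - 1" for a b a' b'
      proof -
        have i: "(a, b) \<in> idx n" "(a', b') \<in> idx n" using that by (auto simp: idx_def)
        show ?thesis unfolding \<phi>_def by (rule restr_compat_iv[OF z(2) i]) (use that in auto)
      qed
    qed (auto simp: parallel_def)
    then obtain c d where c: "\<forall>i\<in>{1..n - 1}. c i \<noteq> 0 \<and> \<phi> 1 (n - 1) i = leading_part c d 0 i"
      and lim: "\<forall>a b. 1 \<le> a \<longrightarrow> a \<le> b \<longrightarrow> b \<le> n - 1 \<longrightarrow> has_limit {a..b} c d (\<phi> a b)"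
      by blast
    have c: "c i \<noteq> 0" if "i \<in> {1..n - 1}" for i using c that by blast
    have lim: "has_limit {a..b} c d (\<phi> a b)" if "(a, b) \<in> idx n" for a b
      using that by (intro lim[rule_format]) (auto simp: idx_def)
    have "\<exists>m. (\<forall>i\<in>rng n j. m \<le> d i) \<and> (\<exists>i\<in>rng n j. d i = m) \<and>
        parallel (rng n j) (gaps_at z j) (leading_part c d m)" if j: "j \<in> ?J" for j
    proof -
      \<comment> \<open>The limits are known for indices of the form \<open>iv a b\<close>. The
        index \<open>None\<close> is reached through the interval index with the same bounds, to
        which compatibility makes it proportional.\<close>
      define j' where "j' = (iv (fst (bounds n j)) (snd (bounds n j)) :: (nat \<Rightarrow> 'k) set option)"
      have b: "(fst (bounds n j), snd (bounds n j)) \<in> idx n" using bounds_in_idx[OF j n] by simp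
      have r: "rng n j' = rng n j" by (simp add: j'_def bounds_iv[OF b])
      obtain m where m: "\<forall>i\<in>rng n j. m \<le> d i" "\<exists>i\<in>rng n j. d i = m"
        "parallel (rng n j) (gaps_at z j') (leading_part c d m)"
        using lim[OF b] unfolding has_limit_def \<phi>_def j'_def by blast
      have J': "j' \<in> ?J" unfolding j'_def by (rule iv_in_ncA_index[OF b])
      obtain p where p: "p \<in> rng n j" "gaps_at z j' p \<noteq> 0"
        using z(1) J' r unfolding hcoords_ambient_iff by metis
      have "parallel (rng n j) (gaps_at z j) (gaps_at z j')"
        using z(2) j J' r unfolding restr_compat_def by blast
      from parallel_trans[OF this m(3) p] show ?thesis using m by blast
    qed
    then obtain m where m: "\<And>j i. j \<in> ?J \<Longrightarrow> i \<in> rng n j \<Longrightarrow> m j \<le> d i"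
      "\<And>j. j \<in> ?J \<Longrightarrow> \<exists>i\<in>rng n j. d i = m j"
      "\<And>j. j \<in> ?J \<Longrightarrow> parallel (rng n j) (gaps_at z j) (leading_part c d (m j))"
      by metis
    \<comment> \<open>Each factor is divided by its own power \<open>m j\<close> of s, so that the
      coordinates remain admissible at s = 0. Outside \<open>rng n j\<close> the subtraction may
      truncate, but those gaps are invisible in the factor \<open>j\<close>.\<close>
    define zs where "zs s = (\<lambda>(j, r). if j \<in> ?J then of_gaps n (\<lambda>i. c i * s ^ (d i - m j)) r else 0)"
      for s
    have comp: "comp_at (zs s) j = (if j \<in> ?J then of_gaps n (\<lambda>i. c i * s ^ (d i - m j)) else 0)"
      for s j by (auto simp: zs_def comp_at_def)
    have rng: "1 \<le> i \<and> i < n" if "j \<in> ?J" "i \<in> rng n j" for i j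
      using bounds_in_idx[OF that(1) n] that(2) by (cases "bounds n j") (auto simp: idx_def)
    have gs: "gaps_at (zs s) j i = c i * s ^ (d i - m j)" if "j \<in> ?J" "i \<in> rng n j" for s i j
      using rng[OF that] that by (simp add: comp gaps_of_gaps)
    have c': "c i \<noteq> 0" if "j \<in> ?J" "i \<in> rng n j" for i j
      using rng[OF that] by (intro c) auto
    have hc: "zs s \<in> hcoords ?A" for s
      unfolding hcoords_ambient_iff
    proof (intro conjI ballI allI impI)
      fix j assume j: "j \<in> ?J"
      show "comp_at (zs s) j \<in> vecs n" using j by (simp add: comp of_gaps_in_vecs)
      obtain i where "i \<in> rng n j" "d i = m j" using m(2)[OF j] by blast
      thus "\<exists>i\<in>rng n j. gaps_at (zs s) j i \<noteq> 0" using gs[OF j] c'[OF j] by (intro bexI[of _ i]) auto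
    qed (simp add: comp)
    have "gaps_at (zs 0) j i = leading_part c d (m j) i" if "j \<in> ?J" "i \<in> rng n j" for j i
      using m(1)[OF that] gs[OF that] by (auto simp: leading_part_def power_0_left)
    hence "parallel (rng n j) (gaps_at z j) (gaps_at (zs 0) j)" if "j \<in> ?J" for j
      using m(3)[OF that] that by (auto simp: parallel_def)
    hence at0: "point_of ?A (zs 0) = q"
      using point_of_ambient_eq_iff[OF z(1) hc[of 0]] z(3) by simp
    have generic: "point_of ?A (zs s) \<in> ?I" if s: "s \<noteq> 0" for s
    proof -
      \<comment> \<open>For nonzero s the powers removed from the factors are scalars, so all
        components come from this single vector, whose gaps are nonzero.\<close>
      define x where "x = of_gaps n (\<lambda>i. c i * s ^ d i)"
      have x: "x \<in> vecs n" "\<And>i. i \<in> {1..n - 1} \<Longrightarrow> gaps x i = c i * s ^ d i"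
        unfolding x_def using n by (auto intro!: of_gaps_in_vecs gaps_of_gaps)
      have x0: "gaps x i \<noteq> 0" if "i \<in> {1..n - 1}" for i using c[OF that] x(2)[OF that] s by simp
      have "parallel (rng n j) (gaps_at (zs s) j) (gaps_at (spread n x) j)" if j: "j \<in> ?J" for j
        unfolding parallel_def
      proof (intro ballI)
        fix i k assume ik: "i \<in> rng n j" "k \<in> rng n j"
        have e: "gaps_at (spread n x) j i = s ^ m j * gaps_at (zs s) j i" if "i \<in> rng n j" for i
        proof -
          have "s ^ d i = s ^ m j * s ^ (d i - m j)"
            using m(1)[OF j that] by (simp flip: power_add)
          moreover have "i \<in> {1..n - 1}" using rng[OF j that] by auto
          ultimately show ?thesis using j x(2)[of i] gs[OF j that] by (simp add: comp_at_spread)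
        qed
        show "gaps_at (zs s) j i * gaps_at (spread n x) j k = gaps_at (zs s) j k * gaps_at (spread n x) j i"
          using e[OF ik(1)] e[OF ik(2)] by simp
      qed
      hence "point_of ?A (zs s) = point_of ?A (spread n x)"
        using point_of_ambient_eq_iff[OF hc spread_in_hcoords[OF n x(1) x0]] by blast
      thus ?thesis unfolding img using x(1) x0 by blast
    qed
    have pol: "\<exists>P. \<forall>s. zs s k = poly P s" for k
    proof (cases k)
      case (Pair j r)
      thus ?thesis
        using of_gaps_monom_poly[of n c "\<lambda>i. d i - m j" r]
        by (cases "j \<in> ?J") (auto simp: zs_def intro: exI[of _ 0])
    qed
    obtain F where F: "F \<subseteq> polys" "\<And>x. x \<in> hcoords ?A \<Longrightarrow> point_of ?A x \<in> C \<longleftrightarrow> (\<forall>f\<in>F. f x = 0)"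
      using C(1) unfolding zariski_closed_def by blast
    \<comment> \<open>Along the curve an equation of \<open>C\<close> is a one-variable polynomial
      with infinitely many roots, namely all nonzero s.\<close>
    have "f (zs 0) = 0" if f: "f \<in> F" for f
    proof -
      obtain P where P: "\<And>s. f (zs s) = poly P s"
        using polys_along_curve[of f zs, OF _ pol] f F(1) by blast
      have "poly P s = 0" if "s \<noteq> 0" for s
        using F(2)[OF hc, of s] generic[OF that] C(2) f P by auto
      hence "UNIV - {0} \<subseteq> {s. poly P s = 0}" by auto
      moreover have "infinite (UNIV - {0 :: 'k alg_closure})"
        using infinite_alg_closed by (simp add: infinite_remove)
      ultimately have "P = 0" using poly_roots_finite finite_subset by blast
      thus ?thesis by (simp add: P)
    qed
    thus "q \<in> C" using F(2)[OF hc, of 0] at0 by simp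
  qed
  ultimately have "zariski_closure ?A ?I = ?Z"
    unfolding zariski_closure_def by blast
  moreover have "point_of ?A z \<in> ?Z \<longleftrightarrow> restr_compat n z" if "z \<in> hcoords ?A" for z
    using restr_compat_cong[OF that] that by blast
  ultimately show ?thesis
    by (auto simp: wonderful_model_def subvariety_def)
qed

section \<open>The brick manifold\<close>

lemma brick_span_eq: "brick_span a b = {v. \<forall>i. i \<notin> {a..<b} \<longrightarrow> v i = 0}"
  unfolding brick_span_def
proof (intro equalityI vs.span_minimal subsetI)
  fix v :: "nat \<Rightarrow> 'a" assume v: "v \<in> {v. \<forall>i. i \<notin> {a..<b} \<longrightarrow> v i = 0}"
  have "v = (\<Sum>i\<in>{a..<b}. scl (v i) (std i))"
  proof
    fix r
    have "(\<Sum>i\<in>{a..<b}. scl (v i) (std i)) r = (\<Sum>i\<in>{a..<b}. if i = r then v r else 0)"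
      unfolding sum_fun_apply by (intro sum.cong) (auto simp: scl_def std_def)
    also have "\<dots> = v r" using v by auto
    finally show "v r = (\<Sum>i\<in>{a..<b}. scl (v i) (std i)) r" by simp
  qed
  also have "\<dots> \<in> vs.span (std ` {a..<b})"
    by (intro vs.span_sum vs.span_scale vs.span_base imageI)
  finally show "v \<in> vs.span (std ` {a..<b})" .
qed (auto simp: vs.subspace_def scl_def std_def)

lemma hyperplane_subset_brick_span: "hyperplane a b t \<subseteq> brick_span a (Suc b)"
  by (auto simp: hyperplane_def brick_span_eq)

lemma hyperplane_cong:
  assumes "\<And>i. i \<in> {a..b} \<Longrightarrow> t i = t' i"
  shows "hyperplane a b t = hyperplane a b t'"
proof -
  have "(\<Sum>i=a..b. t i * v i) = (\<Sum>i=a..b. t' i * v i)" for v :: "nat \<Rightarrow> 'a"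
    using assms by (intro sum.cong) auto
  thus ?thesis by (simp add: hyperplane_def)
qed

lemma std_frame:
  "inj_on (\<lambda>c. std (a + c) :: nat \<Rightarrow> 'a::field) {..<d}"
  "\<not> vs.dependent ((\<lambda>c. std (a + c) :: nat \<Rightarrow> 'a) ` {..<d})"
  "vs.span ((\<lambda>c. std (a + c) :: nat \<Rightarrow> 'a) ` {..<d}) = brick_span a (a + d)"
proof -
  have "inj_on (\<lambda>c. std (a + c) :: nat \<Rightarrow> 'a) {..<d} \<and>
    \<not> vs.dependent ((\<lambda>c. std (a + c) :: nat \<Rightarrow> 'a) ` {..<d})"
  proof (subst frame_iff; (intro allI impI ballI)?)
    fix u :: "nat \<Rightarrow> 'a" and c
    assume u: "(\<Sum>c<d. scl (u c) (std (a + c))) = 0" and c: "c \<in> {..<d}"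
    have "(\<Sum>e<d. scl (u e) (std (a + e))) (a + c) = (\<Sum>e<d. if e = c then u c else 0)"
      unfolding sum_fun_apply by (intro sum.cong) (auto simp: scl_def std_def)
    also have "\<dots> = u c" using c by (subst sum.delta) auto
    finally show "u c = 0" using u by simp
  qed simp
  thus "inj_on (\<lambda>c. std (a + c) :: nat \<Rightarrow> 'a) {..<d}"
    "\<not> vs.dependent ((\<lambda>c. std (a + c) :: nat \<Rightarrow> 'a) ` {..<d})" by auto
  have "(\<lambda>c. a + c) ` {..<d} = {a..<a + d}"
    using image_add_atLeastLessThan[of a 0 d] by (simp add: lessThan_atLeast0 add.commute)
  hence "(\<lambda>c. std (a + c) :: nat \<Rightarrow> 'a) ` {..<d} = std ` {a..<a + d}"
    by (metis image_image)
  thus "vs.span ((\<lambda>c. std (a + c) :: nat \<Rightarrow> 'a) ` {..<d}) = brick_span a (a + d)"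
    by (simp add: brick_span_def)
qed

section \<open>Coordinates and inclusions on the brick manifold\<close>

abbreviation brick_dim :: "nat \<times> nat \<Rightarrow> nat" where
  "brick_dim \<equiv> (\<lambda>(i, j). j - i + 1)"

abbreviation brick_vec :: "((nat \<times> nat) \<times> nat \<times> nat \<Rightarrow> 'a) \<Rightarrow> nat \<times> nat \<Rightarrow> nat \<Rightarrow> nat \<Rightarrow> 'a" where
  "brick_vec y q \<equiv> comp_at (comp_at y q)"

definition brick_point :: "nat \<Rightarrow> ((nat \<times> nat) \<times> nat \<times> nat \<Rightarrow> 'a::field) \<Rightarrow>
    nat \<times> nat \<Rightarrow> (nat \<Rightarrow> 'a) set" where
  "brick_point n y = (\<lambda>q\<in>proper_intervals n. vs.span (brick_vec y q ` {..<brick_dim q}))"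

lemma point_of_brick: "point_of (brick_manifold n) = brick_point n"
  by (simp add: brick_manifold_def subvariety_def grassmannian_prod_def brick_point_def fun_eq_iff)

lemma hcoords_brick_iff:
  "y \<in> hcoords (brick_manifold n) \<longleftrightarrow>
    (\<forall>q c. if q \<in> proper_intervals n \<and> c < brick_dim q then brick_vec y q c \<in> vecs (n - 1)
       else brick_vec y q c = 0) \<and>
    (\<forall>q\<in>proper_intervals n. inj_on (brick_vec y q) {..<brick_dim q} \<and>
       \<not> vs.dependent (brick_vec y q ` {..<brick_dim q})) \<and>
    brick_point n y \<in> brick_points n"
proof -
  have "point_of (grassmannian_prod (n - 1) (proper_intervals n) brick_dim) y = brick_point n y"
    by (simp add: grassmannian_prod_def brick_point_def)
  thus ?thesis
    unfolding brick_manifold_def subvariety_def by (auto simp: grassmannian_prod_def)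
qed

text \<open>The left end is moved first, then the right end. Every intermediate interval lies in the
  proper interval from \<open>i'\<close> to \<open>j'\<close>, hence is proper itself, so each
  single step is available.\<close>

lemma brick_mono:
  assumes V: "V \<in> brick_points n" and q: "(i', j') \<in> proper_intervals n"
    and le: "i' \<le> i" "i \<le> j" "j \<le> j'"
  shows "V (i, j) \<subseteq> V (i', j')"
proof -
  have step: "(i - 1, j) \<in> proper_intervals n \<longrightarrow> V (i, j) \<subseteq> V (i - 1, j)"
    "(i, j + 1) \<in> proper_intervals n \<longrightarrow> V (i, j) \<subseteq> V (i, j + 1)"
    if "(i, j) \<in> proper_intervals n" for i j
    using V that unfolding brick_points_def by blast+
  have P: "(i, j) \<in> proper_intervals n" if "i' \<le> i" "i \<le> j" "j \<le> j'" for i j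
    using q that by (auto simp: proper_intervals_def)
  have "V (i, j) \<subseteq> V (i', j)"
    using le(1,2)
  proof (induction i rule: dec_induct)
    case (step k)
    have "V (Suc k, j) \<subseteq> V (k, j)"
      using \<open>\<And>i j. (i, j) \<in> proper_intervals n \<Longrightarrow> (i - 1, j) \<in> _ \<longrightarrow> _\<close>[of "Suc k" j]
        P[of "Suc k" j] P[of k j] step le by auto
    thus ?case using step by auto
  qed simp
  also have "V (i', j) \<subseteq> V (i', j')"
    using le(3)
  proof (induction rule: inc_induct)
    case (step k)
    have "V (i', k) \<subseteq> V (i', Suc k)"
      using \<open>\<And>i j. (i, j) \<in> proper_intervals n \<Longrightarrow> (i, j + 1) \<in> _ \<longrightarrow> _\<close>[of i' k]
        P[of i' "Suc k"] P[of i' k] step le by auto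
    thus ?case using step by auto
  qed simp
  finally show ?thesis .
qed

lemma brick_points_left:
  "V \<in> brick_points n \<Longrightarrow> (1, j) \<in> proper_intervals n \<Longrightarrow> V (1, j) = brick_span 1 (j + 1)"
  unfolding brick_points_def by blast

lemma brick_points_right:
  "V \<in> brick_points n \<Longrightarrow> (i, n) \<in> proper_intervals n \<Longrightarrow> V (i, n) = brick_span (i - 1) n"
  unfolding brick_points_def by blast

lemma brick_subset_brick_span:
  assumes V: "V \<in> brick_points n" and ab: "(a, b) \<in> idx n" "a < b"
  shows "V (Suc a, b) \<subseteq> brick_span a (Suc b)"
proof -
  have q: "(1, b) \<in> proper_intervals n" "(Suc a, n) \<in> proper_intervals n"
    using ab by (auto simp: idx_def proper_intervals_def)
  have "V (Suc a, b) \<subseteq> V (1, b)" using ab by (intro brick_mono[OF V q(1)]) (auto simp: idx_def)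
  moreover note brick_points_left[OF V q(1)]
  moreover have "V (Suc a, b) \<subseteq> V (Suc a, n)"
    using ab by (intro brick_mono[OF V q(2)]) (auto simp: idx_def)
  moreover note brick_points_right[OF V q(2)]
  ultimately show ?thesis by (auto simp: brick_span_eq subset_iff)
qed

text \<open>The first two kinds carry prescribed subspaces. The third carries the free data; there
  \<open>(Suc a, j)\<close> belongs to the gap interval \<open>{a..j}\<close>.\<close>

lemma proper_interval_cases:
  assumes "(i, j) \<in> proper_intervals n"
  obtains (left) "i = 1" "1 \<le> j" "j < n" | (right) "2 \<le> i" "i \<le> n" "j = n"
    | (middle) a where "i = Suc a" "(a, j) \<in> idx n" "a < j"
proof -
  have "i = 1 \<and> 1 \<le> j \<and> j < n \<or> 2 \<le> i \<and> i \<le> n \<and> j = n \<or> i = Suc (i - 1) \<and> (i - 1, j) \<in> idx n \<and> i - 1 < j"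
    using assms by (auto simp: proper_intervals_def idx_def)
  thus thesis using that by blast
qed

section \<open>The correspondence on homogeneous coordinates\<close>

lemma proper_interval_Suc: "(a, b) \<in> idx n \<Longrightarrow> a < b \<Longrightarrow> (Suc a, b) \<in> proper_intervals n"
  by (auto simp: idx_def proper_intervals_def)

text \<open>The graph of the isomorphism in coordinates. It contains all rescalings of the
  functionals and all changes of frame, so that locally chosen polynomial sections fit
  together.\<close>

definition brick_rel :: "nat \<Rightarrow> ((nat \<Rightarrow> 'k::field) set option \<times> nat \<Rightarrow> 'k alg_closure) \<Rightarrow>
    ((nat \<times> nat) \<times> nat \<times> nat \<Rightarrow> 'k alg_closure) \<Rightarrow> bool" where
  "brick_rel n z y \<longleftrightarrow> z \<in> hcoords (ncA_ambient n) \<and> restr_compat n z \<and>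
     y \<in> hcoords (brick_manifold n) \<and>
     (\<forall>a b. (a, b) \<in> idx n \<longrightarrow> a < b \<longrightarrow>
       brick_point n y (Suc a, b) = hyperplane a b (gaps_at z (iv a b)))"

text \<open>On the compatible locus the component at \<open>None\<close> is proportional to that of
  the full interval, so it imposes no further condition. The nonzero entries \<open>p\<close> and
  \<open>p'\<close> are what transitivity of \<open>parallel\<close> needs.\<close>

lemma point_of_ambient_eq_iff_iv:
  assumes n: "n \<ge> 2" and z: "z \<in> hcoords (ncA_ambient n)" "restr_compat n z"
    and z': "z' \<in> hcoords (ncA_ambient n)" "restr_compat n z'"
  shows "point_of (ncA_ambient n :: (_, 'k::field, _) variety) z = point_of (ncA_ambient n) z' \<longleftrightarrow>
    (\<forall>a b. (a, b) \<in> idx n \<longrightarrow> parallel {a..b} (gaps_at z (iv a b)) (gaps_at z' (iv a b)))"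
    (is "_ \<longleftrightarrow> ?R")
proof -
  have "(\<forall>j\<in>ncA_index n. parallel (rng n j) (gaps_at z j) (gaps_at z' j)) \<longleftrightarrow> ?R"
  proof (intro iffI allI impI ballI)
    fix a b assume par: "\<forall>j\<in>ncA_index n. parallel (rng n j) (gaps_at z j) (gaps_at z' j)"
      and ab: "(a, b) \<in> idx n"
    from bspec[OF par iv_in_ncA_index[OF ab]]
    show "parallel {a..b} (gaps_at z (iv a b)) (gaps_at z' (iv a b))"
      by (simp add: bounds_iv[OF ab])
  next
    fix j :: "(nat \<Rightarrow> 'k) set option" assume R: ?R and j: "j \<in> ncA_index n"
    obtain a b where jab: "bounds n j = (a, b)" by fastforce
    have ab: "(a, b) \<in> idx n" using bounds_in_idx[OF j n] by (simp add: jab)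
    let ?i = "iv a b :: (nat \<Rightarrow> 'k) set option"
    have c: "parallel {a..b} (gaps_at x j) (gaps_at x ?i)" if "restr_compat n x" for x
      using bspec[OF bspec[OF that[unfolded restr_compat_def] j] iv_in_ncA_index[OF ab]]
      by (simp add: bounds_iv[OF ab] jab)
    obtain p p' where p: "p \<in> {a..b}" "gaps_at z ?i p \<noteq> 0" and p': "p' \<in> {a..b}" "gaps_at z' ?i p' \<noteq> 0"
      using gaps_at_iv_nonzero[OF z(1) ab] gaps_at_iv_nonzero[OF z'(1) ab] by blast
    have "parallel {a..b} (gaps_at z j) (gaps_at z' ?i)"
      using parallel_trans[OF c[OF z(2)] _ p] R ab by blast
    thus "parallel (rng n j) (gaps_at z j) (gaps_at z' j)"
      using parallel_trans[OF _ parallel_sym[OF c[OF z'(2)]] p'] by (simp add: jab)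
  qed
  thus ?thesis using point_of_ambient_eq_iff[OF z(1) z'(1)] by simp
qed

text \<open>A nonzero functional and its kernel determine each other up to scaling. Intervals with
  \<open>a = b\<close> are automatic on the left, prescribed subspaces on the right.\<close>

lemma brick_rel_point_eq_iff:
  assumes n: "n \<ge> 2" and R: "brick_rel n z y" and R': "brick_rel n z' y'"
  shows "point_of (ncA_ambient n :: (_, 'k::field, _) variety) z = point_of (ncA_ambient n) z' \<longleftrightarrow>
    brick_point n y = brick_point n y'"
proof -
  have z: "z \<in> hcoords (ncA_ambient n)" "restr_compat n z"
    and z': "z' \<in> hcoords (ncA_ambient n)" "restr_compat n z'"
    and y: "brick_point n y \<in> brick_points n" and y': "brick_point n y' \<in> brick_points n"
    using R R' unfolding brick_rel_def hcoords_brick_iff by blast+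
  have hyp: "brick_point n y (Suc a, b) = brick_point n y' (Suc a, b) \<longleftrightarrow>
      parallel {a..b} (gaps_at z (iv a b)) (gaps_at z' (iv a b))"
    if "(a, b) \<in> idx n" "a < b" for a b
    using R R' that hyperplane_eq_iff[OF gaps_at_iv_nonzero[OF z(1) that(1)] gaps_at_iv_nonzero[OF z'(1) that(1)]]
    by (simp add: brick_rel_def)
  show ?thesis
    unfolding point_of_ambient_eq_iff_iv[OF n z z']
  proof
    assume par: "\<forall>a b. (a, b) \<in> idx n \<longrightarrow> parallel {a..b} (gaps_at z (iv a b)) (gaps_at z' (iv a b))"
    have "brick_point n y (i, j) = brick_point n y' (i, j)" for i j
    proof (cases "(i, j) \<in> proper_intervals n")
      case False
      thus ?thesis by (simp add: brick_point_def)
    next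
      case True
      thus ?thesis
      proof (cases rule: proper_interval_cases)
        case left
        thus ?thesis using brick_points_left[OF y] brick_points_left[OF y'] True by simp
      next
        case right
        thus ?thesis using brick_points_right[OF y] brick_points_right[OF y'] True by simp
      next
        case (middle a)
        thus ?thesis using hyp par by simp
      qed
    qed
    thus "brick_point n y = brick_point n y'" by (simp add: fun_eq_iff)
  next
    assume "brick_point n y = brick_point n y'"
    hence "parallel {a..b} (gaps_at z (iv a b)) (gaps_at z' (iv a b))" if "(a, b) \<in> idx n" for a b
      using that hyp[of a b] by (cases "a < b") (auto simp: parallel_def idx_def)
    thus "\<forall>a b. (a, b) \<in> idx n \<longrightarrow> parallel {a..b} (gaps_at z (iv a b)) (gaps_at z' (iv a b))" by blast
  qed
qed

lemma brick_span_mono: "c \<le> a \<Longrightarrow> b \<le> d \<Longrightarrow> brick_span a b \<subseteq> brick_span c d"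
  unfolding brick_span_def by (intro vs.span_mono image_mono) auto

lemma brick_span_subset_vecs:
  assumes "1 \<le> a" "b \<le> Suc m"
  shows "brick_span a b \<subseteq> (vecs m :: (nat \<Rightarrow> 'a::field) set)"
proof -
  have "brick_span 1 (Suc m) = (vecs m :: (nat \<Rightarrow> 'a) set)"
    by (simp add: brick_span_eq vecs_def atLeastLessThanSuc_atLeastAtMost)
  thus ?thesis using brick_span_mono[OF assms, where 'a = 'a] by simp
qed

text \<open>From functionals to frames. The pivots are fixed at \<open>z0\<close> and remain usable
  as long as the corresponding entries are nonzero; the pivot bases are then polynomial in the
  coordinates.\<close>

lemma brick_lift:
  fixes z0 :: "(nat \<Rightarrow> 'k::field) set option \<times> nat \<Rightarrow> 'k alg_closure"
  assumes n: "n \<ge> 2" and z0: "z0 \<in> hcoords (ncA_ambient n)"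
  shows "\<exists>P r. (\<forall>i. P i \<in> polys) \<and> r \<in> polys \<and> r z0 \<noteq> 0 \<and>
    (\<forall>z. z \<in> hcoords (ncA_ambient n) \<longrightarrow> restr_compat n z \<longrightarrow> r z \<noteq> 0 \<longrightarrow> brick_rel n z (\<lambda>i. P i z))"
proof -
  let ?t = "\<lambda>z a b. gaps_at z (iv a b :: (nat \<Rightarrow> 'k) set option)"
  have "\<exists>p k. p \<in> {a..b} \<and> ?t z0 a b p \<noteq> 0 \<and> bij_betw k {..<b - a} ({a..b} - {p})"
    if ab: "(a, b) \<in> idx n" for a b
  proof -
    obtain p where p: "p \<in> {a..b}" "?t z0 a b p \<noteq> 0" using gaps_at_iv_nonzero[OF z0 ab] by blast
    have "card ({a..b} - {p}) = b - a" using p(1) by auto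
    then obtain k where "bij_betw k {..<b - a} ({a..b} - {p})"
      using ex_bij_betw_nat_finite[of "{a..b} - {p}"] by (auto simp: lessThan_atLeast0)
    thus ?thesis using p by blast
  qed
  then obtain p k where p: "\<And>a b. (a, b) \<in> idx n \<Longrightarrow> p a b \<in> {a..b}"
    and tp: "\<And>a b. (a, b) \<in> idx n \<Longrightarrow> ?t z0 a b (p a b) \<noteq> 0"
    and k: "\<And>a b. (a, b) \<in> idx n \<Longrightarrow> bij_betw (k a b) {..<b - a} ({a..b} - {p a b})"
    by metis
  \<comment> \<open>The prescribed subspaces get constant frames of standard vectors, the others the
    pivot basis of the kernel.\<close>
  define vec where "vec z q c = (case q of (i, j) \<Rightarrow>
      if i = 1 then std (1 + c) else if j = n then std (i - 1 + c)
      else hyperplane_vec (p (i - 1) j) (k (i - 1) j c) (?t z (i - 1) j))"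
    for z :: "(nat \<Rightarrow> 'k) set option \<times> nat \<Rightarrow> 'k alg_closure" and q c
  define P where "P = (\<lambda>(q, c, s) z. if q \<in> proper_intervals n \<and> c < brick_dim q then vec z q c s else 0)"
  \<comment> \<open>One product over the finitely many intervals keeps all pivots nonzero at
    once.\<close>
  define r where "r z = (\<Prod>(a, b)\<in>idx n. ?t z a b (p a b))"
    for z :: "(nat \<Rightarrow> 'k) set option \<times> nat \<Rightarrow> 'k alg_closure"
  have std_polys: "(\<lambda>z :: (nat \<Rightarrow> 'k) set option \<times> nat \<Rightarrow> 'k alg_closure. std a b) \<in> polys" for a b
    by (simp add: std_def polys_0 polys_1)
  have hyperplane_polys: "(\<lambda>z. hyperplane_vec e f (?t z a b) s) \<in> polys" for e f a b s
    by (cases "s = e"; cases "s = f")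
      (simp_all add: hyperplane_vec_def polys_diff polys_uminus polys_0 gaps_at_polys)
  have vec_polys: "(\<lambda>z. vec z q c s) \<in> polys" for q c s
  proof -
    obtain i j where "q = (i, j)" by fastforce
    thus ?thesis
      using std_polys hyperplane_polys by (cases "i = 1"; cases "j = n") (simp_all add: vec_def)
  qed
  have P_polys: "P i \<in> polys" for i
  proof -
    obtain q c s where "i = (q, c, s)" by (metis prod.exhaust)
    thus ?thesis using vec_polys[of q c s] polys_0
      by (cases "q \<in> proper_intervals n \<and> c < brick_dim q") (auto simp: P_def)
  qed
  have r_polys: "r \<in> polys"
    unfolding r_def[abs_def] case_prod_beta by (intro polys_prod gaps_at_polys)
  have r0: "r z0 \<noteq> 0"
    unfolding r_def using tp finite_idx by auto
  have "brick_rel n z (\<lambda>i. P i z)"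
    if z: "z \<in> hcoords (ncA_ambient n)" and comp: "restr_compat n z" and rz: "r z \<noteq> 0" for z
  proof -
    let ?y = "\<lambda>i. P i z"
    have tz: "?t z a b (p a b) \<noteq> 0" if "(a, b) \<in> idx n" for a b
      using rz that finite_idx unfolding r_def by auto
    have vecs: "brick_vec ?y q c = (if q \<in> proper_intervals n \<and> c < brick_dim q then vec z q c else 0)"
      for q c by (auto simp: P_def comp_at_def fun_eq_iff)
    define V where "V q = (case q of (i, j) \<Rightarrow> if i = 1 then brick_span 1 (j + 1)
        else if j = n then brick_span (i - 1) n else hyperplane (i - 1) j (?t z (i - 1) j))" for q
    have frame: "inj_on (vec z q) {..<brick_dim q} \<and> \<not> vs.dependent (vec z q ` {..<brick_dim q}) \<and>
        vs.span (vec z q ` {..<brick_dim q}) = V q \<and> V q \<subseteq> vecs (n - 1)"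
      if q: "q \<in> proper_intervals n" for q
    proof -
      obtain i j where ij: "q = (i, j)" by fastforce
      show ?thesis
        using q unfolding ij
      proof (cases rule: proper_interval_cases)
        case left
        have "vec z (i, j) = (\<lambda>c. std (1 + c))" using left by (simp add: vec_def fun_eq_iff)
        moreover have "V (i, j) = brick_span 1 (1 + j)" using left by (simp add: V_def)
        moreover have "brick_dim (i, j) = j" using left by simp
        moreover have "brick_span 1 (1 + j) \<subseteq> (vecs (n - 1) :: (nat \<Rightarrow> 'k alg_closure) set)"
          using left by (intro brick_span_subset_vecs) auto
        ultimately show "inj_on (vec z (i, j)) {..<brick_dim (i, j)} \<and>
            \<not> vs.dependent (vec z (i, j) ` {..<brick_dim (i, j)}) \<and>
            vs.span (vec z (i, j) ` {..<brick_dim (i, j)}) = V (i, j) \<and> V (i, j) \<subseteq> vecs (n - 1)"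
          using std_frame[of 1 j, where 'a = "'k alg_closure"] by simp
      next
        case right
        have "vec z (i, j) = (\<lambda>c. std (i - 1 + c))" using right by (simp add: vec_def fun_eq_iff)
        moreover have "V (i, j) = brick_span (i - 1) (i - 1 + (j - i + 1))"
          using right by (simp add: V_def)
        moreover have "brick_span (i - 1) (i - 1 + (j - i + 1)) \<subseteq>
            (vecs (n - 1) :: (nat \<Rightarrow> 'k alg_closure) set)"
          using right by (intro brick_span_subset_vecs) auto
        ultimately show "inj_on (vec z (i, j)) {..<brick_dim (i, j)} \<and>
            \<not> vs.dependent (vec z (i, j) ` {..<brick_dim (i, j)}) \<and>
            vs.span (vec z (i, j) ` {..<brick_dim (i, j)}) = V (i, j) \<and> V (i, j) \<subseteq> vecs (n - 1)"
          using std_frame[of "i - 1" "j - i + 1", where 'a = "'k alg_closure"] by simp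
      next
        case (middle a)
        have a: "i \<noteq> 1" "j \<noteq> n" "i - 1 = a" "brick_dim (i, j) = j - a"
          using middle by (auto simp: idx_def)
        have "vec z (i, j) c = hyperplane_vec (p a j) (k a j c) (?t z a j)" for c
          using a by (simp add: vec_def)
        note B = hyperplane_basis[where p = "p a j" and t = "?t z a j" and w = "vec z (i, j)",
            OF p[OF middle(2)] tz[OF middle(2)] k[OF middle(2)] this]
        moreover have "V (i, j) = hyperplane a j (?t z a j)" using a by (simp add: V_def)
        moreover have "hyperplane a j (?t z a j) \<subseteq> vecs (n - 1)"
          using middle by (intro order.trans[OF hyperplane_subset_brick_span brick_span_subset_vecs])
            (auto simp: idx_def)
        ultimately show "inj_on (vec z (i, j)) {..<brick_dim (i, j)} \<and>
            \<not> vs.dependent (vec z (i, j) ` {..<brick_dim (i, j)}) \<and>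
            vs.span (vec z (i, j) ` {..<brick_dim (i, j)}) = V (i, j) \<and> V (i, j) \<subseteq> vecs (n - 1)"
          unfolding a(4) by simp
      qed
    qed
    have img: "brick_vec ?y q ` {..<brick_dim q} = vec z q ` {..<brick_dim q}"
      and inj: "inj_on (brick_vec ?y q) {..<brick_dim q} \<longleftrightarrow> inj_on (vec z q) {..<brick_dim q}"
      if "q \<in> proper_intervals n" for q
      using that by (auto simp: vecs intro!: image_cong inj_on_cong)
    have V: "brick_point n ?y q = V q" if "q \<in> proper_intervals n" for q
      using frame[OF that] by (simp only: brick_point_def restrict_apply' that img)
    have in_vecs: "vec z q c \<in> vecs (n - 1)" if "q \<in> proper_intervals n" "c < brick_dim q" for q c
      using frame[OF that(1)] vs.span_base[of "vec z q c" "vec z q ` {..<brick_dim q}"] that(2) by blast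
    have y1: "if q \<in> proper_intervals n \<and> c < brick_dim q then brick_vec ?y q c \<in> vecs (n - 1)
        else brick_vec ?y q c = 0" for q c
      unfolding vecs using in_vecs[of q c] by simp
    have y2: "inj_on (brick_vec ?y q) {..<brick_dim q} \<and>
        \<not> vs.dependent (brick_vec ?y q ` {..<brick_dim q})" if "q \<in> proper_intervals n" for q
      using frame[OF that] unfolding img[OF that] inj[OF that] by blast
    have gr: "?y \<in> hcoords (grassmannian_prod (n - 1) (proper_intervals n) brick_dim)"
      unfolding grassmannian_prod_def variety.simps mem_Collect_eq using y1 y2 by blast
    have "brick_point n ?y = point_of (grassmannian_prod (n - 1) (proper_intervals n) brick_dim) ?y"
      by (simp add: brick_point_def grassmannian_prod_def)
    hence "brick_point n ?y \<in>
        points (grassmannian_prod (n - 1) (proper_intervals n) brick_dim :: (_, 'k, _) variety)"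
      unfolding points_def by (rule image_eqI[OF _ gr])
    hence PiE: "brick_point n ?y \<in> (\<Pi>\<^sub>E q\<in>proper_intervals n. grassmannian (brick_dim q) (n - 1))"
      by (simp only: points_grassmannian_prod)
    \<comment> \<open>The kind of the larger interval decides: a kernel lies in the full coordinate
      span, two prescribed spans are nested, and inclusion of two kernels is compatibility of the
      functionals.\<close>
    have sub1: "V (i, j) \<subseteq> V (i - 1, j)"
      if q: "(i, j) \<in> proper_intervals n" and q': "(i - 1, j) \<in> proper_intervals n" for i j
      using q'
    proof (cases rule: proper_interval_cases)
      case left
      thus ?thesis using q hyperplane_subset_brick_span[of 1 j "?t z 1 j"]
        by (auto simp: V_def proper_intervals_def)
    next
      case right
      have "brick_span (i - 1) n \<subseteq> brick_span (i - 1 - 1) n" by (rule brick_span_mono) auto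
      moreover have "i \<noteq> 1" "i - 1 \<noteq> 1" using right by linarith+
      ultimately show ?thesis unfolding V_def using right by simp
    next
      case (middle a)
      hence a: "i - 1 = Suc a" by simp
      have idx: "(Suc a, j) \<in> idx n" using middle by (auto simp: idx_def)
      have "hyperplane (Suc a) j (?t z (Suc a) j) \<subseteq> hyperplane a j (?t z a j)"
        by (rule hyperplane_subset[OF restr_compat_iv[OF comp idx middle(2)] p[OF idx] tz[OF idx]]) auto
      moreover have "i \<noteq> 1" "j \<noteq> n" "a \<noteq> 0" using middle a by (auto simp: idx_def)
      ultimately show ?thesis using middle a by (simp add: V_def)
    qed
    have sub2: "V (i, j) \<subseteq> V (i, j + 1)"
      if q: "(i, j) \<in> proper_intervals n" and q': "(i, j + 1) \<in> proper_intervals n" for i j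
      using q
    proof (cases rule: proper_interval_cases)
      case left
      thus ?thesis by (simp add: V_def brick_span_mono)
    next
      case right
      thus ?thesis using q' by (auto simp: proper_intervals_def)
    next
      case (middle a)
      have ij: "i \<noteq> 1" "j \<noteq> n" "i - 1 = a" using middle by (auto simp: idx_def)
      show ?thesis
      proof (cases "j + 1 = n")
        case True
        thus ?thesis using ij hyperplane_subset_brick_span[of a j "?t z a j"] by (simp add: V_def)
      next
        case False
        have idx: "(a, j + 1) \<in> idx n" using middle False q' by (auto simp: idx_def proper_intervals_def)
        have "hyperplane a j (?t z a j) \<subseteq> hyperplane a (j + 1) (?t z a (j + 1))"
          by (rule hyperplane_subset[OF restr_compat_iv[OF comp middle(2) idx] p[OF middle(2)] tz[OF middle(2)]])
            auto
        thus ?thesis using ij False by (simp add: V_def)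
      qed
    qed
    have brick: "brick_point n ?y \<in> brick_points n"
      unfolding brick_points_def
    proof (intro CollectI conjI allI impI ballI)
      show "brick_point n ?y \<in> (\<Pi>\<^sub>E (i, j)\<in>proper_intervals n. grassmannian (j - i + 1) (n - 1))"
        using PiE by (simp add: case_prod_unfold)
      fix q assume q: "q \<in> proper_intervals n"
      obtain i j where ij: "q = (i, j)" by fastforce
      show "case q of (i, j) \<Rightarrow>
          ((i - 1, j) \<in> proper_intervals n \<longrightarrow> brick_point n ?y (i, j) \<subseteq> brick_point n ?y (i - 1, j)) \<and>
          ((i, j + 1) \<in> proper_intervals n \<longrightarrow> brick_point n ?y (i, j) \<subseteq> brick_point n ?y (i, j + 1))"
        using sub1[of i j] sub2[of i j] q V unfolding ij by simp
    next
      fix j assume "(1, j) \<in> proper_intervals n"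
      thus "brick_point n ?y (1, j) = brick_span 1 (j + 1)" by (simp add: V) (simp add: V_def)
    next
      fix i assume i: "(i, n) \<in> proper_intervals n"
      hence "i \<noteq> 1" by (auto simp: proper_intervals_def)
      thus "brick_point n ?y (i, n) = brick_span (i - 1) n" using i by (simp add: V) (simp add: V_def)
    qed
    have "?y \<in> hcoords (brick_manifold n)"
      unfolding hcoords_brick_iff using brick y1 y2 by blast
    moreover have "brick_point n ?y (Suc a, b) = hyperplane a b (?t z a b)"
      if "(a, b) \<in> idx n" "a < b" for a b
      using that V[OF proper_interval_Suc[OF that]] by (auto simp: V_def idx_def)
    ultimately show ?thesis using z comp unfolding brick_rel_def by blast
  qed
  thus ?thesis using P_polys r_polys r0 by blast
qed

text \<open>From frames to functionals. \<open>polynomial_functional\<close> is applied to each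
  interval separately; compatibility of the results is automatic, because nested kernels force
  proportional functionals.\<close>

lemma wonderful_lift:
  fixes y0 :: "(nat \<times> nat) \<times> nat \<times> nat \<Rightarrow> 'k::field alg_closure"
  assumes n: "n \<ge> 2" and y0: "y0 \<in> hcoords (brick_manifold n)"
  shows "\<exists>P r. (\<forall>i. P i \<in> polys) \<and> r \<in> polys \<and> r y0 \<noteq> 0 \<and>
    (\<forall>y\<in>hcoords (brick_manifold n). r y \<noteq> 0 \<longrightarrow>
      brick_rel n (\<lambda>i :: (nat \<Rightarrow> 'k) set option \<times> nat. P i y) y)"
proof -
  have frame: "inj_on (brick_vec y (Suc a, b)) {..<b - a} \<and>
      \<not> vs.dependent (brick_vec y (Suc a, b) ` {..<b - a}) \<and>
      brick_point n y (Suc a, b) = vs.span (brick_vec y (Suc a, b) ` {..<b - a}) \<and>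
      brick_vec y (Suc a, b) ` {..<b - a} \<subseteq> brick_span a (Suc b)"
    if y: "y \<in> hcoords (brick_manifold n)" and ab: "(a, b) \<in> idx n" "a < b"
    for y :: "(nat \<times> nat) \<times> nat \<times> nat \<Rightarrow> 'k alg_closure" and a b
  proof -
    have q: "(Suc a, b) \<in> proper_intervals n" by (rule proper_interval_Suc[OF ab])
    have d: "brick_dim (Suc a, b) = b - a" using ab by simp
    have pt: "brick_point n y (Suc a, b) = vs.span (brick_vec y (Suc a, b) ` {..<b - a})"
      using q d by (simp add: brick_point_def)
    have "brick_point n y (Suc a, b) \<subseteq> brick_span a (Suc b)"
      using y ab by (intro brick_subset_brick_span) (auto simp: hcoords_brick_iff)
    hence "brick_vec y (Suc a, b) ` {..<b - a} \<subseteq> brick_span a (Suc b)"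
      unfolding pt using vs.span_superset by (rule order.trans[rotated])
    moreover have "inj_on (brick_vec y (Suc a, b)) {..<b - a} \<and>
        \<not> vs.dependent (brick_vec y (Suc a, b) ` {..<b - a})"
      using y q d unfolding hcoords_brick_iff by metis
    ultimately show ?thesis using pt by blast
  qed
  \<comment> \<open>The number \<open>y ((Suc a, b), c, i)\<close> is entry \<open>i\<close> of
    frame vector \<open>c\<close> of the subspace at \<open>(Suc a, b)\<close>. For
    \<open>a = b\<close> there are no frame vectors, and only a nonzero entry is demanded.\<close>
  define annihilates where "annihilates a b t r \<longleftrightarrow> (\<forall>i. t i \<in> polys) \<and> r \<in> polys \<and> r y0 \<noteq> 0 \<and>
      (\<forall>y. r y \<noteq> 0 \<longrightarrow> (\<exists>i\<in>{a..b}. t i y \<noteq> 0) \<and>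
        (\<forall>c<b - a. (\<Sum>i\<in>{a..b}. t i y * y ((Suc a, b), c, i)) = 0))"
    for a b and t :: "nat \<Rightarrow> ((nat \<times> nat) \<times> nat \<times> nat \<Rightarrow> 'k alg_closure) \<Rightarrow> 'k alg_closure" and r
  have "\<exists>t r. annihilates a b t r" if ab: "(a, b) \<in> idx n" for a b
    unfolding annihilates_def
  proof (rule polynomial_functional)
    show "card {a..b} = Suc (b - a)" using ab by (auto simp: idx_def)
    fix u c assume u: "\<forall>i\<in>{a..b}. (\<Sum>c<b - a. u c * y0 ((Suc a, b), c, i)) = 0" and c: "c < b - a"
    hence "a < b" by simp
    note F = frame[OF y0 ab this]
    have "(\<Sum>c<b - a. scl (u c) (brick_vec y0 (Suc a, b) c)) = 0"
    proof
      fix i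
      show "(\<Sum>c<b - a. scl (u c) (brick_vec y0 (Suc a, b) c)) i = 0 i"
      \<comment> \<open>The assumption on \<open>u\<close> concerns the coordinates in
        \<open>{a..b}\<close>; at the others the frame vectors vanish, being contained in
        \<open>brick_span a (Suc b)\<close>.\<close>
      proof (cases "i \<in> {a..b}")
        case True
        thus ?thesis using u by (simp add: sum_fun_apply scl_def comp_at_def)
      next
        case False
        hence "brick_vec y0 (Suc a, b) c i = 0" if "c < b - a" for c
          using F that unfolding brick_span_eq by fastforce
        thus ?thesis by (simp add: sum_fun_apply scl_def)
      qed
    qed
    thus "u c = 0"
      using F c frame_iff[of "{..<b - a}" "brick_vec y0 (Suc a, b)"] by blast
  qed (auto intro: polys.coord)
  then obtain t r where tr: "\<And>a b. (a, b) \<in> idx n \<Longrightarrow> annihilates a b (t a b) (r a b)"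
    by metis
  have t: "t a b i \<in> polys" and r: "r a b \<in> polys" "r a b y0 \<noteq> 0"
    if "(a, b) \<in> idx n" for a b i
    using tr[OF that] by (simp_all add: annihilates_def)
  have nz: "\<exists>i\<in>{a..b}. t a b i y \<noteq> 0"
    and kill: "c < b - a \<Longrightarrow> (\<Sum>i\<in>{a..b}. t a b i y * y ((Suc a, b), c, i)) = 0"
    if "(a, b) \<in> idx n" "r a b y \<noteq> 0" for a b y c
    using tr[OF that(1)] that(2) by (simp_all add: annihilates_def)
  \<comment> \<open>Through \<open>bounds\<close>, the index \<open>None\<close> uses the functional
    of the full interval, so these two components coincide.\<close>
  define tj where "tj j k y = t (fst (bounds n j)) (snd (bounds n j)) k y"
    for j :: "(nat \<Rightarrow> 'k) set option" and k y
  define P where "P = (\<lambda>(j :: (nat \<Rightarrow> 'k) set option, s) y.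
    if j \<in> ncA_index n then of_gaps n (\<lambda>k. tj j k y) s else 0)"
  define R where "R y = (\<Prod>(a, b)\<in>idx n. r a b y)" for y
  have P_polys: "P i \<in> polys" for i
  proof -
    obtain j s where i: "i = (j, s)" by fastforce
    show ?thesis
    proof (cases "j \<in> ncA_index n \<and> s \<in> {1..n}")
      case True
      have "tj j k \<in> polys" for k
        unfolding tj_def[abs_def] using bounds_in_idx[OF _ n, of j] True t by simp
      hence "(\<lambda>y. \<Sum>k=s..<n. tj j k y) \<in> polys" by (intro polys_sum)
      thus ?thesis using True by (simp add: i P_def of_gaps_def)
    next
      case False
      hence "P i = (\<lambda>y. 0)" by (auto simp: i P_def of_gaps_def)
      thus ?thesis using polys_0 by simp
    qed
  qed
  have R_polys: "R \<in> polys"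
    unfolding R_def[abs_def] case_prod_beta using r(1) by (intro polys_prod) auto
  have R0: "R y0 \<noteq> 0" unfolding R_def using r(2) finite_idx by auto
  have "brick_rel n (\<lambda>i. P i y) y" if y: "y \<in> hcoords (brick_manifold n)" and Ry: "R y \<noteq> 0" for y
  proof -
    let ?z = "\<lambda>i. P i y"
    have ry: "r a b y \<noteq> 0" if "(a, b) \<in> idx n" for a b
      using Ry that finite_idx unfolding R_def by auto
    have comp: "comp_at ?z j = (if j \<in> ncA_index n then of_gaps n (\<lambda>k. tj j k y) else 0)" for j
      by (auto simp: P_def comp_at_def fun_eq_iff)
    have gz: "gaps_at ?z j i = t a b i y"
      if "j \<in> ncA_index n" "bounds n j = (a, b)" "i \<in> {a..b}" for j a b i
      using that bounds_in_idx[OF that(1) n] by (auto simp: comp gaps_of_gaps tj_def idx_def)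
    have hyp: "brick_point n y (Suc a, b) = hyperplane a b (\<lambda>i. t a b i y)"
      if ab: "(a, b) \<in> idx n" "a < b" for a b
    proof -
      note F = frame[OF y ab]
      obtain p where p: "p \<in> {a..b}" "t a b p y \<noteq> 0" using nz[OF ab(1) ry[OF ab(1)]] by blast
      have "brick_vec y (Suc a, b) ` {..<b - a} \<subseteq> hyperplane a b (\<lambda>i. t a b i y)"
      proof
        fix v assume "v \<in> brick_vec y (Suc a, b) ` {..<b - a}"
        then obtain c where c: "c < b - a" "v = brick_vec y (Suc a, b) c" by blast
        have "v \<in> brick_span a (Suc b)" using F c by blast
        thus "v \<in> hyperplane a b (\<lambda>i. t a b i y)"
          using kill[OF ab(1) ry[OF ab(1)] c(1)] c(2)
          by (auto simp: brick_span_eq hyperplane_def comp_at_def)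
      qed
      with F show ?thesis
        using span_frame_eq_hyperplane[where t = "\<lambda>i. t a b i y", OF p] by metis
    qed
    have "?z \<in> hcoords (ncA_ambient n)"
      unfolding hcoords_ambient_iff
    proof (intro conjI ballI allI impI)
      fix j :: "(nat \<Rightarrow> 'k) set option" assume j: "j \<in> ncA_index n"
      obtain a b where b: "bounds n j = (a, b)" by fastforce
      have ab: "(a, b) \<in> idx n" using bounds_in_idx[OF j n] b by simp
      show "comp_at ?z j \<in> vecs n" using j by (simp add: comp of_gaps_in_vecs)
      show "\<exists>i\<in>rng n j. gaps_at ?z j i \<noteq> 0"
        using nz[OF ab ry[OF ab]] gz[OF j b] b by auto
    qed (simp add: comp)
    moreover have "restr_compat n ?z"
      unfolding restr_compat_def
    proof (intro ballI impI)
      fix j j' :: "(nat \<Rightarrow> 'k) set option"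
      assume j: "j \<in> ncA_index n" and j': "j' \<in> ncA_index n" and sub: "rng n j \<subseteq> rng n j'"
      obtain a b a' b' where b: "bounds n j = (a, b)" "bounds n j' = (a', b')" by fastforce
      have ab: "(a, b) \<in> idx n" "(a', b') \<in> idx n"
        using bounds_in_idx[OF j n] bounds_in_idx[OF j' n] b by simp_all
      have le: "a \<le> b" "a' \<le> a" "b \<le> b'" using sub b ab by (auto simp: idx_def)
      have "parallel {a..b} (\<lambda>i. t a b i y) (\<lambda>i. t a' b' i y)"
      proof (cases "a < b")
        case True
        have lt: "a' < b'" using True le by simp
        have "brick_point n y (Suc a, b) \<subseteq> brick_point n y (Suc a', b')"
          using y True le proper_interval_Suc[OF ab(2) lt]
          by (intro brick_mono) (auto simp: hcoords_brick_iff)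
        thus ?thesis
          unfolding hyp[OF ab(1) True] hyp[OF ab(2) lt] using le
          by (intro parallel_if_hyperplane_subset) auto
      next
        \<comment> \<open>The interval is a single gap, where any two vectors are
          proportional.\<close>
        case False
        thus ?thesis using le by (auto simp: parallel_def)
      qed
      thus "parallel (rng n j) (gaps_at ?z j) (gaps_at ?z j')"
        using gz[OF j b(1)] gz[OF j' b(2)] le by (simp add: b parallel_def)
    qed
    moreover have "brick_point n y (Suc a, b) = hyperplane a b (gaps_at ?z (iv a b))"
      if ab: "(a, b) \<in> idx n" "a < b" for a b
      unfolding hyp[OF ab]
      using gz[OF iv_in_ncA_index[OF ab(1)] bounds_iv[OF ab(1)]] by (intro hyperplane_cong) simp
    ultimately show ?thesis using y unfolding brick_rel_def by blast
  qed
  thus ?thesis using P_polys R_polys R0 by blast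
qed

theorem theorem5p2p1:
  fixes n :: nat
  assumes "n \<ge> 2"
  shows "isomorphic (wonderful_model n (diag n) (ncA_min n :: (nat \<Rightarrow> 'k::field) set set))
           (brick_manifold n)"
proof (rule isomorphicI_relation[where R = "brick_rel n"])
  let ?W = "wonderful_model n (diag n) (ncA_min n :: (nat \<Rightarrow> 'k) set set)"
  note W = hcoords_wonderful_model[OF assms, where 'k = 'k]
  have pt: "point_of ?W = point_of (ncA_ambient n)"
    by (simp add: wonderful_model_def subvariety_def)
  show "z \<in> hcoords ?W \<and> y \<in> hcoords (brick_manifold n)" if "brick_rel n z y" for z y
    using that by (simp add: W brick_rel_def)
  show "point_of ?W z = point_of ?W z' \<longleftrightarrow> point_of (brick_manifold n) y = point_of (brick_manifold n) y'"
    if "brick_rel n z y" "brick_rel n z' y'" for z y z' y'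
    using brick_rel_point_eq_iff[OF assms that] by (simp add: pt point_of_brick)
  show "\<exists>P r. (\<forall>i. P i \<in> polys) \<and> r \<in> polys \<and> r z0 \<noteq> 0 \<and>
      (\<forall>z\<in>hcoords ?W. r z \<noteq> 0 \<longrightarrow> brick_rel n z (\<lambda>i. P i z))"
    if "z0 \<in> hcoords ?W" for z0
  proof -
    have "z0 \<in> hcoords (ncA_ambient n)" using that by (simp add: W)
    from brick_lift[OF assms this] show ?thesis unfolding W by blast
  qed
  show "\<exists>P r. (\<forall>i. P i \<in> polys) \<and> r \<in> polys \<and> r y0 \<noteq> 0 \<and>
      (\<forall>y\<in>hcoords (brick_manifold n). r y \<noteq> 0 \<longrightarrow> brick_rel n (\<lambda>i. P i y) y)"
    if "y0 \<in> hcoords (brick_manifold n)" for y0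
    by (rule wonderful_lift[OF assms that])
qed

end
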